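(* There exist non-negative real constants $c_{n,k}$ ($n\geqslant 2$, $2\leqslant k\leqslant n$), not depending on any sequence, with the following properties. (i) For every $0<\varepsilon\leqslant1$ there is a constant $C(\varepsilon)>0$ depending only on $\varepsilon$ such that for all $n\geqslant2$, \[ \sum_{k=2}^{n-1}c_{n,k}\,k(\log k)^{\varepsilon}\leqslant C(\varepsilon)\,n(\log n)^{\varepsilon-1}. \] (ii) For every fixed $k$, $c_{n,k}=o(n)$ as $n\to\infty$. (iii) If $(a_k)_{k\geqslant1}$ is a sequence of complex numbers such that, with $S(x)=\sum_{k\leqslant x}a_k\left[\frac{x}{k}\right]\log k$, one has $\lim_{k\to\infty}|S(k)|/k^{v}=0$ for every $v>1$, then $g(v)=\sum_{m=1}^\infty a_m m^{-v}$ converges for all $v>1$, and for all $n\geqslant 2$ \[ \left|\sum_{m=1}^n a_m\left[\frac{n}{m}\right]-n\,g\Bigl(1+\frac{1}{\log n}\Bigr)\right| \ll\sum_{k=2}^{n}c_{n,k}|S(k)|+\frac{n}{\log n}\sum_{k=n}^\infty\frac{|S(k)|}{k^{2+1/\log n}\log k}, \] with an absolute implied constant.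
   Context: $[x]$ denotes the integer part of a real number $x$. *)

theory Defs
  imports "HOL-Analysis.Analysis"
begin

text \<open>S(x) = sum over k \<le> x of a_k [x/k] log k, evaluated at a natural number x
  (only integer arguments occur in the statement); for natural x, [x/k] = x div k.
  The sequence a is indexed from 1; a 0 is irrelevant.\<close>
definition Sfun :: "(nat \<Rightarrow> complex) \<Rightarrow> nat \<Rightarrow> complex" where
  "Sfun a x = (\<Sum>k=1..x. a k * of_real (real (x div k) * ln (real k)))"

definition gser :: "(nat \<Rightarrow> complex) \<Rightarrow> real \<Rightarrow> complex" where
  "gser a v = (\<Sum>m. a (Suc m) / of_real (real (Suc m) powr v))"

end

theory Submission
  imports Defs "HOL-Computational_Algebra.Squarefree" "HOL-Real_Asymp.Real_Asymp"
begin

text \<open>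
  Write \<open>L = ln n\<close>. Partial summation and Moebius inversion express the deviation as a sum of
  \<open>S(k) (h(k) - h(k+1))\<close> with \<open>h(k) = w(k) - n I(k)\<close>, where, with \<open>f\<^sub>t(m) = \<Prod>\<^bsub>p|m\<^esub> (1 - p\<^sup>-\<^sup>t)\<close>,
  \<open>w(k)\<close> is the integral of \<open>k\<^sup>-\<^sup>t \<Sum>\<^bsub>m \<le> n/k\<^esub> f\<^sub>t(m)\<close> over \<open>t \<ge> 0\<close> and \<open>I(k)\<close> is the integral of
  \<open>k\<^sup>-\<^sup>1\<^sup>-\<^sup>t / \<zeta>(1+t)\<close> over \<open>t \<ge> 1/L\<close>. Take \<open>c\<^bsub>n,k\<^esub> = |h(k) - h(k+1)|\<close>. For \<open>k > n\<close> only \<open>I\<close> contributes,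
  and \<open>1/\<zeta>(1+t) \<le> t\<close> gives the tail of (iii).

  Both (i) and (ii) follow from \<open>\<Sum>\<^bsub>k\<le>n\<^esub> k c\<^bsub>n,k\<^esub> = O(n/L)\<close>. Selberg's sieve for \<open>f\<^sub>t\<close> on the interval
  \<open>(n/(k+1), n/k]\<close> bounds \<open>h(k) - h(k+1)\<close> from above by \<open>O(n/(kL)\<^sup>2)\<close> for \<open>k \<le> n\<^bsup>1/4\<^esup>\<close>; for larger \<open>k\<close> it is
  bounded below since \<open>w\<close> decreases. The absolute values can thus be removed, and the signed sums
  \<open>\<Sum> k\<^sup>-\<^sup>\<tau> h(k)\<close> with \<open>\<tau> = O(1/L)\<close> are \<open>O(n/L)\<close> by rearranging them along the products \<open>j = ke\<close>.
\<close>

subsection \<open>The Moebius function and its twisted divisor sums\<close>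

text \<open>The integrals over t arise because \<open>S\<close> carries weights \<open>ln k\<close>
  that must be divided out again, and 1/ln j is the integral of j^-t over t >= 0. What is gained is
  positivity: the Moebius sums defining the weights alternate, but under the integral sign they
  become sums of nonnegative f_t(m) and the positive factor 1/zeta(1+t). Since f_t has mean value
  1/zeta(1+t), n I(k) is the expected size of w(k) without the range t < 1/L; this cut at 1/L is the
  same as evaluating g at 1 + 1/L. The obstacle is the absolute value in c: the tools bound each
  increment of h well from one side only. Signed sums are accessible because the Dirichlet series of
  f_tau at 1+a is zeta(1+a)/zeta(1+a+tau); for a = 1/L and tau of the same order, pole and zero
  cancel up to a bounded factor. Hence the weight k is replaced by partial sums of combinations of
  l^-a, l^-2a and l^-3a, which are comparable to k where this is needed.\<close>

definition moebius_mu :: "nat \<Rightarrow> real" where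
  "moebius_mu n = (if squarefree n then (-1) ^ card (prime_factors n) else 0)"

lemma abs_moebius_mu_le: "\<bar>moebius_mu n\<bar> \<le> 1"
  by (simp add: moebius_mu_def)

lemma prime_factors_prod_primes:
  fixes A :: "nat set"
  assumes "finite A" "\<And>p. p \<in> A \<Longrightarrow> prime p"
  shows "prime_factors (\<Prod>A) = A"
proof -
  have "prime_factors (\<Prod>A) = (\<Union>p\<in>A. prime_factors p)"
    using assms by (subst prime_factors_prod) (auto dest: prime_gt_0_nat)
  also have "\<dots> = A" using assms(2) by (auto simp: prime_prime_factors)
  finally show ?thesis .
qed

lemma squarefree_prod_primes:
  fixes A :: "nat set"
  assumes "finite A" "\<And>p. p \<in> A \<Longrightarrow> prime p"
  shows "squarefree (\<Prod>A)"
  using assms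
proof (induction A rule: finite_induct)
  case (insert p A)
  have "coprime p (\<Prod>A)"
    using insert by (intro prod_coprime_right) (auto intro!: primes_coprime)
  thus ?case using insert by (auto simp: squarefree_mult_coprime squarefree_prime)
qed simp

lemma prod_primes_dvd:
  fixes A :: "nat set"
  assumes "finite A" "\<And>p. p \<in> A \<Longrightarrow> prime p" "\<And>p. p \<in> A \<Longrightarrow> p dvd m"
  shows "\<Prod>A dvd m"
  using assms
proof (induction A rule: finite_induct)
  case (insert p A)
  have "coprime p (\<Prod>A)"
    using insert by (intro prod_coprime_right) (auto intro!: primes_coprime)
  thus ?case using insert by (auto intro!: divides_mult)
qed simp

lemma squarefree_eq_prod_prime_factors:
  fixes e :: nat
  assumes "squarefree e"
  shows "\<Prod>(prime_factors e) = e"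
proof -
  have e: "e > 0" using assms by (auto intro: Nat.gr0I)
  have "e = (\<Prod>p\<in>prime_factors e. p ^ multiplicity p e)"
    using e by (simp add: prime_factorization_nat)
  also have "\<dots> = \<Prod>(prime_factors e)"
    using assms e by (intro prod.cong refl) (auto simp: squarefree_factorial_semiring')
  finally show ?thesis by simp
qed

text \<open>Only squarefree divisors contribute, and these are the products of subsets of the prime
  factors of \<open>m\<close>. Complete multiplicativity of \<open>x\<close> turns the sum into the
  expansion of the product over those subsets.\<close>

lemma sum_moebius_mu_divisors:
  fixes x :: "nat \<Rightarrow> real"
  assumes m: "m > 0" and x1: "x 1 = 1" and xm: "\<And>a b. x (a * b) = x a * x b"
  shows "(\<Sum>e | e dvd m. moebius_mu e * x e) = (\<Prod>p\<in>prime_factors m. 1 - x p)"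
proof -
  let ?P = "prime_factors m"
  have xprod: "x (\<Prod>A) = (\<Prod>p\<in>A. x p)" if "finite A" for A
    using that by (induction A rule: finite_induct) (simp_all add: x1[simplified] xm)
  have "(\<Sum>e | e dvd m. moebius_mu e * x e) = (\<Sum>e | e dvd m \<and> squarefree e. moebius_mu e * x e)"
    using m by (intro sum.mono_neutral_right) (auto simp: moebius_mu_def)
  also have "\<dots> = (\<Sum>A\<in>Pow ?P. (\<Prod>p\<in>A. - x p))"
  proof (rule sum.reindex_bij_witness[where i = "\<lambda>A. \<Prod>A" and j = prime_factors])
    fix e assume e: "e \<in> {e. e dvd m \<and> squarefree e}"
    show "\<Prod>(prime_factors e) = e" using e squarefree_eq_prod_prime_factors by auto
    show "prime_factors e \<in> Pow ?P" using e m dvd_prime_factors[of m e] by auto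
    have "(\<Prod>p\<in>prime_factors e. - x p) = (-1) ^ card (prime_factors e) * x (\<Prod>(prime_factors e))"
      by (subst xprod) (auto simp: prod_uminus)
    also have "\<Prod>(prime_factors e) = e" using e squarefree_eq_prod_prime_factors by auto
    finally show "(\<Prod>p\<in>prime_factors e. - x p) = moebius_mu e * x e"
      using e by (simp add: moebius_mu_def)
  next
    fix A assume A: "A \<in> Pow ?P"
    hence f: "finite A" by (auto intro: finite_subset)
    have pr: "\<And>p. p \<in> A \<Longrightarrow> prime p" and dv: "\<And>p. p \<in> A \<Longrightarrow> p dvd m" using A by auto
    show "prime_factors (\<Prod>A) = A" by (rule prime_factors_prod_primes[OF f pr])
    show "\<Prod>A \<in> {e. e dvd m \<and> squarefree e}"
      using prod_primes_dvd[OF f pr dv] squarefree_prod_primes[OF f pr] by auto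
  qed
  also have "\<dots> = (\<Prod>p\<in>?P. (- x p) + 1)"
    by (subst prod_add) simp_all
  finally show ?thesis by (simp add: algebra_simps)
qed

text \<open>This is \<open>f\<^sub>t(m)\<close> of the overview, defined by its divisor sum because
  summation over \<open>m\<close> uses that form. The Euler product shown next supplies
  nonnegativity and the bound 1.\<close>

definition moebius_twist :: "real \<Rightarrow> nat \<Rightarrow> real" where
  "moebius_twist t m = (\<Sum>e | e dvd m. moebius_mu e * real e powr (-t))"

lemma moebius_twist_eq_prod:
  assumes "m > 0"
  shows "moebius_twist t m = (\<Prod>p\<in>prime_factors m. 1 - real p powr (-t))"
  unfolding moebius_twist_def by (rule sum_moebius_mu_divisors) (use assms in \<open>auto simp: powr_mult\<close>)

lemma moebius_twist_nonneg:
  assumes "m > 0" "t \<ge> 0"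
  shows "moebius_twist t m \<ge> 0"
  unfolding moebius_twist_eq_prod[OF assms(1)]
proof (intro prod_nonneg)
  fix p assume "p \<in> prime_factors m"
  hence "real p \<ge> 1" using prime_ge_1_nat[of p] by auto
  thus "0 \<le> 1 - real p powr (-t)" using assms by (simp add: powr_minus ge_one_powr_ge_zero inverse_le_1_iff)
qed

lemma moebius_twist_le_1:
  assumes "m > 0" "t \<ge> 0"
  shows "moebius_twist t m \<le> 1"
  unfolding moebius_twist_eq_prod[OF assms(1)]
proof (intro prod_le_1)
  fix p assume "p \<in> prime_factors m"
  hence "real p \<ge> 1" using prime_ge_1_nat[of p] by auto
  thus "0 \<le> 1 - real p powr (-t) \<and> 1 - real p powr (-t) \<le> 1"
    using assms by (simp add: powr_minus ge_one_powr_ge_zero inverse_le_1_iff)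
qed

lemma moebius_twist_0:
  assumes "m > 0"
  shows "moebius_twist 0 m = (if m = 1 then 1 else 0)"
proof (cases "m = 1")
  case False
  then obtain p where "p \<in> prime_factors m"
    using assms by (metis One_nat_def Suc_lessI dvd_refl in_prime_factors_iff less_numeral_extra(3) prime_factor_nat)
  moreover from this have "p > 0" using in_prime_factors_imp_prime prime_gt_0_nat by blast
  ultimately show ?thesis using False
    by (auto simp: moebius_twist_eq_prod[OF assms] intro!: prod_zero bexI[of _ p])
qed (auto simp: moebius_twist_eq_prod)

text \<open>Up to sign the sum is i^-t times the product of p^t - 1. The radical of \<open>i\<close>
  is at most \<open>i\<close>, so i^-t is at most the product of p^-t, which leaves the product of 1
  - p^-t. Signed coefficients are thereby replaced by a nonnegative function with a known Dirichlet
  series.\<close>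

lemma moebius_mu_convolution_bound:
  assumes i: "i > 0" and t: "t \<ge> 0"
  shows "\<bar>\<Sum>e | e dvd i. moebius_mu e * real (i div e) powr (-t)\<bar> \<le> moebius_twist t i"
proof -
  let ?P = "prime_factors i"
  have "(\<Sum>e | e dvd i. moebius_mu e * real (i div e) powr (-t))
      = (\<Sum>e | e dvd i. real i powr (-t) * (moebius_mu e * real e powr t))"
  proof (intro sum.cong refl)
    fix e assume "e \<in> {e. e dvd i}"
    hence e: "e dvd i" "e > 0" using i by (auto intro: Nat.gr0I)
    have "real (i div e) = real i / real e" using e(1) by (simp add: real_of_nat_div)
    hence "real (i div e) powr (-t) = real i powr (-t) * real e powr t"
      by (simp add: powr_divide powr_minus) (simp add: divide_inverse)
    thus "moebius_mu e * real (i div e) powr (-t) = real i powr (-t) * (moebius_mu e * real e powr t)"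
      by simp
  qed
  also have "\<dots> = real i powr (-t) * (\<Prod>p\<in>?P. 1 - real p powr t)"
    unfolding sum_distrib_left[symmetric]
    by (subst sum_moebius_mu_divisors) (use i in \<open>auto simp: powr_mult\<close>)
  finally have eq: "(\<Sum>e | e dvd i. moebius_mu e * real (i div e) powr (-t))
      = real i powr (-t) * (\<Prod>p\<in>?P. 1 - real p powr t)" .
  have p1: "real p \<ge> 1" if "p \<in> ?P" for p using that prime_ge_1_nat[of p] by auto
  have pg: "real p powr t \<ge> 1" if "p \<in> ?P" for p using p1[OF that] t by (simp add: ge_one_powr_ge_zero)
  have "\<Prod>?P dvd i" by (rule prod_primes_dvd) auto
  hence "\<Prod>?P \<le> i" using i by (intro dvd_imp_le) auto
  hence "real (\<Prod>?P) \<le> real i" by (simp only: of_nat_le_iff)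
  moreover have "\<Prod>?P > 0"
    by (rule prod_pos) (use in_prime_factors_imp_prime prime_gt_0_nat in blast)
  ultimately have "real i powr (-t) \<le> real (\<Prod>?P) powr (-t)"
    using t by (intro powr_mono2') (simp_all only: of_nat_0_less_iff neg_le_0_iff_le)
  also have "\<dots> = (\<Prod>p\<in>?P. real p powr (-t))"
    by (simp add: prod_powr_distrib of_nat_prod del: of_nat_prod[symmetric])
  finally have ip: "real i powr (-t) \<le> (\<Prod>p\<in>?P. real p powr (-t))" .
  have "\<bar>\<Sum>e | e dvd i. moebius_mu e * real (i div e) powr (-t)\<bar> = real i powr (-t) * (\<Prod>p\<in>?P. real p powr t - 1)"
    unfolding eq abs_mult abs_prod using pg by (simp cong: prod.cong)
  also have "\<dots> \<le> (\<Prod>p\<in>?P. real p powr (-t)) * (\<Prod>p\<in>?P. real p powr t - 1)"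
    using pg by (intro mult_right_mono ip prod_nonneg) auto
  also have "\<dots> = (\<Prod>p\<in>?P. 1 - real p powr (-t))"
    unfolding prod.distrib[symmetric]
    by (intro prod.cong refl) (use p1 in \<open>force simp: powr_minus field_simps\<close>)
  also have "\<dots> = moebius_twist t i" using moebius_twist_eq_prod i by simp
  finally show ?thesis .
qed

lemma sum_divisor_sums:
  fixes g :: "nat \<Rightarrow> 'a :: comm_semiring_1"
  shows "(\<Sum>m=1..X. \<Sum>e | e dvd m. g e) = (\<Sum>e=1..X. of_nat (X div e) * g e)"
proof -
  have "(\<Sum>m=1..X. \<Sum>e | e dvd m. g e) = (\<Sum>m=1..X. \<Sum>e\<in>{1..X}. if e dvd m then g e else 0)"
  proof (rule sum.cong[OF refl])
    fix m assume m: "m \<in> {1..X}"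
    have "(\<Sum>e | e dvd m. g e) = (\<Sum>e\<in>{e\<in>{1..X}. e dvd m}. g e)"
      using m by (intro sum.cong) (auto dest: dvd_imp_le intro: Nat.gr0I order.trans)
    thus "(\<Sum>e | e dvd m. g e) = (\<Sum>e\<in>{1..X}. if e dvd m then g e else 0)"
      by (simp only: sum.inter_filter[OF finite_atLeastAtMost, symmetric])
  qed
  also have "\<dots> = (\<Sum>e=1..X. \<Sum>m=1..X. if e dvd m then g e else 0)" by (rule sum.swap)
  also have "\<dots> = (\<Sum>e=1..X. of_nat (X div e) * g e)"
  proof (rule sum.cong[OF refl])
    fix e assume e: "e \<in> {1..X}"
    have "(\<Sum>m=1..X. if e dvd m then g e else 0) = of_nat (card {m\<in>{1..X}. e dvd m}) * g e"
      by (simp add: sum.If_cases Int_def)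
    also have "card {m\<in>{1..X}. e dvd m} = card {1..X div e}"
    proof (rule bij_betw_same_card[symmetric], rule bij_betwI[where f = "\<lambda>d. d * e" and g = "\<lambda>m. m div e"])
      show "(\<lambda>d. d * e) \<in> {1..X div e} \<rightarrow> {m \<in> {1..X}. e dvd m}"
        using e by (auto simp: less_eq_div_iff_mult_less_eq)
      show "(\<lambda>m. m div e) \<in> {m \<in> {1..X}. e dvd m} \<rightarrow> {1..X div e}"
        using e by (auto simp: div_le_mono Suc_le_eq div_greater_zero_iff dvd_imp_le)
    qed (use e in auto)
    finally show "(\<Sum>m=1..X. if e dvd m then g e else 0) = of_nat (X div e) * g e" by simp
  qed
  finally show ?thesis .
qed

subsection \<open>Selberg's sieve\<close>

text \<open>For the density g = p^(-1-t) of the twisted problem this is Selberg's g/(1-g). It is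
  also the sum of p^(-j(1+t)) over j >= 1, which is how \<open>selberg_G\<close> gets compared with
  zeta.\<close>

definition selberg_h :: "real \<Rightarrow> nat \<Rightarrow> real" where
  "selberg_h t p = 1 / (real p powr (1 + t) - 1)"

text \<open>A squarefree number is encoded by the set of its prime factors.\<close>

definition sieve_sets :: "nat \<Rightarrow> nat set set" where
  "sieve_sets R = {A. A \<subseteq> {p. prime p \<and> p \<le> R} \<and> \<Prod>A \<le> R}"

definition selberg_G :: "real \<Rightarrow> nat \<Rightarrow> real" where
  "selberg_G t R = (\<Sum>A\<in>sieve_sets R. \<Prod>p\<in>A. selberg_h t p)"

lemma finite_primes_le: "finite {p::nat. prime p \<and> p \<le> R}"
  by (rule finite_subset[of _ "{..R}"]) auto

lemma finite_sieve_sets: "finite (sieve_sets R)"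
  unfolding sieve_sets_def
  by (rule finite_subset[of _ "Pow {p. prime p \<and> p \<le> R}"]) (auto simp: finite_primes_le)

lemma sieve_setsD:
  assumes "A \<in> sieve_sets R"
  shows "finite A" "\<And>p. p \<in> A \<Longrightarrow> prime p" "\<Prod>A \<le> R"
  using assms finite_subset[OF _ finite_primes_le[of R], of A] by (auto simp: sieve_sets_def)

lemma card_sieve_sets_le: "card (sieve_sets R) \<le> R"
proof -
  have "card (sieve_sets R) \<le> card {1..R}"
  proof (rule card_inj_on_le[where f = "\<lambda>A. \<Prod>A"])
    show "inj_on (\<lambda>A. \<Prod>A) (sieve_sets R)"
      by (rule inj_on_inverseI[where g = prime_factors])
         (use sieve_setsD in \<open>auto intro!: prime_factors_prod_primes\<close>)
    show "(\<lambda>A. \<Prod>A) ` sieve_sets R \<subseteq> {1..R}"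
    proof
      fix x assume "x \<in> (\<lambda>A. \<Prod>A) ` sieve_sets R"
      then obtain A where A: "A \<in> sieve_sets R" "x = \<Prod>A" by auto
      have "x > 0" unfolding A(2) by (rule prod_pos) (use sieve_setsD[OF A(1)] prime_gt_0_nat in auto)
      thus "x \<in> {1..R}" using sieve_setsD(3)[OF A(1)] A(2) by (simp add: Suc_le_eq)
    qed
  qed auto
  thus ?thesis by simp
qed

lemma selberg_h_bounds:
  assumes "prime p" "t \<ge> 0"
  shows "selberg_h t p > 0" "selberg_h t p \<le> 1"
    "real p powr (-1 - t) * (1 + selberg_h t p) = selberg_h t p"
proof -
  have "real p \<ge> 2" using prime_ge_2_nat[OF assms(1)] by simp
  moreover have "real p powr 1 \<le> real p powr (1 + t)" using assms calculation by (intro powr_mono) auto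
  ultimately have *: "real p powr (1 + t) \<ge> 2" by simp
  show "selberg_h t p > 0" "selberg_h t p \<le> 1" using * by (auto simp: selberg_h_def field_simps)
  define u where "u = real p powr (1 + t)"
  have pu: "real p powr (-1 - t) = inverse u"
    by (simp add: u_def powr_minus[symmetric])
  show "real p powr (-1 - t) * (1 + selberg_h t p) = selberg_h t p"
  proof -
    have "u > 1" using * u_def by simp
    hence "inverse u * (1 + 1 / (u - 1)) = 1 / (u - 1)" by (simp add: divide_simps)
    thus ?thesis unfolding pu selberg_h_def u_def[symmetric] .
  qed
qed

lemma card_multiples_interval:
  fixes a b d :: nat
  assumes "a \<le> b" "d > 0"
  shows "\<bar>real (card {m\<in>{a<..b}. d dvd m}) - real (b - a) / real d\<bar> \<le> 1"
proof -
  have "card {m\<in>{a<..b}. d dvd m} = card {a div d <.. b div d}"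
  proof (rule bij_betw_same_card[symmetric], rule bij_betwI[where f = "\<lambda>k. k * d" and g = "\<lambda>m. m div d"])
    show "(\<lambda>k. k * d) \<in> {a div d<..b div d} \<rightarrow> {m \<in> {a<..b}. d dvd m}"
      using assms by (auto simp: less_eq_div_iff_mult_less_eq div_less_iff_less_mult)
    show "(\<lambda>m. m div d) \<in> {m \<in> {a<..b}. d dvd m} \<rightarrow> {a div d<..b div d}"
      using assms by (auto simp: div_le_mono div_less_iff_less_mult)
  qed (use assms in auto)
  also have "\<dots> = b div d - a div d" by simp
  also have "real (b div d - a div d) = real (b div d) - real (a div d)"
    using div_le_mono[OF assms(1)] by (simp add: of_nat_diff)
  finally have 1: "real (card {m\<in>{a<..b}. d dvd m}) = real (b div d) - real (a div d)" .
  have f: "real x / real d - 1 \<le> real (x div d)" "real (x div d) \<le> real x / real d" for x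
  proof -
    show "real (x div d) \<le> real x / real d" by (rule of_nat_div_le_of_nat)
    have "real x = real (x div d) * real d + real (x mod d)"
      by (metis div_mult_mod_eq of_nat_add of_nat_mult)
    moreover have "real (x mod d) < real d" using assms by simp
    ultimately show "real x / real d - 1 \<le> real (x div d)" using assms by (simp add: field_simps)
  qed
  have "real (b - a) / real d = real b / real d - real a / real d"
    using assms by (simp add: of_nat_diff diff_divide_distrib)
  thus ?thesis using 1 f[of a] f[of b] by linarith
qed

text \<open>Expanding over the subsets \<open>B\<close> of \<open>N\<close> leaves counts of
  multiples of \<open>\<Prod>B\<close>, each equal to \<open>(b - a) / \<Prod>B\<close> up to an
  error of 1. The main terms reassemble to the product with every indicator replaced by its mean
  \<open>1 / p\<close>, and the absolute coefficients of the errors to the product on the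
  right.\<close>

lemma sum_prod_affine_le:
  fixes \<alpha> \<beta> :: "nat \<Rightarrow> real" and a b :: nat
  assumes N: "finite N" "\<And>p. p \<in> N \<Longrightarrow> prime p" and ab: "a \<le> b"
  shows "\<bar>(\<Sum>m\<in>{a<..b}. \<Prod>p\<in>N. \<alpha> p + \<beta> p * (if p dvd m then 1 else 0))
           - real (b - a) * (\<Prod>p\<in>N. \<alpha> p + \<beta> p / real p)\<bar> \<le> (\<Prod>p\<in>N. \<bar>\<alpha> p\<bar> + \<bar>\<beta> p\<bar>)"
proof -
  let ?c = "\<lambda>B. (\<Prod>p\<in>B. \<beta> p) * (\<Prod>p\<in>N-B. \<alpha> p)"
  let ?M = "\<lambda>d. card {m\<in>{a<..b}. d dvd m}"
  have fB: "finite B" if "B \<in> Pow N" for B using that N(1) by (auto intro: finite_subset)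
  have dvd_iff: "(\<Prod>p\<in>B. if p dvd m then 1 else 0 :: real) = (if \<Prod>B dvd m then 1 else 0)"
    if B: "B \<in> Pow N" for B m
  proof (cases "\<Prod>B dvd m")
    case True
    have "p dvd m" if "p \<in> B" for p using dvd_trans[OF dvd_prodI[OF fB[OF B] that] True] by simp
    thus ?thesis using True by simp
  next
    case False
    then obtain p where "p \<in> B" "\<not> p dvd m"
      using prod_primes_dvd[OF fB[OF B], of m] N(2) B by blast
    thus ?thesis using False fB[OF B] by (auto intro!: prod_zero)
  qed
  have "(\<Sum>m\<in>{a<..b}. \<Prod>p\<in>N. \<alpha> p + \<beta> p * (if p dvd m then 1 else 0))
      = (\<Sum>m\<in>{a<..b}. \<Sum>B\<in>Pow N. ?c B * (if \<Prod>B dvd m then 1 else 0))"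
  proof (rule sum.cong[OF refl])
    fix m
    have "(\<Prod>p\<in>N. \<alpha> p + \<beta> p * (if p dvd m then 1 else 0))
        = (\<Prod>p\<in>N. \<beta> p * (if p dvd m then 1 else 0) + \<alpha> p)" by (simp only: add.commute)
    also have "\<dots> = (\<Sum>B\<in>Pow N. ?c B * (if \<Prod>B dvd m then 1 else 0))"
      unfolding prod_add[OF N(1)]
      by (rule sum.cong[OF refl]) (simp only: prod.distrib dvd_iff mult_ac)
    finally show "(\<Prod>p\<in>N. \<alpha> p + \<beta> p * (if p dvd m then 1 else 0))
        = (\<Sum>B\<in>Pow N. ?c B * (if \<Prod>B dvd m then 1 else 0))" .
  qed
  also have "\<dots> = (\<Sum>B\<in>Pow N. \<Sum>m\<in>{a<..b}. ?c B * (if \<Prod>B dvd m then 1 else 0))" by (rule sum.swap)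
  also have "\<dots> = (\<Sum>B\<in>Pow N. ?c B * real (?M (\<Prod>B)))"
    by (rule sum.cong[OF refl]) (simp add: sum_distrib_left[symmetric] sum.If_cases Int_def)
  finally have 1: "(\<Sum>m\<in>{a<..b}. \<Prod>p\<in>N. \<alpha> p + \<beta> p * (if p dvd m then 1 else 0))
      = (\<Sum>B\<in>Pow N. ?c B * real (?M (\<Prod>B)))" .
  have "(\<Prod>p\<in>N. \<alpha> p + \<beta> p / real p) = (\<Prod>p\<in>N. \<beta> p / real p + \<alpha> p)" by (simp only: add.commute)
  also have "\<dots> = (\<Sum>B\<in>Pow N. ?c B / real (\<Prod>B))"
    unfolding prod_add[OF N(1)] by (rule sum.cong[OF refl]) (simp add: prod_dividef of_nat_prod)
  finally have 2: "real (b - a) * (\<Prod>p\<in>N. \<alpha> p + \<beta> p / real p)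
      = (\<Sum>B\<in>Pow N. ?c B * (real (b - a) / real (\<Prod>B)))"
    by (simp add: sum_distrib_left mult_ac)
  have "\<bar>(\<Sum>B\<in>Pow N. ?c B * real (?M (\<Prod>B))) - (\<Sum>B\<in>Pow N. ?c B * (real (b - a) / real (\<Prod>B)))\<bar>
      = \<bar>\<Sum>B\<in>Pow N. ?c B * (real (?M (\<Prod>B)) - real (b - a) / real (\<Prod>B))\<bar>"
    by (simp only: sum_subtractf[symmetric] right_diff_distrib)
  also have "\<dots> \<le> (\<Sum>B\<in>Pow N. \<bar>?c B\<bar> * 1)"
  proof (rule order.trans[OF sum_abs], rule sum_mono)
    fix B assume B: "B \<in> Pow N"
    have "\<Prod>B > 0" by (rule prod_pos) (use B N(2) prime_gt_0_nat in auto)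
    from card_multiples_interval[OF ab this]
    show "\<bar>?c B * (real (?M (\<Prod>B)) - real (b - a) / real (\<Prod>B))\<bar> \<le> \<bar>?c B\<bar> * 1"
      unfolding abs_mult[of "?c B"] by (rule mult_left_mono) simp
  qed
  also have "\<dots> = (\<Prod>p\<in>N. \<bar>\<beta> p\<bar> + \<bar>\<alpha> p\<bar>)"
    unfolding prod_add[OF N(1)] by (simp add: abs_mult abs_prod)
  also have "\<dots> = (\<Prod>p\<in>N. \<bar>\<alpha> p\<bar> + \<bar>\<beta> p\<bar>)" by (simp only: add.commute)
  finally show ?thesis unfolding 1 2 .
qed

text \<open>The right-hand side is affine in each \<open>x p\<close>, so it is a convex combination of its values at
  the vertices \<open>X\<close> of the cube. Each of these values is a square, and only \<open>X = {}\<close> is kept.\<close>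

lemma selberg_square_majorant:
  fixes x h :: "nat \<Rightarrow> real"
  assumes P: "finite P" and D: "D \<subseteq> Pow P" and x: "\<And>p. p \<in> P \<Longrightarrow> 0 \<le> x p \<and> x p \<le> 1"
  defines "\<psi> \<equiv> \<lambda>s A p. if p \<in> A then (if s then - 1 else h p) else 1"
  shows "(\<Sum>A\<in>D. \<Prod>p\<in>A. h p)\<^sup>2 * (\<Prod>p\<in>P. 1 - x p)
     \<le> (\<Sum>A\<in>D. \<Sum>B\<in>D. \<Prod>p\<in>P. (1 - x p) * (\<psi> False A p * \<psi> False B p) + x p * (\<psi> True A p * \<psi> True B p))"
proof -
  let ?v = "\<lambda>X A. \<Prod>p\<in>P. \<psi> (p \<in> X) A p"
  let ?W = "\<lambda>X. (\<Prod>p\<in>X. x p) * (\<Prod>p\<in>P-X. 1 - x p)"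
  have fD: "finite D" using P D finite_subset by blast
  have "(\<Sum>A\<in>D. \<Sum>B\<in>D. \<Prod>p\<in>P. (1 - x p) * (\<psi> False A p * \<psi> False B p) + x p * (\<psi> True A p * \<psi> True B p))
      = (\<Sum>A\<in>D. \<Sum>B\<in>D. \<Sum>X\<in>Pow P. ?W X * (?v X A * ?v X B))"
  proof (rule sum.cong[OF refl], rule sum.cong[OF refl])
    fix A B
    have "(\<Prod>p\<in>P. (1 - x p) * (\<psi> False A p * \<psi> False B p) + x p * (\<psi> True A p * \<psi> True B p))
       = (\<Prod>p\<in>P. x p * (\<psi> True A p * \<psi> True B p) + (1 - x p) * (\<psi> False A p * \<psi> False B p))"
      by (simp only: add.commute)
    also have "\<dots> = (\<Sum>X\<in>Pow P. ?W X * (?v X A * ?v X B))"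
      unfolding prod_add[OF P]
    proof (rule sum.cong[OF refl])
      fix X assume "X \<in> Pow P"
      hence X: "X \<subseteq> P" by simp
      have "?v X A * ?v X B = (\<Prod>p\<in>P. \<psi> (p \<in> X) A p * \<psi> (p \<in> X) B p)" by (simp add: prod.distrib)
      also have "\<dots> = (\<Prod>p\<in>P-X. \<psi> (p \<in> X) A p * \<psi> (p \<in> X) B p) * (\<Prod>p\<in>X. \<psi> (p \<in> X) A p * \<psi> (p \<in> X) B p)"
        by (rule prod.subset_diff[OF X P])
      also have "\<dots> = (\<Prod>p\<in>P-X. \<psi> False A p * \<psi> False B p) * (\<Prod>p\<in>X. \<psi> True A p * \<psi> True B p)"
        by (intro arg_cong2[of _ _ _ _ "(*)"] prod.cong) auto
      finally have e: "?v X A * ?v X B = (\<Prod>p\<in>P-X. \<psi> False A p * \<psi> False B p) * (\<Prod>p\<in>X. \<psi> True A p * \<psi> True B p)" .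
      show "(\<Prod>p\<in>X. x p * (\<psi> True A p * \<psi> True B p)) * (\<Prod>p\<in>P-X. (1 - x p) * (\<psi> False A p * \<psi> False B p))
          = ?W X * (?v X A * ?v X B)"
        unfolding e by (simp only: prod.distrib mult_ac)
    qed
    finally show "(\<Prod>p\<in>P. (1 - x p) * (\<psi> False A p * \<psi> False B p) + x p * (\<psi> True A p * \<psi> True B p))
      = (\<Sum>X\<in>Pow P. ?W X * (?v X A * ?v X B))" .
  qed
  also have "\<dots> = (\<Sum>X\<in>Pow P. ?W X * (\<Sum>A\<in>D. ?v X A)\<^sup>2)"
  proof -
    have "(\<Sum>A\<in>D. \<Sum>B\<in>D. \<Sum>X\<in>Pow P. ?W X * (?v X A * ?v X B))
        = (\<Sum>A\<in>D. \<Sum>X\<in>Pow P. \<Sum>B\<in>D. ?W X * (?v X A * ?v X B))"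
      by (rule sum.cong[OF refl]) (rule sum.swap)
    also have "\<dots> = (\<Sum>X\<in>Pow P. \<Sum>A\<in>D. \<Sum>B\<in>D. ?W X * (?v X A * ?v X B))" by (rule sum.swap)
    finally have "(\<Sum>A\<in>D. \<Sum>B\<in>D. \<Sum>X\<in>Pow P. ?W X * (?v X A * ?v X B))
        = (\<Sum>X\<in>Pow P. ?W X * (\<Sum>A\<in>D. \<Sum>B\<in>D. ?v X A * ?v X B))"
      by (simp only: sum_distrib_left)
    thus ?thesis by (simp only: power2_eq_square sum_product)
  qed
  finally have eq: "(\<Sum>A\<in>D. \<Sum>B\<in>D. \<Prod>p\<in>P. (1 - x p) * (\<psi> False A p * \<psi> False B p) + x p * (\<psi> True A p * \<psi> True B p))
     = (\<Sum>X\<in>Pow P. ?W X * (\<Sum>A\<in>D. ?v X A)\<^sup>2)" .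
  have "?v {} A = (\<Prod>p\<in>A. h p)" if "A \<in> D" for A
  proof -
    have "A \<subseteq> P" using that D by auto
    hence "(\<Prod>p\<in>P. if p \<in> A then h p else 1) = (\<Prod>p\<in>A. h p)"
      using P by (simp add: prod.If_cases Int_absorb1 Int_def[symmetric] Collect_mem_eq)
    thus ?thesis by (simp only: \<psi>_def empty_iff if_False)
  qed
  hence "(\<Sum>A\<in>D. \<Prod>p\<in>A. h p)\<^sup>2 * (\<Prod>p\<in>P. 1 - x p) = ?W {} * (\<Sum>A\<in>D. ?v {} A)\<^sup>2"
    by simp
  also have "\<dots> \<le> (\<Sum>X\<in>Pow P. ?W X * (\<Sum>A\<in>D. ?v X A)\<^sup>2)"
  proof (rule member_le_sum)
    fix X assume "X \<in> Pow P - {{}}"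
    thus "0 \<le> ?W X * (\<Sum>A\<in>D. ?v X A)\<^sup>2"
      using x by (intro mult_nonneg_nonneg prod_nonneg) auto
  qed (use P in auto)
  finally show ?thesis unfolding eq .
qed

lemma selberg_G_ge_1:
  assumes "R \<ge> 1" "t \<ge> 0"
  shows "selberg_G t R \<ge> 1"
proof -
  have "{} \<in> sieve_sets R" using assms by (auto simp: sieve_sets_def)
  hence "(\<Prod>p\<in>{}. selberg_h t p) \<le> selberg_G t R"
    unfolding selberg_G_def
  proof (rule member_le_sum)
    fix A assume "A \<in> sieve_sets R - {{}}"
    hence "prime p" if "p \<in> A" for p using that sieve_setsD(2)[of A R p] by blast
    thus "0 \<le> (\<Prod>p\<in>A. selberg_h t p)"
      using selberg_h_bounds(1)[OF _ assms(2)] by (intro prod_nonneg less_imp_le) auto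
  qed (rule finite_sieve_sets)
  thus ?thesis by simp
qed

text \<open>All Euler factors lie in [0, 1], so discarding the prime divisors outside
  \<open>P\<close> only increases the product. The result is affine in each divisibility indicator,
  as the square majorant requires.\<close>

lemma moebius_twist_le_prod_primes:
  assumes m: "m > 0" and t: "t \<ge> 0" and P: "finite P" "\<And>p. p \<in> P \<Longrightarrow> prime p"
  shows "moebius_twist t m \<le> (\<Prod>p\<in>P. 1 - real p powr (-t) * (if p dvd m then 1 else 0))"
proof -
  let ?F = "\<lambda>p::nat. 1 - real p powr (-t)"
  have F: "0 \<le> ?F p \<and> ?F p \<le> 1" if "prime p" for p
    using t prime_ge_1_nat[OF that] by (simp add: powr_minus ge_one_powr_ge_zero inverse_le_1_iff)
  have "moebius_twist t m = (\<Prod>p\<in>prime_factors m. ?F p)" by (rule moebius_twist_eq_prod[OF m])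
  also have "\<dots> \<le> (\<Prod>p\<in>prime_factors m. if p \<in> P then ?F p else 1)"
    by (rule prod_mono) (use F in auto)
  also have "\<dots> = (\<Prod>p\<in>{p\<in>prime_factors m. p \<in> P}. ?F p)"
    by (rule prod.inter_filter[symmetric]) simp
  also have "{p\<in>prime_factors m. p \<in> P} = {p\<in>P. p dvd m}"
    using P m by (auto simp: in_prime_factors_iff)
  also have "(\<Prod>p\<in>\<dots>. ?F p) = (\<Prod>p\<in>P. if p dvd m then ?F p else 1)"
    by (rule prod.inter_filter[OF P(1)])
  also have "\<dots> = (\<Prod>p\<in>P. 1 - real p powr (-t) * (if p dvd m then 1 else 0))"
    by (rule prod.cong) auto
  finally show ?thesis .
qed

text \<open>The factors \<open>h p\<close> (if \<open>p\<close> does not divide \<open>m\<close>) and \<open>-1\<close> (if it does) have mean \<open>0\<close> and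
  variance \<open>h p\<close> when \<open>p\<close> divides with density \<open>p\<^sup>-\<^sup>1\<^sup>-\<^sup>t\<close>, so only the diagonal survives in the
  expanded square.\<close>

theorem selberg_sieve:
  fixes a b R :: nat
  assumes R: "R \<ge> 1" and t: "t \<ge> 0" and ab: "a \<le> b"
  shows "(\<Sum>m\<in>{a<..b}. moebius_twist t m) \<le> real (b - a) / selberg_G t R + real R ^ 6"
proof -
  define P where "P = {p::nat. prime p \<and> p \<le> R}"
  define D where "D = sieve_sets R"
  define h where "h = selberg_h t"
  define \<psi> where "\<psi> = (\<lambda>s A p. if p \<in> A then (if s then - 1 else h p) else (1::real))"
  define \<alpha> where "\<alpha> = (\<lambda>A B p. \<psi> False A p * \<psi> False B p)"
  define \<beta> where "\<beta> = (\<lambda>A B p. real p powr (-t) * (\<psi> True A p * \<psi> True B p - \<psi> False A p * \<psi> False B p))"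
  define x where "x = (\<lambda>m p. real p powr (-t) * (if p dvd m then 1 else 0))"
  define G where "G = selberg_G t R"
  have G1: "G \<ge> 1" unfolding G_def by (rule selberg_G_ge_1) fact+
  have P: "finite P" "\<And>p. p \<in> P \<Longrightarrow> prime p" unfolding P_def using finite_primes_le by auto
  have D: "D \<subseteq> Pow P" "finite D" unfolding D_def P_def using finite_sieve_sets by (auto simp: sieve_sets_def)
  have h: "0 < h p" "h p \<le> 1" "real p powr (-1 - t) * (1 + h p) = h p" if "prime p" for p
    using selberg_h_bounds[OF that t] by (auto simp: h_def)
  have pt: "0 \<le> real p powr (-t) \<and> real p powr (-t) \<le> 1" if "prime p" for p
    using t prime_ge_1_nat[OF that] by (simp add: powr_minus ge_one_powr_ge_zero inverse_le_1_iff)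
  have G_eq: "G = (\<Sum>A\<in>D. \<Prod>p\<in>A. h p)" by (simp add: G_def selberg_G_def D_def h_def)

  have "G\<^sup>2 * (\<Sum>m\<in>{a<..b}. moebius_twist t m) \<le> (\<Sum>m\<in>{a<..b}. G\<^sup>2 * (\<Prod>p\<in>P. 1 - x m p))"
    unfolding sum_distrib_left x_def
    by (intro sum_mono mult_left_mono moebius_twist_le_prod_primes t P) auto
  also have "\<dots> \<le> (\<Sum>m\<in>{a<..b}. \<Sum>A\<in>D. \<Sum>B\<in>D. \<Prod>p\<in>P. (1 - x m p) * (\<psi> False A p * \<psi> False B p) + x m p * (\<psi> True A p * \<psi> True B p))"
    unfolding G_eq \<psi>_def
    by (intro sum_mono selberg_square_majorant) (use P D pt in \<open>auto simp: x_def\<close>)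
  also have "\<dots> = (\<Sum>m\<in>{a<..b}. \<Sum>A\<in>D. \<Sum>B\<in>D. \<Prod>p\<in>P. \<alpha> A B p + \<beta> A B p * (if p dvd m then 1 else 0))"
    by (intro sum.cong prod.cong refl) (simp add: \<alpha>_def \<beta>_def x_def algebra_simps)
  also have "\<dots> = (\<Sum>A\<in>D. \<Sum>m\<in>{a<..b}. \<Sum>B\<in>D. \<Prod>p\<in>P. \<alpha> A B p + \<beta> A B p * (if p dvd m then 1 else 0))"
    by (rule sum.swap)
  also have "\<dots> = (\<Sum>A\<in>D. \<Sum>B\<in>D. \<Sum>m\<in>{a<..b}. \<Prod>p\<in>P. \<alpha> A B p + \<beta> A B p * (if p dvd m then 1 else 0))"
    by (rule sum.cong[OF refl]) (rule sum.swap)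
  also have "\<dots> \<le> (\<Sum>A\<in>D. \<Sum>B\<in>D. real (b - a) * (if A = B then \<Prod>p\<in>A. h p else 0) + real R ^ 4)"
  proof (intro sum_mono)
    fix A B assume AB: "A \<in> D" "B \<in> D"
    hence ABP: "A \<subseteq> P" "B \<subseteq> P" using D by auto
    have \<beta>_over: "\<beta> A B p / real p = real p powr (-1-t) * (\<psi> True A p * \<psi> True B p - \<psi> False A p * \<psi> False B p)"
      if "p \<in> P" for p
    proof -
      have "real p > 0" using P(2)[OF that] prime_gt_0_nat by simp
      hence "real p powr (-1-t) = real p powr (-t) / real p"
        by (simp add: powr_diff powr_minus field_simps)
      thus ?thesis by (simp add: \<beta>_def)
    qed
    have mean: "(\<Prod>p\<in>P. \<alpha> A B p + \<beta> A B p / real p) = (if A = B then \<Prod>p\<in>A. h p else 0)"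
    proof (cases "A = B")
      case True
      have "(\<Prod>p\<in>P. \<alpha> A B p + \<beta> A B p / real p) = (\<Prod>p\<in>P. if p \<in> A then h p else 1)"
      proof (rule prod.cong[OF refl])
        fix p assume p: "p \<in> P"
        have "h p * h p + real p powr (-1 - t) * (1 - h p * h p)
            = h p * h p + (real p powr (-1 - t) * (1 + h p)) * (1 - h p)" by (simp add: algebra_simps)
        also have "\<dots> = h p" unfolding h(3)[OF P(2)[OF p]] by (simp add: algebra_simps)
        finally show "\<alpha> A B p + \<beta> A B p / real p = (if p \<in> A then h p else 1)"
          unfolding \<beta>_over[OF p] using True by (auto simp: \<alpha>_def \<psi>_def)
      qed
      also have "\<dots> = (\<Prod>p\<in>A. h p)"
        using ABP P(1) by (simp add: prod.If_cases Int_absorb1 Int_def[symmetric] Collect_mem_eq)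
      finally show ?thesis using True by simp
    next
      case False
      then obtain p where p: "p \<in> P" "p \<in> A \<and> p \<notin> B \<or> p \<notin> A \<and> p \<in> B" using ABP by blast
      have "h p + real p powr (-1 - t) * (- 1 - h p) = h p - real p powr (-1 - t) * (1 + h p)"
        by (simp add: algebra_simps)
      also have "\<dots> = 0" unfolding h(3)[OF P(2)[OF p(1)]] by simp
      finally have "\<alpha> A B p + \<beta> A B p / real p = 0"
        unfolding \<beta>_over[OF p(1)] using p(2) by (auto simp: \<alpha>_def \<psi>_def)
      thus ?thesis using False p(1) P(1) by (auto intro!: prod_zero)
    qed
    \<comment> \<open>A crude factor p^2 for each occurrence of \<open>p\<close> in \<open>A\<close>
      or \<open>B\<close>. As both products are at most \<open>R\<close>, a pair costs
      \<open>R ^ 4\<close>, and the at most R^2 pairs together cost \<open>R ^ 6\<close>.\<close>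
    have "(\<Prod>p\<in>P. \<bar>\<alpha> A B p\<bar> + \<bar>\<beta> A B p\<bar>)
        \<le> (\<Prod>p\<in>P. (if p \<in> A then (real p)\<^sup>2 else 1) * (if p \<in> B then (real p)\<^sup>2 else 1))"
    proof (rule prod_mono)
      fix p assume p: "p \<in> P"
      note hp = h(1,2)[OF P(2)[OF p]]
      have p2: "real p \<ge> 2" using P(2)[OF p] prime_ge_2_nat by fastforce
      have "4 \<le> (real p)\<^sup>2" using power_mono[OF p2, of 2] by simp
      hence p4: "3 \<le> (real p)\<^sup>2" by simp
      have p8: "1 \<le> (real p)\<^sup>2 * (real p)\<^sup>2" using mult_mono[OF p4 p4] by simp
      have hh: "h p * h p \<le> 1" "h p * h p \<ge> 0" using hp by (auto intro: mult_le_one)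
      have "\<bar>\<beta> A B p\<bar> \<le> 1 * \<bar>\<psi> True A p * \<psi> True B p - \<psi> False A p * \<psi> False B p\<bar>"
        unfolding \<beta>_def abs_mult using pt[OF P(2)[OF p]] by (intro mult_right_mono) auto
      moreover have "\<bar>\<alpha> A B p\<bar> + \<bar>\<psi> True A p * \<psi> True B p - \<psi> False A p * \<psi> False B p\<bar>
         \<le> (if p \<in> A then (real p)\<^sup>2 else 1) * (if p \<in> B then (real p)\<^sup>2 else 1)"
      proof -
        have "\<bar>h p * h p\<bar> + \<bar>1 - h p * h p\<bar> = 1" "\<bar>h p\<bar> + \<bar>- 1 - h p\<bar> \<le> (real p)\<^sup>2"
          using hp hh p4 by linarith+
        thus ?thesis using p8
          by (cases "p \<in> A"; cases "p \<in> B") (simp_all add: \<alpha>_def \<psi>_def del: abs_mult_self_eq)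
      qed
      ultimately show "0 \<le> \<bar>\<alpha> A B p\<bar> + \<bar>\<beta> A B p\<bar> \<and> \<bar>\<alpha> A B p\<bar> + \<bar>\<beta> A B p\<bar>
          \<le> (if p \<in> A then (real p)\<^sup>2 else 1) * (if p \<in> B then (real p)\<^sup>2 else 1)" by simp
    qed
    also have "\<dots> = (\<Prod>p\<in>A. (real p)\<^sup>2) * (\<Prod>p\<in>B. (real p)\<^sup>2)"
      unfolding prod.distrib using ABP P(1)
      by (simp add: prod.If_cases Int_absorb1 Int_def[symmetric] Collect_mem_eq)
    also have "\<dots> = (real (\<Prod>A))\<^sup>2 * (real (\<Prod>B))\<^sup>2"
      by (simp add: prod_power_distrib of_nat_prod)
    also have "\<dots> \<le> (real R)\<^sup>2 * (real R)\<^sup>2"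
      using sieve_setsD(3) AB unfolding D_def by (intro mult_mono power_mono) (auto simp del: of_nat_prod)
    finally have err: "(\<Prod>p\<in>P. \<bar>\<alpha> A B p\<bar> + \<bar>\<beta> A B p\<bar>) \<le> real R ^ 4" by (simp add: power_add[symmetric])
    show "(\<Sum>m\<in>{a<..b}. \<Prod>p\<in>P. \<alpha> A B p + \<beta> A B p * (if p dvd m then 1 else 0))
       \<le> real (b - a) * (if A = B then \<Prod>p\<in>A. h p else 0) + real R ^ 4"
      using sum_prod_affine_le[OF P ab, of "\<alpha> A B" "\<beta> A B"] err unfolding mean by linarith
  qed
  also have "\<dots> = real (b - a) * G + (real (card D))\<^sup>2 * real R ^ 4"
    using D(2) by (simp add: sum.distrib sum_distrib_left[symmetric] sum.delta G_eq power2_eq_square)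
  also have "\<dots> \<le> real (b - a) * G + (real R)\<^sup>2 * real R ^ 4"
    using card_sieve_sets_le[of R] unfolding D_def by (intro add_left_mono mult_right_mono power_mono) auto
  also have "\<dots> = real (b - a) * G + real R ^ 6" by (simp add: power_add[symmetric])
  also have "\<dots> \<le> real (b - a) * G + G\<^sup>2 * real R ^ 6"
    using G1 by (simp add: mult_le_cancel_right1 one_le_power)
  also have "\<dots> = G\<^sup>2 * (real (b - a) / G + real R ^ 6)"
    using G1 by (simp add: field_simps power2_eq_square)
  finally have "G\<^sup>2 * (\<Sum>m\<in>{a<..b}. moebius_twist t m) \<le> G\<^sup>2 * (real (b - a) / G + real R ^ 6)" .
  moreover have "G\<^sup>2 > 0" using G1 by simp
  ultimately show ?thesis
    unfolding G_def by (rule mult_left_le_imp_le)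
qed

text \<open>Unique factorization embeds these \<open>m\<close> into exponent vectors with entries
  between 1 and \<open>R\<close>, so the sum is at most a product of truncated geometric series,
  whose full sums are \<open>selberg_h t p\<close>.\<close>

lemma sum_prime_support_le:
  assumes A: "finite A" "\<And>p. p \<in> A \<Longrightarrow> prime p" and t: "t \<ge> 0"
  shows "(\<Sum>m | m \<in> {1..R} \<and> prime_factors m = A. real m powr (-1 - t)) \<le> (\<Prod>p\<in>A. selberg_h t p)"
proof -
  define M where "M = {m \<in> {1..R}. prime_factors m = A}"
  let ?e = "\<lambda>m. \<lambda>p\<in>A. multiplicity p m"
  let ?g = "\<lambda>f. \<Prod>p\<in>A. (real p powr (-1-t)) ^ (f p)"
  have mult_le: "multiplicity p m \<le> R" if "m \<in> M" "p \<in> A" for m p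
  proof -
    have "p ^ multiplicity p m dvd m" by (rule multiplicity_dvd)
    hence "p ^ multiplicity p m \<le> m" using that by (intro dvd_imp_le) (auto simp: M_def)
    moreover have "multiplicity p m < p ^ multiplicity p m"
      using A(2)[OF that(2)] by (intro power_gt_expt) (auto dest: prime_gt_1_nat)
    ultimately show ?thesis using that by (auto simp: M_def)
  qed
  have m_eq: "m = (\<Prod>p\<in>A. p ^ multiplicity p m)" if "m \<in> M" for m
    using that prime_factorization_nat[of m] by (auto simp: M_def)
  have "(\<Sum>m\<in>M. real m powr (-1 - t)) = (\<Sum>m\<in>M. ?g (?e m))"
  proof (rule sum.cong[OF refl])
    fix m assume m: "m \<in> M"
    have "real m powr (-1-t) = real (\<Prod>p\<in>A. p ^ multiplicity p m) powr (-1-t)"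
      using m_eq[OF m] by simp
    also have "\<dots> = (\<Prod>p\<in>A. real (p ^ multiplicity p m) powr (-1-t))"
      by (simp add: of_nat_prod prod_powr_distrib)
    also have "\<dots> = ?g (?e m)"
    proof (rule prod.cong[OF refl])
      fix p assume p: "p \<in> A"
      hence "real p > 0" using A(2) prime_gt_0_nat by auto
      thus "real (p ^ multiplicity p m) powr (-1-t) = (real p powr (-1-t)) ^ ?e m p"
        using p by (simp add: powr_realpow[symmetric] powr_powr mult.commute)
    qed
    finally show "real m powr (-1 - t) = ?g (?e m)" .
  qed
  also have "\<dots> = (\<Sum>f\<in>?e ` M. ?g f)"
  proof (rule sum.reindex_cong[symmetric, OF _ refl])
    show "inj_on ?e M"
    proof (rule inj_onI)
      fix m m' assume m: "m \<in> M" "m' \<in> M" and e: "?e m = ?e m'"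
      have "multiplicity p m = multiplicity p m'" if "p \<in> A" for p
        using fun_cong[OF e, of p] that by simp
      thus "m = m'" using m_eq[OF m(1)] m_eq[OF m(2)] by simp
    qed
  qed simp
  also have "\<dots> \<le> (\<Sum>f\<in>PiE A (\<lambda>_. {1..R}). ?g f)"
  proof (rule sum_mono2)
    show "?e ` M \<subseteq> PiE A (\<lambda>_. {1..R})"
    proof (intro image_subsetI PiE_I)
      fix m p assume m: "m \<in> M" and p: "p \<in> A"
      have "multiplicity p m \<ge> 1" using m p by (auto simp: M_def prime_factors_multiplicity)
      thus "?e m p \<in> {1..R}" using mult_le[OF m p] p by simp
    qed auto
  qed (use A in \<open>auto intro!: finite_PiE prod_nonneg\<close>)
  also have "\<dots> = (\<Prod>p\<in>A. \<Sum>j=1..R. (real p powr (-1-t)) ^ j)"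
    using A(1) by (simp add: prod_sum_PiE)
  also have "\<dots> \<le> (\<Prod>p\<in>A. selberg_h t p)"
  proof (intro prod_mono conjI)
    fix p assume p: "p \<in> A"
    define y where "y = real p powr (-1-t)"
    note hp = selberg_h_bounds[OF A(2)[OF p] t, folded y_def]
    have y: "0 \<le> y" "y < 1"
    proof -
      show "y \<ge> 0" by (simp add: y_def)
      have "y * (1 + selberg_h t p) < 1 * (1 + selberg_h t p)" unfolding hp(3) by simp
      thus "y < 1" using hp(1) by (simp add: mult_less_cancel_right)
    qed
    have "selberg_h t p = y / (1 - y)" using hp(3) y by (simp add: field_simps)
    moreover have "(\<Sum>j=1..R. y ^ j) = y * (\<Sum>j<R. y ^ j)"
      by (simp add: sum_distrib_left sum.atLeast1_atMost_eq atLeast0LessThan)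
    moreover have "(\<Sum>j<R. y ^ j) = (1 - y ^ R) / (1 - y)" using y by (simp add: sum_gp_strict)
    moreover have "y * ((1 - y ^ R) / (1 - y)) \<le> y / (1 - y)"
      using y by (simp add: divide_right_mono mult_left_le)
    ultimately show "(\<Sum>j=1..R. y ^ j) \<le> selberg_h t p" by simp
    show "0 \<le> (\<Sum>j=1..R. y ^ j)" using y by (intro sum_nonneg) auto
  qed
  finally show ?thesis by (simp add: M_def)
qed

text \<open>Group the \<open>m \<le> R\<close> by their sets of prime factors. The radical of
  \<open>m\<close> is at most \<open>R\<close>, so every such set belongs to
  \<open>sieve_sets R\<close>. A partial zeta sum thus stands in for an evaluation of
  \<open>selberg_G\<close>.\<close>

lemma selberg_G_ge_sum:
  assumes t: "t \<ge> 0"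
  shows "(\<Sum>m=1..R. real m powr (-1 - t)) \<le> selberg_G t R"
proof -
  have "(\<Sum>m=1..R. real m powr (-1 - t))
      = (\<Sum>A\<in>sieve_sets R. \<Sum>m | m \<in> {1..R} \<and> prime_factors m = A. real m powr (-1 - t))"
  proof (rule sum.group[symmetric])
    show "prime_factors ` {1..R} \<subseteq> sieve_sets R"
    proof
      fix A assume "A \<in> prime_factors ` {1..R}"
      then obtain m where m: "m \<in> {1..R}" "A = prime_factors m" by auto
      have le: "p \<le> R" if "p \<in> A" for p
      proof -
        have "p dvd m" using that m by auto
        hence "p \<le> m" using m by (intro dvd_imp_le) auto
        thus ?thesis using m by simp
      qed
      have "\<Prod>A dvd m" by (rule prod_primes_dvd) (use m in auto)
      hence "\<Prod>A \<le> m" using m by (intro dvd_imp_le) auto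
      thus "A \<in> sieve_sets R" using m le by (auto simp: sieve_sets_def)
    qed
  qed (use finite_sieve_sets in auto)
  also have "\<dots> \<le> (\<Sum>A\<in>sieve_sets R. \<Prod>p\<in>A. selberg_h t p)"
    by (intro sum_mono sum_prime_support_le sieve_setsD t)
  finally show ?thesis by (simp add: selberg_G_def)
qed

subsection \<open>Dirichlet series and divisor convolutions\<close>

lemma summable_on_Times_product_bound:
  fixes f :: "'a \<Rightarrow> 'b \<Rightarrow> 'c :: banach"
  assumes "\<alpha> summable_on A" "\<beta> summable_on B"
    and "\<And>x. x \<in> A \<Longrightarrow> (0::real) \<le> \<alpha> x" "\<And>y. y \<in> B \<Longrightarrow> 0 \<le> \<beta> y"
    and "\<And>x y. x \<in> A \<Longrightarrow> y \<in> B \<Longrightarrow> norm (f x y) \<le> \<alpha> x * \<beta> y"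
  shows "(\<lambda>(x, y). f x y) summable_on A \<times> B"
proof -
  have "(\<lambda>(x, y). \<alpha> x * \<beta> y) summable_on A \<times> B"
  proof (rule summable_on_SigmaI)
    fix x assume "x \<in> A"
    show "((\<lambda>y. case (x, y) of (x, y) \<Rightarrow> \<alpha> x * \<beta> y) has_sum \<alpha> x * infsum \<beta> B) B"
      using assms(2) by (auto intro!: has_sum_cmult_right has_sum_infsum)
  next
    show "(\<lambda>x. \<alpha> x * infsum \<beta> B) summable_on A" by (rule summable_on_cmult_left[OF assms(1)])
  qed (use assms in auto)
  hence "(\<lambda>z. norm (case z of (x, y) \<Rightarrow> f x y)) summable_on A \<times> B"
    by (rule summable_on_comparison_test) (use assms in auto)
  thus ?thesis by (rule abs_summable_summable)
qed

lemma infsum_divisor_convolution: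
  fixes f :: "nat \<Rightarrow> nat \<Rightarrow> 'a :: banach"
  assumes "(\<lambda>(e, d). f e d) summable_on {1..} \<times> {1..}"
  shows "(\<lambda>j. \<Sum>e | e dvd j. f e (j div e)) summable_on {1..}"
    and "(\<Sum>\<^sub>\<infinity>j\<in>{1..}. \<Sum>e | e dvd j. f e (j div e)) = (\<Sum>\<^sub>\<infinity>e\<in>{1..}. \<Sum>\<^sub>\<infinity>d\<in>{1..}. f e d)"
proof -
  let ?S = "Sigma {1::nat..} (\<lambda>j. {e. e dvd j})"
  let ?g = "\<lambda>(j, e). f e (j div e)"
  let ?i = "\<lambda>(e::nat, d::nat). (e * d, e)" and ?j = "\<lambda>(j::nat, e::nat). (e, j div e)"
  have w: "\<And>a. a \<in> ?S \<Longrightarrow> ?i (?j a) = a" "\<And>a. a \<in> ?S \<Longrightarrow> ?j a \<in> {1..} \<times> {1..}"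
    "\<And>b. b \<in> {1..} \<times> {1..} \<Longrightarrow> ?j (?i b) = b" "\<And>b. b \<in> {1..} \<times> {1..} \<Longrightarrow> ?i b \<in> ?S"
    "\<And>a. a \<in> ?S \<Longrightarrow> (\<lambda>(e, d). f e d) (?j a) = ?g a"
    by (auto simp: Suc_le_eq div_greater_zero_iff dest: dvd_imp_le intro: Nat.gr0I)
  have s: "?g summable_on ?S"
    using summable_on_reindex_bij_witness[of ?S ?i ?j "{1..} \<times> {1..}" "\<lambda>(e, d). f e d" ?g, OF w] assms by blast
  have inner: "infsum (\<lambda>e. ?g (j, e)) {e. e dvd j} = (\<Sum>e | e dvd j. f e (j div e))" if "j \<in> {1..}" for j
    using that by (subst infsum_finite) auto
  have "(\<lambda>j. infsum (\<lambda>e. ?g (j, e)) {e. e dvd j}) summable_on {1..}"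
    using summable_on_Sigma_banach[of "\<lambda>j e. f e (j div e)" "{1..}" "\<lambda>j. {e. e dvd j}"] s by simp
  thus "(\<lambda>j. \<Sum>e | e dvd j. f e (j div e)) summable_on {1..}"
    using inner by (subst (asm) summable_on_cong) auto
  have "(\<Sum>\<^sub>\<infinity>j\<in>{1..}. \<Sum>e | e dvd j. f e (j div e)) = infsum (\<lambda>j. infsum (\<lambda>e. ?g (j, e)) {e. e dvd j}) {1..}"
    using inner by (intro infsum_cong) auto
  also have "\<dots> = infsum ?g ?S" by (rule infsum_Sigma_banach[OF s])
  also have "\<dots> = infsum (\<lambda>(e, d). f e d) ({1..} \<times> {1..})"
    by (rule infsum_reindex_bij_witness[of ?S ?i ?j "{1..} \<times> {1..}" "\<lambda>(e, d). f e d" ?g, OF w])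
  also have "\<dots> = (\<Sum>\<^sub>\<infinity>e\<in>{1..}. \<Sum>\<^sub>\<infinity>d\<in>{1..}. f e d)"
    using infsum_Sigma_banach[OF assms] by simp
  finally show "(\<Sum>\<^sub>\<infinity>j\<in>{1..}. \<Sum>e | e dvd j. f e (j div e)) = (\<Sum>\<^sub>\<infinity>e\<in>{1..}. \<Sum>\<^sub>\<infinity>d\<in>{1..}. f e d)" .
qed

lemma powr_minus_diff_bounds:
  fixes x t :: real
  assumes "x > 0" "t \<ge> 0"
  shows "x powr (-t) - (x + 1) powr (-t) \<le> t * x powr (-1 - t)"
    and "t * (x + 1) powr (-1 - t) \<le> x powr (-t) - (x + 1) powr (-t)"
proof -
  have "\<exists>z>x. z < x + 1 \<and> (x + 1) powr (-t) - x powr (-t) = (x + 1 - x) * (-t * z powr (-t - 1))"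
    by (rule MVT2) (use assms in \<open>auto intro!: derivative_eq_intros\<close>)
  then obtain z where "x < z" "z < x + 1" "(x + 1) powr (-t) - x powr (-t) = (x + 1 - x) * (-t * z powr (-t - 1))"
    by blast
  moreover have "-t - 1 = -1 - t" by simp
  ultimately have z: "x < z" "z < x + 1" "x powr (-t) - (x + 1) powr (-t) = t * z powr (-1 - t)"
    by simp_all
  show "x powr (-t) - (x + 1) powr (-t) \<le> t * x powr (-1 - t)"
    unfolding z(3) using z assms by (intro mult_left_mono powr_mono2') auto
  show "t * (x + 1) powr (-1 - t) \<le> x powr (-t) - (x + 1) powr (-t)"
    unfolding z(3) using z assms by (intro mult_left_mono powr_mono2') auto
qed

lemma sum_powr_ge:
  assumes t: "t > 0"
  shows "(1 - (real N + 1) powr (-t)) / t \<le> (\<Sum>m=1..N. real m powr (-1 - t))"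
proof (induction N)
  case (Suc N)
  have "(real N + 1) powr (-t) - (real N + 1 + 1) powr (-t) \<le> t * (real N + 1) powr (-1 - t)"
    by (rule powr_minus_diff_bounds) (use t in auto)
  thus ?case using Suc t by (simp add: field_simps)
qed (use t in simp)

lemma sum_powr_tail_le:
  assumes t: "t > 0" and N: "N \<ge> 1" and M: "N \<le> M"
  shows "(\<Sum>m\<in>{N<..M}. real m powr (-1 - t)) \<le> (real N powr (-t) - real M powr (-t)) / t"
  using M
proof (induction M rule: dec_induct)
  case (step M)
  have "t * (real M + 1) powr (-1 - t) \<le> real M powr (-t) - (real M + 1) powr (-t)"
    by (rule powr_minus_diff_bounds) (use t N step in auto)
  moreover have "{N<..Suc M} = insert (Suc M) {N<..M}" using step by auto
  ultimately show ?case using step t by (simp add: field_simps)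
qed simp

text \<open>Both series are shifted: \<open>zeta1 t\<close> is zeta at \<open>1 + t\<close>, and \<open>moebius_sum t\<close> is its reciprocal.\<close>

definition zeta1 :: "real \<Rightarrow> real" where
  "zeta1 t = (\<Sum>\<^sub>\<infinity>m\<in>{1::nat..}. real m powr (-1 - t))"

definition moebius_sum :: "real \<Rightarrow> real" where
  "moebius_sum t = (\<Sum>\<^sub>\<infinity>e\<in>{1::nat..}. moebius_mu e * real e powr (-1 - t))"

lemma summable_on_powr:
  assumes "t > 0"
  shows "(\<lambda>m::nat. real m powr (-1 - t)) summable_on A"
proof -
  have "summable (\<lambda>m. real m powr (-1 - t))"
    using summable_real_powr_iff[of "-1 - t"] assms by simp
  hence "(\<lambda>m. real m powr (-1 - t)) summable_on UNIV"
    by (intro norm_summable_imp_summable_on) simp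
  thus ?thesis by (rule summable_on_subset_banach) simp
qed

lemma zeta1_le:
  assumes t: "t > 0" and N: "N \<ge> 1"
  shows "zeta1 t \<le> (\<Sum>m=1..N. real m powr (-1 - t)) + real N powr (-t) / t"
  unfolding zeta1_def
proof (rule infsum_le_finite_sums[OF summable_on_powr[OF t]])
  fix F :: "nat set" assume F: "finite F" "F \<subseteq> {1..}"
  define M where "M = Max (insert N F)"
  have "F \<subseteq> {1..N} \<union> {N<..M}" using F by (auto simp: M_def Suc_le_eq)
  hence "(\<Sum>m\<in>F. real m powr (-1 - t)) \<le> (\<Sum>m\<in>{1..N} \<union> {N<..M}. real m powr (-1 - t))"
    by (intro sum_mono2) auto
  also have "\<dots> = (\<Sum>m=1..N. real m powr (-1 - t)) + (\<Sum>m\<in>{N<..M}. real m powr (-1 - t))"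
    by (rule sum.union_disjoint) auto
  also have "(\<Sum>m\<in>{N<..M}. real m powr (-1 - t)) \<le> (real N powr (-t) - real M powr (-t)) / t"
    by (rule sum_powr_tail_le) (use t N F in \<open>auto simp: M_def\<close>)
  also have "\<dots> \<le> real N powr (-t) / t" using t by (simp add: divide_right_mono)
  finally show "(\<Sum>m\<in>F. real m powr (-1 - t)) \<le> (\<Sum>m=1..N. real m powr (-1 - t)) + real N powr (-t) / t"
    by simp
qed

lemma zeta1_le': "t > 0 \<Longrightarrow> zeta1 t \<le> 1 + 1 / t"
  using zeta1_le[of t 1] by simp

lemma zeta1_ge_sum:
  assumes "t > 0"
  shows "(\<Sum>m=1..N. real m powr (-1 - t)) \<le> zeta1 t"
  unfolding zeta1_def by (rule finite_sum_le_infsum) (use summable_on_powr[OF assms] in auto)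

lemma zeta1_ge:
  assumes t: "t > 0"
  shows "zeta1 t \<ge> 1 / t"
proof (rule tendsto_upperbound[where F = sequentially])
  have "((\<lambda>x::real. x powr (-t)) \<longlongrightarrow> 0) at_top" by (rule tendsto_neg_powr) (use t in \<open>auto intro: filterlim_ident\<close>)
  moreover have "filterlim (\<lambda>N. real N + 1) at_top sequentially"
    by (rule filterlim_at_top_mono[OF filterlim_real_sequentially]) auto
  ultimately have "((\<lambda>N. (real N + 1) powr (-t)) \<longlongrightarrow> 0) sequentially" by (rule filterlim_compose)
  hence "((\<lambda>N. (1 - (real N + 1) powr (-t)) / t) \<longlongrightarrow> (1 - 0) / t) sequentially"
    by (intro tendsto_intros) (use t in auto)
  thus "((\<lambda>N. (1 - (real N + 1) powr (-t)) / t) \<longlongrightarrow> 1 / t) sequentially" by simp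
  show "\<forall>\<^sub>F N in sequentially. (1 - (real N + 1) powr (-t)) / t \<le> zeta1 t"
    using sum_powr_ge[OF t] zeta1_ge_sum[OF t] by (intro always_eventually allI) (rule order.trans)
qed simp

lemma summable_on_moebius_powr:
  assumes "t > 0"
  shows "(\<lambda>e. moebius_mu e * real e powr (-1 - t)) summable_on A"
proof (rule abs_summable_summable, rule summable_on_comparison_test[OF summable_on_powr[OF assms]])
  show "norm (moebius_mu e * real e powr (-1 - t)) \<le> real e powr (-1 - t)" for e
    using abs_moebius_mu_le[of e] by (simp add: abs_mult mult_left_le_one_le)
qed simp

text \<open>The twist is the Dirichlet convolution of 1 with mu(e) e^-tau, so its series factors;
  the double series converges absolutely since the Moebius function is bounded by 1.\<close>

lemma infsum_moebius_twist_powr: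
  assumes a: "a > 0" and \<tau>: "\<tau> \<ge> 0"
  shows "(\<lambda>j. moebius_twist \<tau> j * real j powr (-1 - a)) summable_on {1..}"
    and "(\<Sum>\<^sub>\<infinity>j\<in>{1..}. moebius_twist \<tau> j * real j powr (-1 - a)) = zeta1 a * moebius_sum (a + \<tau>)"
proof -
  define f where "f = (\<lambda>e d. moebius_mu e * real e powr (-1 - (a + \<tau>)) * real d powr (-1 - a))"
  have sm: "(\<lambda>(e, d). f e d) summable_on {1..} \<times> {1..}"
    by (rule summable_on_Times_product_bound[OF summable_on_powr[of "a + \<tau>"] summable_on_powr[of a]])
       (use a \<tau> abs_moebius_mu_le in \<open>auto simp: f_def abs_mult mult_left_le_one_le intro!: mult_right_mono\<close>)
  have eq: "(\<Sum>e | e dvd j. f e (j div e)) = moebius_twist \<tau> j * real j powr (-1 - a)" if "j \<in> {1..}" for j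
  proof -
    have "f e (j div e) = moebius_mu e * real e powr (-\<tau>) * real j powr (-1 - a)" if "e \<in> {e. e dvd j}" for e
    proof -
      have "real j = real e * real (j div e)" using that by (simp flip: of_nat_mult)
      hence "real j powr (-1 - a) = real e powr (-1 - a) * real (j div e) powr (-1 - a)" by (simp add: powr_mult)
      moreover have "real e powr (-1 - (a + \<tau>)) = real e powr (-\<tau>) * real e powr (-1 - a)"
        by (simp add: powr_add[symmetric] algebra_simps)
      ultimately show ?thesis by (simp add: f_def)
    qed
    thus ?thesis by (simp add: moebius_twist_def sum_distrib_right)
  qed
  have "(\<lambda>j. \<Sum>e | e dvd j. f e (j div e)) summable_on {1..}" by (rule infsum_divisor_convolution[OF sm])
  thus "(\<lambda>j. moebius_twist \<tau> j * real j powr (-1 - a)) summable_on {1..}"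
    using eq by (subst (asm) summable_on_cong) auto
  have "(\<Sum>\<^sub>\<infinity>j\<in>{1..}. moebius_twist \<tau> j * real j powr (-1 - a)) = (\<Sum>\<^sub>\<infinity>j\<in>{1..}. \<Sum>e | e dvd j. f e (j div e))"
    using eq by (intro infsum_cong) auto
  also have "\<dots> = (\<Sum>\<^sub>\<infinity>e\<in>{1..}. \<Sum>\<^sub>\<infinity>d\<in>{1..}. f e d)" by (rule infsum_divisor_convolution[OF sm])
  also have "\<dots> = zeta1 a * moebius_sum (a + \<tau>)"
    unfolding f_def using a \<tau>
    by (simp add: infsum_cmult_right' infsum_cmult_left' zeta1_def moebius_sum_def)
  finally show "(\<Sum>\<^sub>\<infinity>j\<in>{1..}. moebius_twist \<tau> j * real j powr (-1 - a)) = zeta1 a * moebius_sum (a + \<tau>)" .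
qed

text \<open>At tau = 0 the twist is the indicator of 1, and the factorization of its Dirichlet
  series becomes the reciprocity of zeta and the Moebius series.\<close>

lemma zeta1_moebius_sum:
  assumes t: "t > 0"
  shows "zeta1 t * moebius_sum t = 1"
proof -
  have "zeta1 t * moebius_sum t = (\<Sum>\<^sub>\<infinity>j\<in>{1..}. moebius_twist 0 j * real j powr (-1 - t))"
    using infsum_moebius_twist_powr(2)[OF t, of 0] by simp
  also have "\<dots> = (\<Sum>\<^sub>\<infinity>j\<in>{1::nat}. moebius_twist 0 j * real j powr (-1 - t))"
    by (rule infsum_cong_neutral) (auto simp: moebius_twist_0)
  also have "\<dots> = 1" using moebius_twist_0[of 1] by simp
  finally show ?thesis .
qed

lemma moebius_sum_bounds:
  assumes t: "t > 0"
  shows "moebius_sum t = 1 / zeta1 t" "0 < moebius_sum t" "moebius_sum t \<le> t"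
proof -
  have z: "zeta1 t \<ge> 1 / t" by (rule zeta1_ge[OF t])
  moreover have "1 / t > 0" using t by simp
  ultimately have z0: "zeta1 t > 0" by linarith
  show eq: "moebius_sum t = 1 / zeta1 t" using zeta1_moebius_sum[OF t] z0 by (simp add: field_simps)
  show "0 < moebius_sum t" using eq z0 by simp
  show "moebius_sum t \<le> t" using z z0 t unfolding eq by (simp add: field_simps)
qed

text \<open>With \<open>g\<close> the partial zeta sum, the difference is at most (zeta - g) / (zeta
  g). Here zeta - g is at most N^-t / t, while 1/zeta and 1/g are of order at most t. The factor
  N^-t matters: the excess of the sieve density over the true one decays exponentially in t at scale
  ln N, so integrating over t gains powers of 1/ln N.\<close>

lemma selberg_main_term_bound:
  assumes N: "N \<ge> 1" and t: "t > 0" and a: "a > 0" "a \<le> t"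
    and less_1: "real N powr (-a) < 1"
  shows "1 / selberg_G t N - moebius_sum t \<le> t * real N powr (-t) / (1 - real N powr (-a))"
proof -
  define g where "g = (\<Sum>m=1..N. real m powr (-1 - t))"
  define y where "y = real N powr (-t)"
  have z: "zeta1 t \<ge> 1 / t" by (rule zeta1_ge[OF t])
  moreover have "1 / t > 0" using t by simp
  ultimately have z0: "zeta1 t > 0" by linarith
  have ya: "y \<le> real N powr (-a)" unfolding y_def using N a by (intro powr_mono) auto
  have "(real N + 1) powr (-t) \<le> y" unfolding y_def using N t by (intro powr_mono2') auto
  hence "(1 - y) / t \<le> (1 - (real N + 1) powr (-t)) / t" using t by (intro divide_right_mono) auto
  also have "\<dots> \<le> g" unfolding g_def by (rule sum_powr_ge[OF t])
  finally have g1: "(1 - real N powr (-a)) / t \<le> g" using ya t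
    by (meson diff_left_mono divide_right_mono less_imp_le order.trans)
  have g0: "g > 0" using g1 less_1 t by (smt (verit) divide_pos_pos)
  have "1 / selberg_G t N \<le> 1 / g"
    using selberg_G_ge_sum[of t N] t g0 unfolding g_def by (intro divide_left_mono mult_pos_pos) auto
  hence "1 / selberg_G t N - moebius_sum t \<le> 1 / g - 1 / zeta1 t"
    using moebius_sum_bounds(1)[OF t] by simp
  also have "\<dots> = (zeta1 t - g) * (1 / zeta1 t) / g" using z0 g0 by (simp add: field_simps)
  also have "\<dots> \<le> (y / t) * t / g"
  proof (intro divide_right_mono mult_mono)
    show "zeta1 t - g \<le> y / t" using zeta1_le[OF t N] by (simp add: g_def y_def)
    show "1 / zeta1 t \<le> t" using moebius_sum_bounds[OF t] by simp
  qed (use g0 z0 t y_def in auto)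
  also have "\<dots> = y * (1 / g)" using t by simp
  also have "\<dots> \<le> y * (t / (1 - real N powr (-a)))"
    using g1 g0 less_1 t by (intro mult_left_mono) (auto simp: y_def field_simps)
  finally show ?thesis by (simp add: y_def mult_ac)
qed

subsection \<open>Laplace integrals of the weights\<close>

lemma has_bochner_integral_FTC_atLeast:
  fixes f F :: "real \<Rightarrow> real"
  assumes "f \<in> borel_measurable borel"
    and deriv: "\<And>x. a \<le> x \<Longrightarrow> (F has_real_derivative f x) (at x)"
    and nonneg: "\<And>x. a \<le> x \<Longrightarrow> 0 \<le> f x" and lim: "(F \<longlongrightarrow> T) at_top"
  shows "has_bochner_integral lborel (\<lambda>x. f x * indicator {a..} x) (T - F a)"
proof (rule has_bochner_integral_nn_integral)
  have "F a \<le> F x" if "a \<le> x" for x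
    by (rule DERIV_nonneg_imp_nondecreasing[OF that]) (use deriv nonneg in blast)
  hence "F a \<le> T"
    by (intro tendsto_lowerbound[OF lim]) (auto intro: eventually_mono[OF eventually_ge_at_top[of a]])
  thus "0 \<le> T - F a" by simp
  have "(\<integral>\<^sup>+x. ennreal (f x) * indicator {a..} x \<partial>lborel) = T - F a"
    by (rule nn_integral_FTC_atLeast) fact+
  moreover have "ennreal (f x * indicator {a..} x) = ennreal (f x) * indicator {a..} x" for x
    by (auto split: split_indicator)
  ultimately show "(\<integral>\<^sup>+x. ennreal (f x * indicator {a..} x) \<partial>lborel) = ennreal (T - F a)" by simp
qed (use assms nonneg in \<open>auto split: split_indicator\<close>)

lemma has_bochner_integral_exp_atLeast:
  fixes l :: real
  assumes l: "l > 0"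
  shows "has_bochner_integral lborel (\<lambda>t. exp (-l * t) * indicator {a..} t) (exp (-l * a) / l)"
proof -
  have "has_bochner_integral lborel (\<lambda>t. exp (-l * t) * indicator {a..} t) (0 - (- exp (-l * a) / l))"
  proof (rule has_bochner_integral_FTC_atLeast[where F = "\<lambda>t::real. - exp (-l * t) / l"])
    show "((\<lambda>t. - exp (-l * t) / l) \<longlongrightarrow> 0) at_top" using l by real_asymp
  qed (use l in \<open>auto intro!: derivative_eq_intros\<close>)
  thus ?thesis by simp
qed

text \<open>The common majorant of all later integrands: \<open>1 + t\<close> comes from the mean
  value bound for k^(-1-t) - (k+1)^(-1-t), and \<open>b + t\<close> from 1/zeta(1+t) <= t (with
  \<open>b = 0\<close>) or from the sieve excess (with \<open>b\<close> the cut-off).\<close>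

lemma has_bochner_integral_quadratic_exp_atLeast:
  fixes l a b :: real
  assumes l: "l > 0" and a: "a \<ge> 0" "b \<ge> 0"
  shows "has_bochner_integral lborel (\<lambda>t. (1 + t) * (b + t) * exp (-l * t) * indicator {a..} t)
     (exp (-l * a) * ((1 + a) * (b + a) / l + (1 + b + 2 * a) / l ^ 2 + 2 / l ^ 3))"
proof -
  let ?F = "\<lambda>t::real. - exp (-l * t) * ((1 + t) * (b + t) / l + (1 + b + 2 * t) / l ^ 2 + 2 / l ^ 3)"
  have "has_bochner_integral lborel (\<lambda>t. (1 + t) * (b + t) * exp (-l * t) * indicator {a..} t) (0 - ?F a)"
  proof (rule has_bochner_integral_FTC_atLeast[where F = ?F])
    show "(?F \<longlongrightarrow> 0) at_top" using l by real_asymp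
    fix t :: real assume "a \<le> t"
    thus "0 \<le> (1 + t) * (b + t) * exp (-l * t)" using a by simp
    show "(?F has_real_derivative (1 + t) * (b + t) * exp (-l * t)) (at t)"
      using l by (auto intro!: derivative_eq_intros simp: field_simps power2_eq_square power3_eq_cube)
  qed auto
  thus ?thesis by simp
qed

lemma powr_eq_exp_times:
  "k > 0 \<Longrightarrow> real k powr (- c - t) = real k powr (- c) * exp (- ln (real k) * t)"
  "k > 0 \<Longrightarrow> real k powr (- t) = exp (- ln (real k) * t)"
  by (auto simp: powr_def exp_add[symmetric] algebra_simps)

lemma has_bochner_integral_powr_atLeast:
  assumes "k \<ge> 2"
  shows "has_bochner_integral lborel (\<lambda>t. real k powr (- c - t) * indicator {a..} t) (real k powr (- c - a) / ln (real k))"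
proof -
  have "has_bochner_integral lborel (\<lambda>t. real k powr (-c) * (exp (- ln (real k) * t) * indicator {a..} t))
     (real k powr (-c) * (exp (- ln (real k) * a) / ln (real k)))"
    by (intro has_bochner_integral_mult_right has_bochner_integral_exp_atLeast) (use assms in auto)
  thus ?thesis using assms by (simp add: powr_eq_exp_times(1) mult_ac)
qed

lemma infsum_atLeast1_sums:
  fixes g :: "nat \<Rightarrow> 'a :: banach"
  assumes "g summable_on {1..}"
  shows "(\<lambda>n. g (Suc n)) sums infsum g {1..}"
proof -
  have "(g has_sum infsum g {1..}) {1..}" using assms by (rule has_sum_infsum)
  moreover have "{1..} = range Suc" by (auto simp: image_iff Suc_le_eq dest: gr0_implies_Suc)
  ultimately have "(g has_sum infsum g {1..}) (range Suc)" by metis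
  hence "((g \<circ> Suc) has_sum infsum g {1..}) UNIV" by (subst (asm) has_sum_reindex) auto
  from has_sum_imp_sums[OF this] show ?thesis by (simp only: o_def)
qed

text \<open>The series form of \<open>I(k)\<close> in the overview, with a general cut-off
  \<open>a\<close> in place of 1/L. For \<open>k = 1\<close> the term \<open>e = 1\<close> is a
  division by \<open>ln 1 = 0\<close> and counts as 0.\<close>

definition smooth_weight :: "real \<Rightarrow> nat \<Rightarrow> real" where
  "smooth_weight a k = (\<Sum>\<^sub>\<infinity>e\<in>{1..}. moebius_mu e * (real (k * e) powr (-1 - a) / ln (real (k * e))))"

lemma summable_on_smooth_weight:
  assumes a: "a > 0"
  shows "(\<lambda>e. moebius_mu e * (real (k * e) powr (-1 - a) / ln (real (k * e)))) summable_on A"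
proof (cases "k = 0")
  case False
  have bd: "norm (moebius_mu e * (real (k * e) powr (-1 - a) / ln (real (k * e)))) \<le> real e powr (-1 - a) * (1 / ln 2)" for e
  proof (cases "k * e \<le> 1")
    case True
    hence "k * e = 0 \<or> k * e = 1" by linarith
    thus ?thesis by (auto simp del: of_nat_mult)
  next
    case c: False
    hence "real (k * e) \<ge> real 2" unfolding of_nat_le_iff by simp
    hence "ln 2 \<le> ln (real (k * e))" by (intro ln_mono) auto
    moreover have "e \<le> k * e" "e > 0" using False c by (auto intro: Nat.gr0I)
    hence "real (k * e) powr (-1 - a) \<le> real e powr (-1 - a)"
      using a by (intro powr_mono2') (auto simp del: of_nat_mult)
    moreover have "ln (2::real) > 0" by simp
    ultimately have "real (k * e) powr (-1 - a) / ln (real (k * e)) \<le> real e powr (-1 - a) / ln 2"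
      by (intro frac_le) auto
    moreover have "\<bar>moebius_mu e\<bar> * \<bar>real (k * e) powr (-1 - a) / ln (real (k * e))\<bar>
       \<le> 1 * \<bar>real (k * e) powr (-1 - a) / ln (real (k * e))\<bar>"
      by (intro mult_right_mono abs_moebius_mu_le) auto
    moreover have "ln (real (k * e)) > 0" using \<open>ln 2 \<le> ln (real (k * e))\<close> \<open>ln (2::real) > 0\<close> by linarith
    ultimately show ?thesis by (simp add: abs_mult del: of_nat_mult)
  qed
  show ?thesis
    by (rule abs_summable_summable, rule summable_on_comparison_test[OF _ bd])
       (use summable_on_cmult_left[OF summable_on_powr[OF a], of "1 / ln 2" A] in auto)
qed simp

text \<open>Each j^(-1-a) / ln j with j = k e is the integral of j^(-1-t) from \<open>a\<close> on;
  \<open>k \<ge> 2\<close> keeps every j away from 1. Absolute summability of the integrals permits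
  exchanging sum and integral.\<close>

lemma has_bochner_integral_smooth_weight:
  assumes a: "a > 0" and k: "k \<ge> 2"
  shows "has_bochner_integral lborel (\<lambda>t. real k powr (-1 - t) * moebius_sum t * indicator {a..} t) (smooth_weight a k)"
proof -
  define f where "f = (\<lambda>e t. moebius_mu (Suc e) * (real (k * Suc e) powr (-1 - t) * indicator {a..} t))"
  have ke: "k * Suc e \<ge> 2" for e using k mult_le_mono[of 2 k 1 "Suc e"] by simp
  have pw: "real (k * Suc e) powr (-1 - t) = real k powr (-1 - t) * real (Suc e) powr (-1 - t)" for e t
    by (simp only: of_nat_mult) (rule powr_mult)
  have int: "has_bochner_integral lborel (f e) (moebius_mu (Suc e) * (real (k * Suc e) powr (-1 - a) / ln (real (k * Suc e))))" for e
    unfolding f_def by (intro has_bochner_integral_mult_right has_bochner_integral_powr_atLeast[where c = 1] ke)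
  have intn: "(\<integral>t. norm (f e t) \<partial>lborel) = norm (moebius_mu (Suc e) * (real (k * Suc e) powr (-1 - a) / ln (real (k * Suc e))))" for e
  proof -
    have "has_bochner_integral lborel (\<lambda>t. \<bar>moebius_mu (Suc e)\<bar> * (real (k * Suc e) powr (-1 - t) * indicator {a..} t))
       (\<bar>moebius_mu (Suc e)\<bar> * (real (k * Suc e) powr (-1 - a) / ln (real (k * Suc e))))"
      by (intro has_bochner_integral_mult_right has_bochner_integral_powr_atLeast[where c = 1] ke)
    moreover have "norm (f e t) = \<bar>moebius_mu (Suc e)\<bar> * (real (k * Suc e) powr (-1 - t) * indicator {a..} t)" for t
      by (auto simp: f_def abs_mult split: split_indicator)
    moreover have "ln (real (k * Suc e)) \<ge> 0" using ke[of e] by (simp del: of_nat_mult)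
    ultimately show ?thesis
      by (simp only: has_bochner_integral_integral_eq real_norm_def abs_mult abs_divide abs_of_nonneg powr_ge_zero)
  qed
  have summ: "summable (\<lambda>e. norm (f e t))" for t
  proof (cases "t \<ge> a")
    case True
    hence "(\<lambda>e. norm (real k powr (-1 - t) * (moebius_mu e * real e powr (-1 - t)))) summable_on {1..}"
      using a by (subst summable_on_iff_abs_summable_on_real[symmetric]) (intro summable_on_cmult_right summable_on_moebius_powr, simp)
    from infsum_atLeast1_sums[OF this]
    have "summable (\<lambda>e. norm (real k powr (-1 - t) * (moebius_mu (Suc e) * real (Suc e) powr (-1 - t))))"
      by (rule sums_summable)
    moreover have "f e t = real k powr (-1 - t) * (moebius_mu (Suc e) * real (Suc e) powr (-1 - t))" for e
      unfolding f_def pw using True by simp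
    ultimately show ?thesis by (simp only:)
  next
    case False
    thus ?thesis by (simp add: f_def)
  qed
  have summi: "summable (\<lambda>e. \<integral>t. norm (f e t) \<partial>lborel)"
  proof -
    have "(\<lambda>e. norm (moebius_mu e * (real (k * e) powr (-1 - a) / ln (real (k * e))))) summable_on {1..}"
      by (subst summable_on_iff_abs_summable_on_real[symmetric]) (rule summable_on_smooth_weight[OF a])
    from infsum_atLeast1_sums[OF this] show ?thesis unfolding intn by (rule sums_summable)
  qed
  have itg: "integrable lborel (f e)" for e using int by (auto simp: has_bochner_integral_iff)
  have ptw: "(\<Sum>e. f e t) = real k powr (-1 - t) * moebius_sum t * indicator {a..} t" for t
  proof (cases "t \<ge> a")
    case True
    hence "(\<lambda>e. moebius_mu e * real e powr (-1 - t)) summable_on {1..}" using a by (intro summable_on_moebius_powr) simp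
    from sums_mult[OF infsum_atLeast1_sums[OF this], of "real k powr (-1 - t)"]
    have "(\<lambda>e. real k powr (-1 - t) * (moebius_mu (Suc e) * real (Suc e) powr (-1 - t))) sums (real k powr (-1 - t) * moebius_sum t)"
      by (simp only: moebius_sum_def)
    moreover have "f e t = real k powr (-1 - t) * (moebius_mu (Suc e) * real (Suc e) powr (-1 - t))" for e
      unfolding f_def pw using True by simp
    ultimately have "(\<lambda>e. f e t) sums (real k powr (-1 - t) * moebius_sum t)" by (simp only:)
    from sums_unique[OF this] show ?thesis using True by simp
  qed (simp add: f_def)
  have "integrable lborel (\<lambda>t. \<Sum>e. f e t)"
    by (rule integrable_suminf[OF itg]) (use summ summi in auto)
  moreover have "(\<lambda>e. integral\<^sup>L lborel (f e)) sums (\<integral>t. (\<Sum>e. f e t) \<partial>lborel)"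
    by (rule sums_integral[OF itg]) (use summ summi in auto)
  moreover have "(\<lambda>e. integral\<^sup>L lborel (f e)) sums smooth_weight a k"
    using infsum_atLeast1_sums[OF summable_on_smooth_weight[OF a, of k]] int
    unfolding smooth_weight_def by (simp only: has_bochner_integral_integral_eq[OF int])
  ultimately show ?thesis unfolding ptw has_bochner_integral_iff using sums_unique2 by blast
qed

definition floor_weight :: "nat \<Rightarrow> nat \<Rightarrow> real" where
  "floor_weight n k = (\<Sum>e=1..n. moebius_mu e * (real (n div (k * e)) / ln (real (k * e))))"

text \<open>Writing 1/ln(k e) as the integral of (k e)^-t leaves a Moebius sum over
  \<open>n div k div e\<close>, which \<open>sum_divisor_sums\<close> recognizes as the summatory
  function of the twist.\<close>

lemma has_bochner_integral_floor_weight: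
  assumes k: "k \<ge> 2"
  shows "has_bochner_integral lborel
    (\<lambda>t. real k powr (-t) * (\<Sum>m=1..n div k. moebius_twist t m) * indicator {0..} t) (floor_weight n k)"
proof -
  define f where "f = (\<lambda>e t. moebius_mu e * real (n div (k * e)) * (real (k * e) powr (- 0 - t) * indicator {0..} t))"
  have ke: "k * e \<ge> 2" if "e \<in> {1..n}" for e
    using that k mult_le_mono[of 2 k 1 e] by simp
  have "has_bochner_integral lborel (f e) (moebius_mu e * real (n div (k * e)) * (real (k * e) powr (- 0 - 0) / ln (real (k * e))))"
    if "e \<in> {1..n}" for e
    unfolding f_def by (intro has_bochner_integral_mult_right has_bochner_integral_powr_atLeast[where c = 0] ke that)
  hence "has_bochner_integral lborel (\<lambda>t. \<Sum>e=1..n. f e t)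
      (\<Sum>e=1..n. moebius_mu e * real (n div (k * e)) * (real (k * e) powr (- 0 - 0) / ln (real (k * e))))"
    by (rule has_bochner_integral_sum)
  also have "(\<Sum>e=1..n. moebius_mu e * real (n div (k * e)) * (real (k * e) powr (- 0 - 0) / ln (real (k * e)))) = floor_weight n k"
    unfolding floor_weight_def
  proof (rule sum.cong[OF refl])
    fix e assume "e \<in> {1..n}"
    thus "moebius_mu e * real (n div (k * e)) * (real (k * e) powr (- 0 - 0) / ln (real (k * e)))
      = moebius_mu e * (real (n div (k * e)) / ln (real (k * e)))" using ke[of e] by simp
  qed
  also have "(\<lambda>t. \<Sum>e=1..n. f e t) = (\<lambda>t. real k powr (-t) * (\<Sum>m=1..n div k. moebius_twist t m) * indicator {0..} t)"
  proof
    fix t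
    have "(\<Sum>m=1..n div k. moebius_twist t m) = (\<Sum>e=1..n div k. real (n div k div e) * (moebius_mu e * real e powr (-t)))"
      unfolding moebius_twist_def by (rule sum_divisor_sums)
    also have "\<dots> = (\<Sum>e=1..n. real (n div k div e) * (moebius_mu e * real e powr (-t)))"
      by (intro sum.mono_neutral_left) (auto intro: order.trans[OF _ div_le_dividend])
    finally show "(\<Sum>e=1..n. f e t) = real k powr (-t) * (\<Sum>m=1..n div k. moebius_twist t m) * indicator {0..} t"
      unfolding f_def div_mult2_eq[symmetric] sum_distrib_right
      by (simp add: powr_mult sum_distrib_left sum_distrib_right mult_ac)
  qed
  finally show ?thesis .
qed

section \<open>Monotonicity and size of the two weights\<close>

lemma has_bochner_integral_le:
  fixes f g :: "'a \<Rightarrow> real"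
  assumes "has_bochner_integral M f x" "has_bochner_integral M g y" "\<And>t. f t \<le> g t"
  shows "x \<le> y"
  using integral_mono[of M f g] assms by (auto simp: has_bochner_integral_iff)

lemma powr_diff_bounds:
  assumes "k \<ge> 1" "t \<ge> 0"
  shows "0 \<le> real k powr (-1 - t) - real (Suc k) powr (-1 - t)"
    and "real k powr (-1 - t) - real (Suc k) powr (-1 - t) \<le> (1 + t) * real k powr (-2 - t)"
proof -
  show "0 \<le> real k powr (-1 - t) - real (Suc k) powr (-1 - t)"
    using assms by (simp add: powr_mono2')
  have "real k powr (-(1 + t)) - (real k + 1) powr (-(1 + t)) \<le> (1 + t) * real k powr (-1 - (1 + t))"
    by (rule powr_minus_diff_bounds) (use assms in auto)
  moreover have "-(1 + t) = -1 - t" "-1 - (1 + t) = -2 - t" by simp_all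
  ultimately show "real k powr (-1 - t) - real (Suc k) powr (-1 - t) \<le> (1 + t) * real k powr (-2 - t)"
    by (simp add: add.commute)
qed

lemma powr_minus_one_minus:
  "k > 0 \<Longrightarrow> real k powr (-1 - t) = real k powr (-t) / real k"
  using powr_add[of "real k" "-1" "-t"] by (simp add: powr_minus divide_inverse mult.commute)

text \<open>Invisible in the alternating definition but clear from the integral: k^-t decreases, and
  the sum up to \<open>n div k\<close> of nonnegative twists loses terms.\<close>

lemma floor_weight_antimono:
  assumes k: "k \<ge> 2"
  shows "floor_weight n (Suc k) \<le> floor_weight n k"
proof (rule has_bochner_integral_le[OF has_bochner_integral_floor_weight has_bochner_integral_floor_weight])
  fix t
  show "real (Suc k) powr - t * sum (moebius_twist t) {1..n div Suc k} * indicator {0..} t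
      \<le> real k powr - t * sum (moebius_twist t) {1..n div k} * indicator {0..} t"
  proof (cases "t \<ge> 0")
    case True
    have "sum (moebius_twist t) {1..n div Suc k} \<le> sum (moebius_twist t) {1..n div k}"
      using True k div_le_mono2[of k "Suc k" n] by (intro sum_mono2) (auto intro!: moebius_twist_nonneg)
    moreover have "real (Suc k) powr - t \<le> real k powr - t" using k True by (intro powr_mono2') auto
    moreover have "0 \<le> sum (moebius_twist t) {1..n div Suc k}" using True by (intro sum_nonneg moebius_twist_nonneg) auto
    ultimately show ?thesis using True by (simp add: mult_mono)
  qed simp
qed (use k in auto)

lemma smooth_weight_nonneg:
  assumes "a > 0" "k \<ge> 2"
  shows "smooth_weight a k \<ge> 0"
proof (rule has_bochner_integral_le[OF has_bochner_integral_zero has_bochner_integral_smooth_weight[OF assms]])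
  fix t show "0 \<le> real k powr (-1 - t) * moebius_sum t * indicator {a..} t"
    using moebius_sum_bounds(2)[of t] assms by (cases "t \<ge> a") auto
qed

lemma has_bochner_integral_smooth_weight_diff:
  assumes "a > 0" "k \<ge> 2"
  shows "has_bochner_integral lborel
    (\<lambda>t. (real k powr (-1 - t) - real (Suc k) powr (-1 - t)) * moebius_sum t * indicator {a..} t)
    (smooth_weight a k - smooth_weight a (Suc k))"
  using has_bochner_integral_diff[OF has_bochner_integral_smooth_weight[of a k]
      has_bochner_integral_smooth_weight[of a "Suc k"]] assms
  by (simp add: algebra_simps)

lemma smooth_weight_antimono:
  assumes "a > 0" "k \<ge> 2"
  shows "smooth_weight a (Suc k) \<le> smooth_weight a k"
proof -
  have "0 \<le> smooth_weight a k - smooth_weight a (Suc k)"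
  proof (rule has_bochner_integral_le[OF has_bochner_integral_zero has_bochner_integral_smooth_weight_diff[OF assms]])
    fix t show "0 \<le> (real k powr (-1 - t) - real (Suc k) powr (-1 - t)) * moebius_sum t * indicator {a..} t"
    proof (cases "t \<ge> a")
      case True
      thus ?thesis using powr_diff_bounds(1)[of k t] moebius_sum_bounds(2)[of t] assms by simp
    qed simp
  qed
  thus ?thesis by simp
qed

lemma ln_ge_half: "k \<ge> 2 \<Longrightarrow> ln (real k) \<ge> 1 / 2"
proof -
  assume "k \<ge> 2"
  hence "ln 2 \<le> ln (real k)" by (intro ln_mono) auto
  thus ?thesis using ln2_ge_two_thirds by linarith
qed

text \<open>By 1/zeta(1+t) <= t the integral is at most that of t k^(-1-t), giving two factors 1/ln
  k. The spare factor \<open>1 + t\<close> only serves to reuse the quadratic integral; with ln k >=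
  1/2 it raises the constant from 1 to 5.\<close>

lemma smooth_weight_le:
  assumes a: "a > 0" and k: "k \<ge> 2"
  shows "smooth_weight a k \<le> 5 / (real k * (ln (real k))\<^sup>2)"
proof -
  define l where "l = ln (real k)"
  have l: "l \<ge> 1 / 2" unfolding l_def by (rule ln_ge_half[OF k])
  have "has_bochner_integral lborel (\<lambda>t. real k powr (-1) * ((1 + t) * (0 + t) * exp (- l * t) * indicator {0..} t))
     (real k powr (-1) * (exp (- l * 0) * ((1 + 0) * (0 + 0) / l + (1 + 0 + 2 * 0) / l ^ 2 + 2 / l ^ 3)))"
    by (intro has_bochner_integral_mult_right has_bochner_integral_quadratic_exp_atLeast) (use l in auto)
  hence "smooth_weight a k \<le> real k powr (-1) * (exp (- l * 0) * ((1 + 0) * (0 + 0) / l + (1 + 0 + 2 * 0) / l ^ 2 + 2 / l ^ 3))"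
  proof (rule has_bochner_integral_le[OF has_bochner_integral_smooth_weight[OF a k]])
    fix t
    show "real k powr (-1 - t) * moebius_sum t * indicator {a..} t
      \<le> real k powr (-1) * ((1 + t) * (0 + t) * exp (- l * t) * indicator {0..} t)"
    proof (cases "t \<ge> a")
      case True
      have "moebius_sum t \<le> (1 + t) * t"
        using moebius_sum_bounds(3)[of t] mult_right_mono[of 1 "1 + t" t] True a by linarith
      hence "real k powr (-1) * exp (- l * t) * moebius_sum t \<le> real k powr (-1) * exp (- l * t) * ((1 + t) * t)"
        by (intro mult_left_mono) auto
      thus ?thesis using True a powr_eq_exp_times(1)[of k 1 t] k by (simp add: l_def mult_ac)
    qed (use a in \<open>auto split: split_indicator\<close>)
  qed
  also have "\<dots> = (1 / l ^ 2 + 2 / l ^ 3) / real k" using k by (simp add: powr_minus field_simps)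
  also have "\<dots> \<le> (5 / l ^ 2) / real k"
  proof (intro divide_right_mono)
    have "2 / l ^ 3 = (1 / l ^ 2) * (2 / l)" by (simp add: power3_eq_cube power2_eq_square)
    also have "\<dots> \<le> (1 / l ^ 2) * 4" using l by (intro mult_left_mono) (auto simp: field_simps)
    finally show "1 / l ^ 2 + 2 / l ^ 3 \<le> 5 / l ^ 2" by simp
  qed auto
  finally show ?thesis by (simp add: l_def mult_ac)
qed

text \<open>This feeds the tail k > n of (iii), where 1/ln k <= a holds for a = 1/ln n. Under that
  hypothesis each further factor 1/ln k of the Laplace integral can be traded for \<open>a\<close>;
  the bracket is then at most 2a + 5a^2, hence at most 12a for \<open>a \<le> 2\<close>.\<close>

lemma smooth_weight_diff_le:
  assumes a: "a > 0" and k: "k \<ge> 2" and ak: "1 / ln (real k) \<le> a" and a2: "a \<le> 2"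
  shows "smooth_weight a k - smooth_weight a (Suc k) \<le> 12 * a / ln (real k) * real k powr (-2 - a)"
proof -
  define l where "l = ln (real k)"
  have l: "l \<ge> 1 / 2" unfolding l_def by (rule ln_ge_half[OF k])
  have "has_bochner_integral lborel (\<lambda>t. real k powr (-2) * ((1 + t) * (0 + t) * exp (- l * t) * indicator {a..} t))
     (real k powr (-2) * (exp (- l * a) * ((1 + a) * (0 + a) / l + (1 + 0 + 2 * a) / l ^ 2 + 2 / l ^ 3)))"
    by (intro has_bochner_integral_mult_right has_bochner_integral_quadratic_exp_atLeast) (use l a in auto)
  hence "smooth_weight a k - smooth_weight a (Suc k)
     \<le> real k powr (-2) * (exp (- l * a) * ((1 + a) * (0 + a) / l + (1 + 0 + 2 * a) / l ^ 2 + 2 / l ^ 3))"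
  proof (rule has_bochner_integral_le[OF has_bochner_integral_smooth_weight_diff[OF a k]])
    fix t
    show "(real k powr (-1 - t) - real (Suc k) powr (-1 - t)) * moebius_sum t * indicator {a..} t
      \<le> real k powr (-2) * ((1 + t) * (0 + t) * exp (- l * t) * indicator {a..} t)"
    proof (cases "t \<ge> a")
      case True
      have "(real k powr (-1 - t) - real (Suc k) powr (-1 - t)) * moebius_sum t \<le> ((1 + t) * real k powr (-2 - t)) * t"
        by (intro mult_mono powr_diff_bounds moebius_sum_bounds)
           (use True a k moebius_sum_bounds(2)[of t] in auto)
      thus ?thesis using True a powr_eq_exp_times(1)[of k 2 t] k by (simp add: l_def mult_ac)
    qed simp
  qed
  also have "real k powr (-2) * (exp (- l * a) * ((1 + a) * (0 + a) / l + (1 + 0 + 2 * a) / l ^ 2 + 2 / l ^ 3))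
     = real k powr (-2 - a) * (((1 + a) * a + (1 + 2 * a) * (1 / l) + 2 * ((1 / l) * (1 / l))) / l)"
    using powr_eq_exp_times(1)[of k 2 a] k l
    by (simp add: l_def[symmetric] power2_eq_square power3_eq_cube add_divide_distrib)
  also have "\<dots> \<le> real k powr (-2 - a) * (12 * a / l)"
  proof (intro mult_left_mono divide_right_mono)
    have "(1 / l) * (1 / l) \<le> a * a" using ak a l unfolding l_def[symmetric] by (intro mult_mono) auto
    moreover have "(1 + 2 * a) * (1 / l) \<le> (1 + 2 * a) * a" using ak a unfolding l_def[symmetric] by (intro mult_left_mono) auto
    moreover have "a * a \<le> 2 * a" using a a2 by (intro mult_right_mono) auto
    ultimately show "(1 + a) * a + (1 + 2 * a) * (1 / l) + 2 * ((1 / l) * (1 / l)) \<le> 12 * a"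
      by (simp add: algebra_simps)
  qed (use l in auto)
  finally show ?thesis by (simp add: l_def mult_ac)
qed

text \<open>The excess of the sieve density 1/G over the true one. From \<open>a\<close> on,
  \<open>selberg_main_term_bound\<close> applies. Below \<open>a\<close> nothing is subtracted, and
  the simple estimate G >= N^-t ln N suffices because 1/ln N is at most a/c.\<close>

lemma sieve_density_bound:
  assumes N: "N \<ge> 1" and a: "a > 0" and c: "0 < c" "c \<le> a * ln (real N)" "a * ln (real N) \<le> 1" and t: "t \<ge> 0"
  shows "1 / selberg_G t N - (if t \<ge> a then moebius_sum t else 0)
     \<le> (1 / (1 - exp (-c)) + exp 2 / c) * (a + t) * exp (- ln (real N) * t)"
proof -
  define r where "r = ln (real N)"
  have r: "r > 0" using c a zero_less_mult_pos[of a r] unfolding r_def by linarith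
  have Na: "real N powr (-a) \<le> exp (-c)" using N c by (simp add: powr_def)
  have ec: "exp (-c) < 1" using c by simp
  have Nt: "real N powr (-t) = exp (-r * t)" unfolding r_def using N by (simp add: powr_def mult_ac)
  show ?thesis
  proof (cases "t \<ge> a")
    case True
    have "1 / selberg_G t N - moebius_sum t \<le> t * real N powr (-t) / (1 - real N powr (-a))"
      by (rule selberg_main_term_bound) (use N True a le_less_trans[OF Na ec] in auto)
    also have "\<dots> \<le> t * real N powr (-t) / (1 - exp (-c))"
      using Na ec le_less_trans[OF Na ec] t by (intro divide_left_mono mult_pos_pos mult_nonneg_nonneg) auto
    also have "\<dots> = (1 / (1 - exp (-c))) * t * exp (-r * t)" by (simp add: Nt)
    also have "\<dots> \<le> (1 / (1 - exp (-c)) + exp 2 / c) * (a + t) * exp (-r * t)"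
      using a t c ec by (intro mult_right_mono mult_mono) auto
    finally show ?thesis using True by (simp add: r_def)
  next
    case False
    have "r \<le> ln (real N + 1)" unfolding r_def using N by (intro ln_mono) auto
    also have "\<dots> \<le> (\<Sum>m=1..N. inverse (real m))" using ln_le_harm[of N] by (simp add: harm_def)
    finally have h: "r \<le> (\<Sum>m=1..N. inverse (real m))" .
    have "exp (-r * t) * r \<le> exp (-r * t) * (\<Sum>m=1..N. inverse (real m))" using h by (intro mult_left_mono) auto
    also have "\<dots> = (\<Sum>m=1..N. real N powr (-t) * inverse (real m))" by (simp add: sum_distrib_left Nt)
    also have "\<dots> \<le> (\<Sum>m=1..N. real m powr (-1 - t))"
    proof (rule sum_mono)
      fix m assume m: "m \<in> {1..N}"
      have "real N powr (-t) * inverse (real m) \<le> real m powr (-t) * inverse (real m)"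
        using m t by (intro mult_right_mono powr_mono2') auto
      also have "\<dots> = real m powr (-1 - t)" using m powr_minus_one_minus[of m t] by (simp add: divide_inverse)
      finally show "real N powr (-t) * inverse (real m) \<le> real m powr (-1 - t)" .
    qed
    also have "\<dots> \<le> selberg_G t N" by (rule selberg_G_ge_sum[OF t])
    finally have G: "exp (-r * t) * r \<le> selberg_G t N" .
    have "1 / selberg_G t N \<le> 1 / (exp (-r * t) * r)" using G r by (intro divide_left_mono mult_pos_pos) (auto intro: less_le_trans[OF _ G])
    \<comment> \<open>Below \<open>a\<close> one has r t <= 1, so the growing exp(rt) may be traded
      for exp 2 times the decaying exp(-rt); both ranges of t then share one majorant.\<close>
    also have "\<dots> = exp (2 * (r * t)) * exp (-r * t) / r" 
    proof -
      have "exp (2 * (r * t)) * exp (-r * t) = exp (r * t)" by (simp add: exp_add[symmetric])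
      thus ?thesis by (simp add: exp_minus divide_inverse)
    qed
    also have "\<dots> \<le> exp 2 * exp (-r * t) / r"
    proof (intro divide_right_mono mult_right_mono)
      have "r * t \<le> r * a" using False r by (intro mult_left_mono) auto
      thus "exp (2 * (r * t)) \<le> exp 2" using c unfolding r_def by (simp add: mult.commute)
    qed (use r in auto)
    also have "\<dots> = exp 2 * (1 / r) * exp (-r * t)" by simp
    also have "\<dots> \<le> exp 2 * (a / c) * exp (-r * t)"
    proof (intro mult_right_mono mult_left_mono)
      show "1 / r \<le> a / c" using c r unfolding r_def[symmetric] by (simp add: field_simps)
    qed auto
    also have "\<dots> = (exp 2 / c) * a * exp (-r * t)" by simp
    also have "\<dots> \<le> (1 / (1 - exp (-c)) + exp 2 / c) * (a + t) * exp (-r * t)"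
      using a t c ec by (intro mult_right_mono mult_mono) auto
    finally show ?thesis using False by (simp add: r_def)
  qed
qed

text \<open>Apply the sieve under the integral sign. Its main term n psi(t) / G and the smooth term
  n psi(t) / zeta(1+t) carry the same factor psi(t) = k^(-1-t) - (k+1)^(-1-t), so only the sieve
  excess remains, weighted by psi(t) <= (1+t) / k^2. The error N^6 appears three times, and
  integrating k^-t costs 1/ln k <= 2, whence the 6.\<close>

lemma floor_smooth_one_sided:
  assumes N: "N \<ge> 2" and a: "a > 0" and c: "0 < c" "c \<le> a * ln (real N)" "a * ln (real N) \<le> 1"
    and k: "k \<ge> 2"
  defines "C \<equiv> 1 / (1 - exp (-c)) + exp 2 / c"
  shows "(floor_weight n k - floor_weight n (Suc k)) - real n * (smooth_weight a k - smooth_weight a (Suc k))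
    \<le> real n * real k powr (-2) * C * (a / ln (real N) + (1 + a) / ln (real N) ^ 2 + 2 / ln (real N) ^ 3)
      + 6 * real N ^ 6"
proof -
  define X Y where "X = n div k" and "Y = n div Suc k"
  define \<psi> where "\<psi> = (\<lambda>t. real k powr (-1 - t) - real (Suc k) powr (-1 - t))"
  define r where "r = ln (real N)"
  define l where "l = ln (real k)"
  have r: "r > 0" using N by (simp add: r_def)
  have l: "l \<ge> 1 / 2" unfolding l_def by (rule ln_ge_half[OF k])
  have C: "C \<ge> 0" using c by (simp add: C_def)
  define E where "E = real N ^ 6"
  have E1: "E \<ge> 1" unfolding E_def using N by (intro one_le_power) auto
  have YX: "Y \<le> X" unfolding X_def Y_def using k by (intro div_le_mono2) auto
  have main: "real k powr (-t) * (\<Sum>m=1..X. moebius_twist t m) - real (Suc k) powr (-t) * (\<Sum>m=1..Y. moebius_twist t m)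
      \<le> real n * \<psi> t / selberg_G t N + 3 * E * real k powr (-t)" if t: "t \<ge> 0" for t
  proof -
    define G where "G = selberg_G t N"
    define u v where "u = real k powr (-t)" and "v = real (Suc k) powr (-t)"
    have uv: "0 \<le> v" "v \<le> u" unfolding u_def v_def using k t by (auto intro!: powr_mono2')
    have G: "G \<ge> 1" unfolding G_def by (rule selberg_G_ge_1) (use N t in auto)
    have s1: "(\<Sum>m\<in>{Y<..X}. moebius_twist t m) \<le> real (X - Y) / G + E"
      unfolding G_def E_def by (rule selberg_sieve) (use N t YX in auto)
    have s2: "(\<Sum>m\<in>{0<..Y}. moebius_twist t m) \<le> real (Y - 0) / G + E"
      unfolding G_def E_def by (rule selberg_sieve) (use N t YX in auto)
    have Yn: "real Y \<le> real n / (real k + 1)" unfolding Y_def using of_nat_div_le_of_nat[of n "Suc k", where 'a = real] by (simp add: add.commute)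
    have Xn: "real X \<le> real n / real k" unfolding X_def by (rule of_nat_div_le_of_nat)
    have Yg: "real n / (real k + 1) \<le> real Y + 1"
    proof -
      have "n < Suc k + Suc k * Y" unfolding Y_def by (rule dividend_less_times_div) simp
      hence "real n < real (Suc k + Suc k * Y)" by (simp only: of_nat_less_iff)
      hence "real n < (real k + 1) * (real Y + 1)" by (simp add: algebra_simps)
      thus ?thesis by (simp add: field_simps)
    qed
    have XY: "real (X - Y) \<le> real n / real k - real n / (real k + 1) + 1"
      using YX Xn Yg by (simp add: of_nat_diff)
    have set1: "{1..X} = {0<..Y} \<union> {Y<..X}" "{0<..Y} \<inter> {Y<..X} = {}" "{1..Y} = {0<..Y}" using YX by auto
    \<comment> \<open>Both coefficients \<open>u\<close> and \<open>u - v\<close> are nonnegative,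
      so the sieve, an upper bound only, may be applied on both intervals. After the interval
      lengths are replaced by real quotients the main terms recombine exactly to
      \<open>\<psi> t\<close>; the rounding loss \<open>u / G\<close> is absorbed into the
      error.\<close>
    have "u * (\<Sum>m=1..X. moebius_twist t m) - v * (\<Sum>m=1..Y. moebius_twist t m)
        = u * (\<Sum>m\<in>{Y<..X}. moebius_twist t m) + (u - v) * (\<Sum>m\<in>{0<..Y}. moebius_twist t m)"
      unfolding set1(1,3) by (subst sum.union_disjoint) (use set1(2) in \<open>auto simp: algebra_simps\<close>)
    also have "\<dots> \<le> u * (real (X - Y) / G + E) + (u - v) * (real Y / G + E)"
      using s1 s2 uv by (intro add_mono mult_left_mono) auto
    also have "\<dots> \<le> u * ((real n / real k - real n / (real k + 1) + 1) / G + E) + (u - v) * (real n / (real k + 1) / G + E)"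
      using uv XY Yn G by (intro add_mono mult_left_mono divide_right_mono) auto
    also have "\<dots> = real n * (u / real k - v / (real k + 1)) / G + u / G + (2 * u - v) * E"
      using G by (simp add: add_divide_distrib diff_divide_distrib algebra_simps)
    also have "\<dots> \<le> real n * (u / real k - v / (real k + 1)) / G + u * E + 2 * u * E"
    proof -
      have "u / G \<le> u / 1" using G uv by (intro divide_left_mono) auto
      also have "\<dots> \<le> u * E" using E1 uv mult_left_mono[of 1 E u] by simp
      finally have "u / G \<le> u * E" .
      moreover have "(2 * u - v) * E \<le> (2 * u) * E" using uv E1 by (intro mult_right_mono) auto
      ultimately show ?thesis by linarith
    qed
    also have "u / real k - v / (real k + 1) = \<psi> t"
      unfolding u_def v_def \<psi>_def using powr_minus_one_minus[of k t] powr_minus_one_minus[of "Suc k" t] k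
      by (simp add: add.commute)
    finally show ?thesis by (simp add: u_def v_def G_def algebra_simps)
  qed
  have lhs: "has_bochner_integral lborel
     (\<lambda>t. (real k powr (-t) * (\<Sum>m=1..X. moebius_twist t m) * indicator {0..} t
          - real (Suc k) powr (-t) * (\<Sum>m=1..Y. moebius_twist t m) * indicator {0..} t)
          - real n * (\<psi> t * moebius_sum t * indicator {a..} t))
     ((floor_weight n k - floor_weight n (Suc k)) - real n * (smooth_weight a k - smooth_weight a (Suc k)))"
    unfolding X_def Y_def \<psi>_def
    by (intro has_bochner_integral_diff has_bochner_integral_floor_weight has_bochner_integral_mult_right
        has_bochner_integral_smooth_weight_diff a) (use k in auto)
  have rhs: "has_bochner_integral lborel
     (\<lambda>t. real n * real k powr (-2) * C * ((1 + t) * (a + t) * exp (- r * t) * indicator {0..} t)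
        + 3 * E * (exp (- l * t) * indicator {0..} t))
     (real n * real k powr (-2) * C * (exp (- r * 0) * ((1 + 0) * (a + 0) / r + (1 + a + 2 * 0) / r ^ 2 + 2 / r ^ 3))
        + 3 * E * (exp (- l * 0) / l))"
    by (intro has_bochner_integral_add has_bochner_integral_mult_right has_bochner_integral_exp_atLeast
        has_bochner_integral_quadratic_exp_atLeast) (use r l a in auto)
  have "(floor_weight n k - floor_weight n (Suc k)) - real n * (smooth_weight a k - smooth_weight a (Suc k))
    \<le> real n * real k powr (-2) * C * (exp (- r * 0) * ((1 + 0) * (a + 0) / r + (1 + a + 2 * 0) / r ^ 2 + 2 / r ^ 3))
        + 3 * E * (exp (- l * 0) / l)"
  proof (rule has_bochner_integral_le[OF lhs rhs])
    fix t :: real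
    show "(real k powr (-t) * (\<Sum>m=1..X. moebius_twist t m) * indicator {0..} t
          - real (Suc k) powr (-t) * (\<Sum>m=1..Y. moebius_twist t m) * indicator {0..} t)
          - real n * (\<psi> t * moebius_sum t * indicator {a..} t)
       \<le> real n * real k powr (-2) * C * ((1 + t) * (a + t) * exp (- r * t) * indicator {0..} t)
        + 3 * E * (exp (- l * t) * indicator {0..} t)"
    proof (cases "t \<ge> 0")
      case t: True
      define Z where "Z = (if t \<ge> a then moebius_sum t else 0)"
      have \<psi>: "0 \<le> \<psi> t" "\<psi> t \<le> (1 + t) * real k powr (-2)"
      proof -
        show "0 \<le> \<psi> t" unfolding \<psi>_def by (rule powr_diff_bounds) (use k t in auto)
        have "\<psi> t \<le> (1 + t) * real k powr (-2 - t)" unfolding \<psi>_def by (rule powr_diff_bounds) (use k t in auto)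
        also have "\<dots> \<le> (1 + t) * real k powr (-2)" using k t by (intro mult_left_mono powr_mono) auto
        finally show "\<psi> t \<le> (1 + t) * real k powr (-2)" .
      qed
      have "real n * \<psi> t / selberg_G t N - real n * (\<psi> t * Z) = real n * \<psi> t * (1 / selberg_G t N - Z)"
        by (simp add: algebra_simps)
      also have "\<dots> \<le> real n * \<psi> t * (C * (a + t) * exp (- r * t))"
        unfolding Z_def C_def r_def using \<psi> N c a t by (intro mult_left_mono sieve_density_bound) auto
      also have "\<dots> \<le> real n * ((1 + t) * real k powr (-2)) * (C * (a + t) * exp (- r * t))"
        using \<psi> C a t by (intro mult_right_mono mult_left_mono) auto
      finally have 1: "real n * \<psi> t / selberg_G t N - real n * (\<psi> t * Z)
         \<le> real n * real k powr (-2) * C * ((1 + t) * (a + t) * exp (- r * t))" by (simp add: mult_ac)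
      have 2: "\<psi> t * moebius_sum t * indicator {a..} t = \<psi> t * Z" by (simp add: Z_def split: split_indicator)
      have 3: "real k powr (-t) = exp (- l * t)" unfolding l_def by (rule powr_eq_exp_times(2)) (use k in auto)
      have "3 * E * real k powr (-t) = 3 * E * exp (- l * t)" by (simp only: 3)
      moreover have "indicator {0..} t = (1::real)" using t by simp
      ultimately show ?thesis unfolding 2 using main[OF t] 1
        by (simp only: mult_1_right)
    qed (use a in \<open>auto split: split_indicator\<close>)
  qed
  also have "\<dots> \<le> real n * real k powr (-2) * C * (a / r + (1 + a) / r ^ 2 + 2 / r ^ 3) + 6 * E"
  proof -
    have "3 * E * (1 / l) \<le> 3 * E * 2" using l E1 by (intro mult_left_mono) (auto simp: field_simps)
    thus ?thesis by simp
  qed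
  finally show ?thesis by (simp add: r_def E_def)
qed

subsection \<open>The Dirichlet series of the weight difference\<close>

text \<open>The coefficient of \<open>S(k)\<close> in the deviation is \<open>weight_diff n k - weight_diff n (k + 1)\<close>. The value
  \<open>floor_kernel n 1\<close> is a division by \<open>ln 1 = 0\<close>; it is only ever multiplied by \<open>ln 1\<close> or by \<open>S(1) = 0\<close>.\<close>

definition weight_diff :: "nat \<Rightarrow> nat \<Rightarrow> real" where
  "weight_diff n k = floor_weight n k - real n * smooth_weight (1 / ln (real n)) k"

definition floor_kernel :: "nat \<Rightarrow> nat \<Rightarrow> real" where
  "floor_kernel n j = (real (n div j) - real n * real j powr (-1 - 1 / ln (real n))) / ln (real j)"

lemma floor_weight_eq_infsum:
  assumes "k \<ge> 1"
  shows "((\<lambda>e. moebius_mu e * (real (n div (k * e)) / ln (real (k * e)))) has_sum floor_weight n k) {1..}"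
  unfolding floor_weight_def
proof (rule has_sum_finite_neutralI)
  show "moebius_mu e * (real (n div (k * e)) / ln (real (k * e))) = 0" if "e \<in> {1..} - {1..n}" for e
  proof -
    have "n < 1 * e" using that by auto
    also have "\<dots> \<le> k * e" using assms by (intro mult_le_mono1)
    finally show ?thesis by simp
  qed
qed auto

lemma weight_diff_has_sum:
  assumes "n \<ge> 2" "k \<ge> 1"
  shows "((\<lambda>e. moebius_mu e * floor_kernel n (k * e)) has_sum weight_diff n k) {1..}"
proof -
  have "1 / ln (real n) > 0" using assms by simp
  from has_sum_infsum[OF summable_on_smooth_weight[OF this, of k "{1..}"]]
  have "((\<lambda>e. moebius_mu e * (real (k * e) powr (-1 - 1 / ln (real n)) / ln (real (k * e))))
    has_sum smooth_weight (1 / ln (real n)) k) {1..}" by (simp only: smooth_weight_def)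
  from has_sum_add[OF floor_weight_eq_infsum[OF assms(2), of n] has_sum_cmult_right[OF this, of "- real n"]]
  show ?thesis by (simp add: weight_diff_def floor_kernel_def diff_divide_distrib right_diff_distrib mult_ac)
qed

lemma floor_weight_eq_0: "k > n \<Longrightarrow> floor_weight n k = 0"
  unfolding floor_weight_def
proof (rule sum.neutral, rule ballI)
  fix e assume "k > n" "e \<in> {1..n}"
  hence "n < k * 1" "k * 1 \<le> k * e" by (auto intro!: mult_le_mono2)
  hence "n < k * e" by linarith
  thus "moebius_mu e * (real (n div (k * e)) / ln (real (k * e))) = 0" by simp
qed

lemma inverse_ln_le_2: "n \<ge> 2 \<Longrightarrow> 1 / ln (real n) \<le> 2"
  using ln_ge_half[of n] by (simp add: field_simps)

lemma powr_neg_inverse_ln: "n \<ge> 2 \<Longrightarrow> real n powr (- (1 / ln (real n))) = exp (-1)"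
  by (simp add: powr_def)

text \<open>This is what makes 1/ln n the right scale: up to \<open>n\<close> the factor j^(-1/ln n)
  lies between 1/e and 1, while beyond \<open>n\<close> it secures convergence.\<close>

lemma powr_neg_ge:
  assumes "n \<ge> 2" "1 \<le> j" "j \<le> n"
  shows "real j powr (- (1 / ln (real n))) \<ge> exp (-1)"
proof -
  have "real n powr (- (1 / ln (real n))) \<le> real j powr (- (1 / ln (real n)))"
    using assms by (intro powr_mono2') auto
  thus ?thesis using powr_neg_inverse_ln[OF assms(1)] by simp
qed

text \<open>For \<open>j \<le> n\<close> the numerator is n/j (1 - j^-a) up to 1, and 1 - j^-a <= a
  ln j cancels the denominator. For \<open>j > n\<close> the floor vanishes and 1/ln j <= a
  directly.\<close>

lemma abs_floor_kernel_le:
  assumes n: "n \<ge> 2" and j: "j \<ge> 2"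
  shows "\<bar>floor_kernel n j\<bar> \<le> exp 1 * real n / ln (real n) * real j powr (-1 - 1 / ln (real n))
    + (if j \<le> n then 1 / ln (real j) else 0)"
proof -
  define a where "a = 1 / ln (real n)"
  have a: "a > 0" using n by (simp add: a_def)
  have lj: "ln (real j) > 0" using j by simp
  have pj: "real j powr (-1 - a) = real j powr (-a) / real j" by (rule powr_minus_one_minus) (use j in auto)
  show ?thesis
  proof (cases "j \<le> n")
    case True
    define x where "x = real j powr (-a)"
    have x: "exp (-1) \<le> x" unfolding x_def a_def by (rule powr_neg_ge) (use n j True in auto)
    have "1 + (- a * ln (real j)) \<le> exp (- a * ln (real j))" by (rule exp_ge_add_one_self)
    hence x1: "1 - x \<le> a * ln (real j)" unfolding x_def using j by (simp add: powr_def)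
    have x2: "x \<le> 1" unfolding x_def using j a by (simp add: powr_def)
    have f: "real (n div j) \<le> real n / real j" "real n / real j - 1 \<le> real (n div j)"
    proof -
      show "real (n div j) \<le> real n / real j" by (rule of_nat_div_le_of_nat)
      have "n < j + j * (n div j)" by (rule dividend_less_times_div) (use j in simp)
      hence "real n < real (j + j * (n div j))" by (simp only: of_nat_less_iff)
      thus "real n / real j - 1 \<le> real (n div j)" using j by (simp add: field_simps)
    qed
    have "real n / real j * (1 - x) \<ge> 0" using x2 by simp
    moreover have "real n * real j powr (-1 - a) = real n / real j - real n / real j * (1 - x)"
      unfolding pj x_def by (simp add: right_diff_distrib)
    ultimately have "\<bar>real (n div j) - real n * real j powr (-1 - a)\<bar> \<le> real n / real j * (1 - x) + 1"
      using f by linarith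
    also have "\<dots> \<le> real n / real j * (a * ln (real j)) + 1"
      using x1 by (intro add_right_mono mult_left_mono) auto
    finally have "\<bar>real (n div j) - real n * real j powr (-1 - a)\<bar> / ln (real j)
       \<le> (real n / real j * (a * ln (real j)) + 1) / ln (real j)" using lj by (intro divide_right_mono) auto
    also have "\<dots> = real n * a / real j * 1 + 1 / ln (real j)" using lj by (simp add: field_simps)
    \<comment> \<open>Inserting \<open>exp 1 * x \<ge> 1\<close> restores the factor j^-a, so that
      one summable majorant serves all \<open>j\<close>.\<close>
    also have "\<dots> \<le> real n * a / real j * (exp 1 * x) + 1 / ln (real j)"
    proof -
      have "exp 1 * exp (-1) \<le> exp 1 * x" using x by (intro mult_left_mono) auto
      hence "1 \<le> exp 1 * x" by (simp add: exp_minus)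
      thus ?thesis using a by (intro add_right_mono mult_left_mono) auto
    qed
    also have "real n * a / real j * (exp 1 * x) = exp 1 * real n / ln (real n) * real j powr (-1 - 1 / ln (real n))"
      using pj unfolding x_def by (simp add: a_def)
    finally show ?thesis using True lj by (simp add: floor_kernel_def a_def abs_divide)
  next
    case False
    hence "n div j = 0" by simp
    moreover have "1 / ln (real j) \<le> 1 / ln (real n)" using False n by (intro divide_left_mono ln_mono mult_pos_pos) auto
    ultimately have "\<bar>floor_kernel n j\<bar> \<le> real n * real j powr (-1 - a) * a"
      using lj mult_left_mono[of "1 / ln (real j)" "1 / ln (real n)" "real n * real j powr (-1 - a)"]
      by (simp add: floor_kernel_def a_def abs_mult abs_divide)
    also have "\<dots> \<le> exp 1 * (real n * real j powr (-1 - a) * a)"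
      using a one_le_exp_iff[of 1] by (intro mult_right_mono[of 1 "exp 1", simplified]) auto
    finally show ?thesis using False by (simp add: a_def mult_ac)
  qed
qed

lemma sum_inverse_ln_le:
  assumes n: "n \<ge> 2"
  shows "(\<Sum>j=2..n. 1 / ln (real j)) \<le> 6 * real n / ln (real n)"
proof -
  define L where "L = ln (real n)"
  have L: "L > 0" using n by (simp add: L_def)
  have sq: "sqrt (real n) \<le> 2 * real n / L"
  proof -
    have "ln (sqrt (real n)) \<le> sqrt (real n)" using n by (intro order.trans[OF ln_le_minus_one]) auto
    hence "L \<le> 2 * sqrt (real n)" unfolding L_def using n by (simp add: ln_sqrt)
    hence "L * sqrt (real n) \<le> 2 * sqrt (real n) * sqrt (real n)" by (intro mult_right_mono) auto
    also have "\<dots> = 2 * real n" by simp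
    finally have "L * sqrt (real n) \<le> 2 * real n" .
    thus ?thesis using L by (simp add: field_simps)
  qed
  have "(\<Sum>j=2..n. 1 / ln (real j)) \<le> (\<Sum>j=2..n. (if real j \<le> sqrt (real n) then 2 else 0) + 2 / L)"
  proof (rule sum_mono)
    fix j assume j: "j \<in> {2..n}"
    show "1 / ln (real j) \<le> (if real j \<le> sqrt (real n) then 2 else 0) + 2 / L"
    proof (cases "real j \<le> sqrt (real n)")
      case True
      thus ?thesis using inverse_ln_le_2[of j] j L by (simp add: add_increasing2)
    next
      case False
      hence "ln (sqrt (real n)) \<le> ln (real j)" using n by (intro ln_mono) auto
      hence "L / 2 \<le> ln (real j)" using n by (simp add: L_def ln_sqrt)
      thus ?thesis using False L by (simp add: field_simps)
    qed
  qed
  also have "\<dots> = (\<Sum>j=2..n. if real j \<le> sqrt (real n) then 2 else 0) + real (n - 1) * (2 / L)"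
    by (simp add: sum.distrib)
  also have "(\<Sum>j=2..n. if real j \<le> sqrt (real n) then 2 else (0::real)) = 2 * real (card {j\<in>{2..n}. real j \<le> sqrt (real n)})"
    by (simp add: sum.If_cases Int_def)
  also have "card {j\<in>{2..n}. real j \<le> sqrt (real n)} \<le> card {1..nat \<lfloor>sqrt (real n)\<rfloor>}"
    by (intro card_mono) (auto simp: le_nat_floor)
  also have "real (card {1..nat \<lfloor>sqrt (real n)\<rfloor>}) \<le> sqrt (real n)" by simp
  also have "real (n - 1) * (2 / L) \<le> real n * (2 / L)" using L by (intro mult_right_mono) auto
  finally have "(\<Sum>j=2..n. 1 / ln (real j)) \<le> 2 * sqrt (real n) + real n * (2 / L)" by simp
  also have "\<dots> \<le> 2 * (2 * real n / L) + real n * (2 / L)" using sq by simp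
  finally show ?thesis by (simp add: L_def)
qed

text \<open>Only even arguments are summed, which leaves out the junk term \<open>weight_diff n 1\<close>.\<close>

lemma weight_diff_dirichlet_bound:
  assumes n: "n \<ge> 2" and \<tau>: "0 \<le> \<tau>" "\<tau> \<le> 3 / ln (real n)"
  shows "(\<lambda>l. real l powr (-\<tau>) * weight_diff n (2 * l)) summable_on {1..}"
    and "\<bar>\<Sum>\<^sub>\<infinity>l\<in>{1..}. real l powr (-\<tau>) * weight_diff n (2 * l)\<bar> \<le> (12 * exp 1 + 6) * real n / ln (real n)"
proof -
  define a where "a = 1 / ln (real n)"
  have a: "a > 0" "a \<le> 2" using n inverse_ln_le_2[OF n] by (auto simp: a_def)
  have \<tau>3: "\<tau> \<le> 3 * a" using \<tau> by (simp add: a_def)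
  define B where "B = exp 1 * real n * a"
  have B: "B \<ge> 0" using a by (simp add: B_def)
  have kb: "\<bar>floor_kernel n j\<bar> \<le> B * real j powr (-1 - a) + (if j \<le> n then 1 / ln (real j) else 0)" if "j \<ge> 2" for j
    using abs_floor_kernel_le[OF n that] by (simp add: B_def a_def)
  define f where "f = (\<lambda>d e. real d powr (-\<tau>) * (moebius_mu e * floor_kernel n (2 * d * e)))"
  have sm: "(\<lambda>(d, e). f d e) summable_on {1..} \<times> {1..}"
  \<comment> \<open>Only absolute convergence is at stake here, so the finitely many terms with 2de
    <= n are absorbed into a wasteful constant depending on \<open>n\<close>.\<close>
  proof (rule summable_on_Times_product_bound)
    show "(\<lambda>d. (B + 2 * real n powr (1 + a)) * real d powr (-1 - a)) summable_on {1::nat..}"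
      by (rule summable_on_cmult_right[OF summable_on_powr[OF a(1)]])
    show "(\<lambda>d. real d powr (-1 - a)) summable_on {1::nat..}"
      by (rule summable_on_powr[OF a(1)])
    fix d e :: nat assume de: "d \<in> {1..}" "e \<in> {1..}"
    hence j: "2 * d * e \<ge> 2" by simp
    have "real d powr (-\<tau>) \<le> 1 powr (-\<tau>)" using de \<tau> by (intro powr_mono2') auto
    hence "\<bar>real d powr (-\<tau>)\<bar> \<le> 1" by simp
    hence "norm (f d e) \<le> 1 * (1 * \<bar>floor_kernel n (2 * d * e)\<bar>)"
      unfolding f_def real_norm_def abs_mult by (intro mult_mono abs_moebius_mu_le) auto
    also have "\<dots> \<le> B * real (2 * d * e) powr (-1 - a) + (if 2 * d * e \<le> n then 1 / ln (real (2 * d * e)) else 0)"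
      using kb[OF j] by simp
    also have "\<dots> \<le> B * real (2 * d * e) powr (-1 - a) + 2 * real n powr (1 + a) * real (2 * d * e) powr (-1 - a)"
    proof (intro add_left_mono)
      show "(if 2 * d * e \<le> n then 1 / ln (real (2 * d * e)) else 0) \<le> 2 * real n powr (1 + a) * real (2 * d * e) powr (-1 - a)"
      proof (cases "2 * d * e \<le> n")
        case True
        have "real n powr (1 + a) * real n powr (-1 - a) \<le> real n powr (1 + a) * real (2 * d * e) powr (-1 - a)"
          using True j a by (intro mult_left_mono powr_mono2') (simp_all only: of_nat_le_iff of_nat_0_less_iff, auto)
        also have "real n powr (1 + a) * real n powr (-1 - a) = 1" using n by (simp add: powr_add[symmetric])
        finally show ?thesis using inverse_ln_le_2[OF j] True by simp
      qed simp
    qed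
    also have "\<dots> = (B + 2 * real n powr (1 + a)) * real (2 * d * e) powr (-1 - a)" by (simp add: algebra_simps)
    also have "\<dots> \<le> (B + 2 * real n powr (1 + a)) * real (d * e) powr (-1 - a)"
      using B de a by (intro mult_left_mono powr_mono2') auto
    also have "\<dots> = (B + 2 * real n powr (1 + a)) * real d powr (-1 - a) * real e powr (-1 - a)"
      by (simp add: powr_mult)
    finally show "norm (f d e) \<le> (B + 2 * real n powr (1 + a)) * real d powr (-1 - a) * real e powr (-1 - a)" .
  qed (use B in auto)
  have inner: "(\<Sum>\<^sub>\<infinity>e\<in>{1..}. f d e) = real d powr (-\<tau>) * weight_diff n (2 * d)" if "d \<in> {1..}" for d
    unfolding f_def using has_sum_cmult_right[OF weight_diff_has_sum[OF n, of "2 * d"], of "real d powr (-\<tau>)"] that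
    by (intro infsumI) auto
  have "(\<lambda>d. \<Sum>\<^sub>\<infinity>e\<in>{1..}. f d e) summable_on {1..}"
    using summable_on_Sigma_banach[of f "{1..}" "\<lambda>_. {1..}"] sm by simp
  thus "(\<lambda>l. real l powr (-\<tau>) * weight_diff n (2 * l)) summable_on {1..}"
    using inner by (subst (asm) summable_on_cong) auto
  \<comment> \<open>Absolute values are taken only after grouping by \<open>j = d * e\<close>: the
    coefficient of \<open>floor_kernel n (2 * j)\<close> is then a Moebius convolution, bounded by
    the twist rather than by the number of divisors.\<close>
  have conv: "\<bar>\<Sum>d | d dvd j. f d (j div d)\<bar> \<le> \<bar>floor_kernel n (2 * j)\<bar> * moebius_twist \<tau> j" if j: "j \<in> {1..}" for j
  proof -
    have "(\<Sum>d | d dvd j. f d (j div d)) = (\<Sum>e | e dvd j. floor_kernel n (2 * j) * (moebius_mu e * real (j div e) powr (-\<tau>)))"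
      by (rule sum.reindex_bij_witness[where i = "\<lambda>e. j div e" and j = "\<lambda>d. j div d"])
         (use j in \<open>auto simp: f_def div_dvd_iff_mult dvd_div_eq_mult mult_ac\<close>)
    also have "\<dots> = floor_kernel n (2 * j) * (\<Sum>e | e dvd j. moebius_mu e * real (j div e) powr (-\<tau>))"
      by (simp only: sum_distrib_left)
    also have "\<bar>\<dots>\<bar> \<le> \<bar>floor_kernel n (2 * j)\<bar> * moebius_twist \<tau> j"
      unfolding abs_mult using j \<tau> by (intro mult_left_mono moebius_mu_convolution_bound) auto
    finally show ?thesis .
  qed
  define g where "g = (\<lambda>j::nat. if j \<in> {j\<in>{1..n}. 2 * j \<le> n} then 1 / ln (real (2 * j)) else 0)"
  have bound: "\<bar>\<Sum>d | d dvd j. f d (j div d)\<bar> \<le> B * (moebius_twist \<tau> j * real j powr (-1 - a)) + g j" if j: "j \<in> {1..}" for j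
  proof -
    have m: "0 \<le> moebius_twist \<tau> j" "moebius_twist \<tau> j \<le> 1" using moebius_twist_nonneg[of j \<tau>] moebius_twist_le_1[of j \<tau>] \<tau> j by auto
    have "\<bar>\<Sum>d | d dvd j. f d (j div d)\<bar> \<le> \<bar>floor_kernel n (2 * j)\<bar> * moebius_twist \<tau> j" by (rule conv[OF j])
    also have "\<dots> \<le> (B * real (2 * j) powr (-1 - a) + (if 2 * j \<le> n then 1 / ln (real (2 * j)) else 0)) * moebius_twist \<tau> j"
      using m j by (intro mult_right_mono kb) auto
    also have "\<dots> \<le> (B * real j powr (-1 - a)) * moebius_twist \<tau> j + (if 2 * j \<le> n then 1 / ln (real (2 * j)) else 0) * 1"
      unfolding distrib_right using m j a B by (intro add_mono mult_right_mono mult_left_mono powr_mono2') auto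
    also have "\<dots> = B * (moebius_twist \<tau> j * real j powr (-1 - a)) + g j" using j by (auto simp: g_def)
    finally show ?thesis .
  qed
  have gs: "(g has_sum (\<Sum>j | j \<in> {1..n} \<and> 2 * j \<le> n. 1 / ln (real (2 * j)))) {1..}"
    by (rule has_sum_finite_neutralI[of "{j\<in>{1..n}. 2 * j \<le> n}"]) (auto simp: g_def intro!: sum.cong)
  have "(\<Sum>j | j \<in> {1..n} \<and> 2 * j \<le> n. 1 / ln (real (2 * j))) = (\<Sum>i\<in>(\<lambda>j. 2 * j) ` {j. j \<in> {1..n} \<and> 2 * j \<le> n}. 1 / ln (real i))"
    by (subst sum.reindex) (auto simp: inj_on_def)
  also have "\<dots> \<le> (\<Sum>i=2..n. 1 / ln (real i))" by (rule sum_mono2) auto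
  also have "\<dots> \<le> 6 * real n / ln (real n)" by (rule sum_inverse_ln_le[OF n])
  finally have gle: "(\<Sum>j | j \<in> {1..n} \<and> 2 * j \<le> n. 1 / ln (real (2 * j))) \<le> 6 * real n * a" by (simp add: a_def)
  have ms: "((\<lambda>j. moebius_twist \<tau> j * real j powr (-1 - a)) has_sum (zeta1 a * moebius_sum (a + \<tau>))) {1..}"
    using has_sum_infsum[OF infsum_moebius_twist_powr(1)[OF a(1) \<tau>(1)]] infsum_moebius_twist_powr(2)[OF a(1) \<tau>(1)] by simp
  \<comment> \<open>The decisive cancellation: \<open>\<tau> \<le> 3 * a\<close> makes the second
    factor at most 4a, which offsets the 1/a from zeta. With \<open>a \<le> 2\<close> the result 4 +
    4a is at most 12.\<close>
  have "zeta1 a * moebius_sum (a + \<tau>) \<le> (1 + 1 / a) * (4 * a)"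
  proof (intro mult_mono)
    show "moebius_sum (a + \<tau>) \<le> 4 * a" using moebius_sum_bounds(3)[of "a + \<tau>"] a \<tau> \<tau>3 by simp
    show "0 \<le> moebius_sum (a + \<tau>)" using moebius_sum_bounds(2)[of "a + \<tau>"] a \<tau> by simp
  qed (use zeta1_le'[OF a(1)] a in auto)
  also have "\<dots> = 4 + 4 * a" using a by (simp add: field_simps)
  finally have z: "zeta1 a * moebius_sum (a + \<tau>) \<le> 12" using a by simp
  have fs: "((\<lambda>j. \<Sum>d | d dvd j. f d (j div d)) has_sum (\<Sum>\<^sub>\<infinity>d\<in>{1..}. \<Sum>\<^sub>\<infinity>e\<in>{1..}. f d e)) {1..}"
    using has_sum_infsum[OF infsum_divisor_convolution(1)[OF sm]] infsum_divisor_convolution(2)[OF sm] by simp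
  have "\<bar>\<Sum>\<^sub>\<infinity>l\<in>{1..}. real l powr (-\<tau>) * weight_diff n (2 * l)\<bar> = norm (\<Sum>\<^sub>\<infinity>d\<in>{1..}. \<Sum>\<^sub>\<infinity>e\<in>{1..}. f d e)"
    unfolding real_norm_def by (rule arg_cong[where f = abs], rule infsum_cong, rule inner[symmetric])
  also have "\<dots> \<le> B * (zeta1 a * moebius_sum (a + \<tau>)) + (\<Sum>j | j \<in> {1..n} \<and> 2 * j \<le> n. 1 / ln (real (2 * j)))"
    by (rule norm_infsum_le[OF fs has_sum_add[OF has_sum_cmult_right[OF ms] gs]]) (use bound in auto)
  also have "\<dots> \<le> B * 12 + 6 * real n * a" using z gle B by (intro add_mono mult_left_mono)
  also have "\<dots> = (12 * exp 1 + 6) * real n / ln (real n)" by (simp add: B_def a_def algebra_simps add_divide_distrib)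
  finally show "\<bar>\<Sum>\<^sub>\<infinity>l\<in>{1..}. real l powr (-\<tau>) * weight_diff n (2 * l)\<bar> \<le> (12 * exp 1 + 6) * real n / ln (real n)" .
qed

subsection \<open>Total variation of the weight difference\<close>

text \<open>Abel summation for a partial sum that jumps only at even \<open>k = 2 * l\<close>. It
  turns sums over increments of \<open>x\<close>, weighted by something comparable to k, into sums
  of \<open>x\<close> at even arguments, the form that the Dirichlet bound controls.\<close>

lemma sum_half_partial_sums:
  fixes g x :: "nat \<Rightarrow> real"
  shows "(\<Sum>k=1..n. (\<Sum>l=1..k div 2. g l) * (x k - x (Suc k)))
     = (\<Sum>l=1..n div 2. g l * x (2 * l)) - (\<Sum>l=1..n div 2. g l) * x (Suc n)"
proof (induction n)
  case (Suc n)
  have step: "(\<Sum>l=1..Suc n div 2. g l * x (2 * l)) - (\<Sum>l=1..Suc n div 2. g l) * x (Suc (Suc n))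
    = (\<Sum>l=1..n div 2. g l * x (2 * l)) - (\<Sum>l=1..n div 2. g l) * x (Suc n)
      + (\<Sum>l=1..Suc n div 2. g l) * (x (Suc n) - x (Suc (Suc n)))"
  proof (cases "even n")
    case True
    hence "Suc n div 2 = n div 2" by simp
    thus ?thesis by (simp add: algebra_simps)
  next
    case False
    then obtain m where m: "n = 2 * m + 1" by (elim oddE)
    have d: "Suc n div 2 = Suc m" "n div 2 = m" "Suc n = 2 * Suc m" using m by simp_all
    have "(\<Sum>l=1..Suc m. g l * x (2 * l)) = (\<Sum>l=1..m. g l * x (2 * l)) + g (Suc m) * x (2 * Suc m)"
      "(\<Sum>l=1..Suc m. g l) = (\<Sum>l=1..m. g l) + g (Suc m)" by simp_all
    thus ?thesis unfolding d(1,2) unfolding d(3)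
      by (simp only: distrib_right right_diff_distrib)
  qed
  show ?case using Suc.IH step by simp
qed simp

text \<open>The weight on the right is nonnegative and, thanks to the square, small for small
  \<open>l\<close>; the left side shows it as a combination of exponents a, 2a, 3a. This explains
  the range of \<open>\<tau>\<close> up to \<open>3 / ln n\<close> in the Dirichlet bound.\<close>

lemma powr_weight_square:
  fixes a :: real
  assumes "l \<ge> 1"
  shows "real l powr (-a) - 2 * real l powr (-(2 * a)) + real l powr (-(3 * a)) = real l powr (-a) * (1 - real l powr (-a))\<^sup>2"
proof -
  define x where "x = real l powr (-a)"
  have x2: "real l powr (-(2 * a)) = x * x" unfolding x_def by (simp flip: powr_add)
  have x3: "real l powr (-(3 * a)) = x * x * x" unfolding x_def by (simp flip: powr_add)
  show ?thesis unfolding x2 x3 x_def[symmetric] by (simp add: power2_eq_square algebra_simps)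
qed

text \<open>The square is at most (a ln(2l))^2 and cancels the squared logarithm in
  \<open>smooth_weight_le\<close>. What remains is a^2 times the sum of l^(-1-a), of order a.
  Without the square small \<open>l\<close> would spoil this.\<close>

lemma summable_infsum_square_weight:
  assumes a: "a > 0" "a \<le> 2"
  defines "q \<equiv> \<lambda>l. real l powr (-a) * (1 - real l powr (-a))\<^sup>2"
  shows "(\<lambda>l. q l * smooth_weight a (2 * l)) summable_on {1..}"
    and "(\<Sum>\<^sub>\<infinity>l\<in>{1..}. q l * smooth_weight a (2 * l)) \<le> 15 / 2 * a"
proof -
  have bd: "0 \<le> q l * smooth_weight a (2 * l) \<and> q l * smooth_weight a (2 * l) \<le> 5 / 2 * a\<^sup>2 * real l powr (-1 - a)" if l: "l \<in> {1..}" for l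
  proof -
    define y where "y = real l powr (-a)"
    define L where "L = ln (real (2 * l))"
    have L: "L \<ge> 1 / 2" unfolding L_def by (rule ln_ge_half) (use l in auto)
    have "1 + (- a * ln (real l)) \<le> exp (- a * ln (real l))" by (rule exp_ge_add_one_self)
    also have "exp (- a * ln (real l)) = y" unfolding y_def using l by (simp add: powr_def)
    finally have "1 - y \<le> a * ln (real l)" by simp
    also have "\<dots> \<le> a * L" unfolding L_def using l a by (intro mult_left_mono ln_mono) auto
    finally have y1: "1 - y \<le> a * L" .
    have y2: "y \<le> 1" unfolding y_def using l a by (simp add: powr_def)
    have "(1 - y)\<^sup>2 \<le> (a * L)\<^sup>2" using y1 y2 by (intro power_mono) auto
    moreover have y0: "y \<ge> 0" by (simp add: y_def)
    moreover have s0: "smooth_weight a (2 * l) \<ge> 0" by (rule smooth_weight_nonneg) (use a l in auto)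
    moreover have "smooth_weight a (2 * l) \<le> 5 / (real (2 * l) * L\<^sup>2)"
      unfolding L_def by (rule smooth_weight_le) (use a l in auto)
    ultimately have "y * (1 - y)\<^sup>2 * smooth_weight a (2 * l) \<le> y * (a * L)\<^sup>2 * (5 / (real (2 * l) * L\<^sup>2))"
      by (intro mult_mono mult_left_mono) auto
    also have "\<dots> = 5 / 2 * a\<^sup>2 * (y / real l)" using L by (simp add: power_mult_distrib field_simps)
    also have "y / real l = real l powr (-1 - a)"
      unfolding y_def by (rule powr_minus_one_minus[symmetric]) (use l in auto)
    finally show ?thesis using y0 s0 by (simp add: q_def y_def)
  qed
  have maj: "(\<lambda>l. 5 / 2 * a\<^sup>2 * real l powr (-1 - a)) summable_on {1::nat..}"
    by (rule summable_on_cmult_right[OF summable_on_powr[OF a(1)]])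
  show s: "(\<lambda>l. q l * smooth_weight a (2 * l)) summable_on {1..}"
    by (rule summable_on_comparison_test[OF maj]) (use bd in auto)
  have "(\<Sum>\<^sub>\<infinity>l\<in>{1..}. q l * smooth_weight a (2 * l)) \<le> (\<Sum>\<^sub>\<infinity>l\<in>{1::nat..}. 5 / 2 * a\<^sup>2 * real l powr (-1 - a))"
    by (rule infsum_mono[OF s maj]) (use bd in auto)
  also have "\<dots> = 5 / 2 * a\<^sup>2 * zeta1 a" unfolding zeta1_def by (rule infsum_cmult_right')
  also have "\<dots> \<le> 5 / 2 * a\<^sup>2 * (1 + 1 / a)" using zeta1_le'[OF a(1)] by (intro mult_left_mono) auto
  also have "\<dots> = 5 / 2 * a * (a + 1)" using a by (simp add: power2_eq_square field_simps)
  also have "\<dots> \<le> 5 / 2 * a * 3" using a by (intro mult_left_mono) auto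
  finally show "(\<Sum>\<^sub>\<infinity>l\<in>{1..}. q l * smooth_weight a (2 * l)) \<le> 15 / 2 * a" by simp
qed

lemma sum_inverse_le:
  assumes "n \<ge> 1"
  shows "(\<Sum>k=1..n. 1 / real k) \<le> 1 + ln (real n)"
  using assms
proof (induction n rule: dec_induct)
  case (step n)
  have "ln (real n / (real n + 1)) \<le> real n / (real n + 1) - 1" by (rule ln_le_minus_one) (use step in auto)
  also have "\<dots> = - 1 / (real n + 1)" by (simp add: field_simps)
  finally have "1 / real (Suc n) \<le> ln (real (Suc n)) - ln (real n)"
    using step by (simp add: ln_div add.commute)
  thus ?case using step by simp
qed simp

text \<open>Up to acceptable errors, the increments of \<open>weight_diff\<close> are bounded above for \<open>k \<le> K\<close> by the
  sieve and below for \<open>k > K\<close> because \<open>floor_weight\<close> is decreasing. One-sided bounds suffice, since signed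
  sums against smooth weights are controlled by \<open>weight_diff_dirichlet_bound\<close>. The weight \<open>Q\<close> treats
  \<open>k > K\<close>: its square factor makes the contribution of \<open>smooth_weight\<close> for small \<open>k\<close> negligible.
  The weight \<open>P\<close> then treats \<open>k \<le> K\<close>.\<close>

lemma sum_abs_weight_diff_le:
  fixes n :: nat and K E :: real
  assumes n: "n \<ge> 2" and E: "E \<ge> 0"
    and upper: "\<And>k. 2 \<le> k \<Longrightarrow> real k \<le> K \<Longrightarrow>
       weight_diff n k - weight_diff n (Suc k) \<le> E * real n / (real k * ln (real n))\<^sup>2"
    and K: "K \<ge> 4" and \<rho>: "\<rho> < 1"
    and large: "\<And>l. l \<le> n \<Longrightarrow> K \<le> 4 * real l \<Longrightarrow> real l powr (-(1 / ln (real n))) \<le> \<rho>"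
  defines "\<kappa> \<equiv> exp (-1) * (1 - \<rho>)\<^sup>2 / 8"
  defines "U \<equiv> 12 * exp 1 + 6"
  shows "(\<Sum>k=2..n. real k * \<bar>weight_diff n k - weight_diff n (Suc k)\<bar>)
     \<le> ((4 * U + 15) / \<kappa> + 3 * exp 1 * (6 * E + U + (4 * U + 15) / \<kappa>)) * (real n / ln (real n))"
proof -
  define a where "a = 1 / ln (real n)"
  have a: "a > 0" "a \<le> 2" using n inverse_ln_le_2[OF n] by (auto simp: a_def)
  have U0: "U \<ge> 0" by (simp add: U_def)
  have \<kappa>0: "\<kappa> > 0" using \<rho> by (simp add: \<kappa>_def)
  define h w I where "h = weight_diff n" and "w = floor_weight n" and "I = smooth_weight a"
  have hwI: "h k = w k - real n * I k" for k by (simp add: h_def w_def I_def weight_diff_def a_def)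
  have w_mono: "w (Suc k) \<le> w k" if "k \<ge> 2" for k unfolding w_def by (rule floor_weight_antimono[OF that])
  have w_0: "w k = 0" if "k > n" for k unfolding w_def by (rule floor_weight_eq_0[OF that])
  have I_mono: "I (Suc k) \<le> I k" if "k \<ge> 2" for k unfolding I_def by (rule smooth_weight_antimono[OF a(1) that])
  have I_0: "I k \<ge> 0" if "k \<ge> 2" for k unfolding I_def by (rule smooth_weight_nonneg[OF a(1) that])
  have h_neg: "h k \<le> 0" if "k > n" for k using w_0[OF that] I_0[of k] that n by (simp add: hwI)

  define q where "q = (\<lambda>l. real l powr (-a) * (1 - real l powr (-a))\<^sup>2)"
  define Q where "Q = (\<lambda>k. \<Sum>l=1..k div 2. q l)"
  define P where "P = (\<lambda>k. \<Sum>l=1..k div 2. real l powr (-a))"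
  have q0: "q l \<ge> 0" for l by (simp add: q_def)
  have Q0: "Q k \<ge> 0" for k unfolding Q_def by (intro sum_nonneg q0)
  \<comment> \<open>Both weights vanish at 1, so sums may start there without meeting the default
    value hidden in \<open>weight_diff n 1\<close>.\<close>
  have Qn: "Q 1 = 0" "P 1 = 0" by (simp_all add: Q_def P_def)

  define V where "V = (\<lambda>c. \<Sum>\<^sub>\<infinity>l\<in>{1..}. real l powr (-(c * a)) * h (2 * l))"
  have Vs: "((\<lambda>l. real l powr (-(c * a)) * h (2 * l)) has_sum V c) {1..}" and Vb: "\<bar>V c\<bar> \<le> U * (real n * a)"
    if "0 \<le> c" "c \<le> 3" for c
  proof -
    have c: "0 \<le> c * a" "c * a \<le> 3 / ln (real n)" using that a n by (auto simp: a_def divide_right_mono)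
    show "((\<lambda>l. real l powr (-(c * a)) * h (2 * l)) has_sum V c) {1..}"
      unfolding V_def h_def by (rule has_sum_infsum) (rule weight_diff_dirichlet_bound[OF n c])
    show "\<bar>V c\<bar> \<le> U * (real n * a)"
      unfolding V_def h_def U_def using weight_diff_dirichlet_bound(2)[OF n c] by (simp add: a_def)
  qed
  have qh: "((\<lambda>l. q l * h (2 * l)) has_sum (V 1 - 2 * V 2 + V 3)) {1..}"
  proof -
    have "((\<lambda>l. real l powr (-(1 * a)) * h (2 * l) + (- 2) * (real l powr (-(2 * a)) * h (2 * l)) + real l powr (-(3 * a)) * h (2 * l))
       has_sum (V 1 + (-2) * V 2 + V 3)) {1..}"
      by (intro has_sum_add has_sum_cmult_right Vs) auto
    also have "?this \<longleftrightarrow> ((\<lambda>l. q l * h (2 * l)) has_sum (V 1 + (-2) * V 2 + V 3)) {1..}"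
    proof (rule has_sum_cong)
      fix l :: nat assume "l \<in> {1..}"
      hence ql: "q l = real l powr (-a) - 2 * real l powr (-(2 * a)) + real l powr (-(3 * a))"
        unfolding q_def using powr_weight_square[of l a] by simp
      show "real l powr (-(1 * a)) * h (2 * l) + (- 2) * (real l powr (-(2 * a)) * h (2 * l)) + real l powr (-(3 * a)) * h (2 * l) = q l * h (2 * l)"
        unfolding ql by (simp add: algebra_simps)
    qed
    finally show ?thesis by simp
  qed
  define J where "J = (\<Sum>\<^sub>\<infinity>l\<in>{1..}. q l * I (2 * l))"
  have Js: "((\<lambda>l. q l * I (2 * l)) has_sum J) {1..}"
    unfolding J_def I_def q_def by (rule has_sum_infsum) (rule summable_infsum_square_weight[OF a])
  have Jb: "J \<le> 15 / 2 * a" unfolding J_def I_def q_def by (rule summable_infsum_square_weight[OF a])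

  \<comment> \<open>Since w = h + n I, the sum at even arguments splits into the three signed
    Dirichlet sums, with coefficients of total size 1 + 2 + 1 = 4, and the square-weighted sum of
    I.\<close>
  have S1: "(\<Sum>k=1..n. Q k * (w k - w (Suc k))) \<le> (4 * U + 15 / 2) * (real n * a)"
  proof -
    have "(\<Sum>k=1..n. Q k * (w k - w (Suc k))) = (\<Sum>l=1..n div 2. q l * w (2 * l))"
      unfolding Q_def sum_half_partial_sums by (simp add: w_0)
    also have "\<dots> = V 1 - 2 * V 2 + V 3 + real n * J"
    proof (rule has_sum_unique)
      show "((\<lambda>l. q l * w (2 * l)) has_sum (\<Sum>l=1..n div 2. q l * w (2 * l))) {1..}"
        by (rule has_sum_finite_neutralI) (auto simp: w_0)
      show "((\<lambda>l. q l * w (2 * l)) has_sum (V 1 - 2 * V 2 + V 3 + real n * J)) {1..}"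
        using has_sum_add[OF qh has_sum_cmult_right[OF Js, of "real n"]] by (simp add: hwI algebra_simps)
    qed
    also have "\<dots> \<le> 4 * (U * (real n * a)) + real n * (15 / 2 * a)"
      using Vb[of 1] Vb[of 2] Vb[of 3] mult_left_mono[OF Jb, of "real n"] by simp
    finally show ?thesis by (simp add: algebra_simps)
  qed
  have S2: "(\<Sum>k=1..n. Q k * (real n * (I k - I (Suc k)))) \<le> 15 / 2 * (real n * a)"
  proof -
    have "(\<Sum>k=1..n. Q k * (I k - I (Suc k))) = (\<Sum>l=1..n div 2. q l * I (2 * l)) - Q n * I (Suc n)"
      unfolding Q_def sum_half_partial_sums ..
    also have "\<dots> \<le> (\<Sum>l=1..n div 2. q l * I (2 * l))" using Q0 I_0[of "Suc n"] n by simp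
    also have "\<dots> \<le> J"
      by (rule finite_sum_le_has_sum[OF Js]) (use q0 I_0 in auto)
    finally have "(\<Sum>k=1..n. Q k * (I k - I (Suc k))) \<le> 15 / 2 * a" using Jb by linarith
    hence "real n * (\<Sum>k=1..n. Q k * (I k - I (Suc k))) \<le> real n * (15 / 2 * a)" by (intro mult_left_mono) auto
    thus ?thesis by (simp add: sum_distrib_left mult_ac)
  qed

  \<comment> \<open>For k/4 < l <= k/2 one has 4l >= K, so l^-a lies between 1/e and
    \<open>\<rho>\<close> and \<open>q l\<close> is at least exp(-1) (1 - rho)^2. There are at least
    k/8 such \<open>l\<close>; this is the origin of \<open>\<kappa>\<close>.\<close>
  have Q_ge: "\<kappa> * real k \<le> Q k" if k: "k \<le> n" "K \<le> real k" for k
  proof -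
    have k4: "k \<ge> 4" using k(2) K by linarith
    have "(\<Sum>l\<in>{k div 4<..k div 2}. exp (-1) * (1 - \<rho>)\<^sup>2) \<le> (\<Sum>l\<in>{k div 4<..k div 2}. q l)"
    proof (rule sum_mono)
      fix l assume l: "l \<in> {k div 4<..k div 2}"
      have l1: "l \<le> n" "1 \<le> l" using l k by auto
      have "k \<le> 4 * l" using l by auto
      hence "K \<le> 4 * real l" using k by linarith
      hence r: "real l powr (-a) \<le> \<rho>" using large[OF l1(1)] by (simp add: a_def)
      have e: "real l powr (-a) \<ge> exp (-1)" unfolding a_def by (rule powr_neg_ge[OF n l1(2,1)])
      have "(1 - \<rho>)\<^sup>2 \<le> (1 - real l powr (-a))\<^sup>2" using r \<rho> by (intro power_mono) auto
      thus "exp (-1) * (1 - \<rho>)\<^sup>2 \<le> q l" unfolding q_def using e by (intro mult_mono) auto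
    qed
    also have "\<dots> \<le> Q k" unfolding Q_def by (intro sum_mono2) (auto simp: q0)
    finally have "real (k div 2 - k div 4) * (exp (-1) * (1 - \<rho>)\<^sup>2) \<le> Q k" by simp
    moreover have "real k / 8 \<le> real (k div 2 - k div 4)"
    proof -
      have "2 * (k div 4) \<le> k div 2" "k \<le> 4 * (k div 4) + 3" "1 \<le> k div 4" using k4 by linarith+
      hence "k \<le> 8 * (k div 2 - k div 4)" by linarith
      hence "real k \<le> real (8 * (k div 2 - k div 4))" by (simp only: of_nat_le_iff)
      thus ?thesis by simp
    qed
    hence "real k / 8 * (exp (-1) * (1 - \<rho>)\<^sup>2) \<le> real (k div 2 - k div 4) * (exp (-1) * (1 - \<rho>)\<^sup>2)"
      by (intro mult_right_mono) auto
    ultimately have "real k / 8 * (exp (-1) * (1 - \<rho>)\<^sup>2) \<le> Q k" by linarith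
    thus ?thesis by (simp add: \<kappa>_def mult_ac)
  qed

  define A B where "A = {k\<in>{2..n}. real k \<le> K}" and "B = {k\<in>{2..n}. K < real k}"
  have AB: "{2..n} = A \<union> B" "A \<inter> B = {}" "finite A" "finite B" by (auto simp: A_def B_def)
  have split1: "(\<Sum>k=1..n. f k) = f 1 + (\<Sum>k=2..n. f k)" for f :: "nat \<Rightarrow> real"
    using sum.atLeast_Suc_atMost[of 1 n f] n by (simp add: numeral_2_eq_2)
  have tail: "(\<Sum>k\<in>B. real k * x k) \<le> (\<Sum>k=1..n. Q k * x k) / \<kappa>" if x: "\<And>k. k \<ge> 2 \<Longrightarrow> x k \<ge> 0" for x
  proof -
    have "\<kappa> * (\<Sum>k\<in>B. real k * x k) = (\<Sum>k\<in>B. (\<kappa> * real k) * x k)" by (simp add: sum_distrib_left mult_ac)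
    also have "\<dots> \<le> (\<Sum>k\<in>B. Q k * x k)" using x by (intro sum_mono mult_right_mono Q_ge) (auto simp: B_def)
    also have "\<dots> \<le> (\<Sum>k=2..n. Q k * x k)" using x Q0 by (intro sum_mono2) (auto simp: B_def)
    also have "\<dots> \<le> (\<Sum>k=1..n. Q k * x k)" unfolding split1 using Qn by simp
    finally show ?thesis using \<kappa>0 by (simp add: field_simps)
  qed
  have Bw: "(\<Sum>k\<in>B. real k * (w k - w (Suc k))) \<le> (4 * U + 15 / 2) * (real n * a) / \<kappa>"
    by (rule order.trans[OF tail divide_right_mono[OF S1]]) (use w_mono \<kappa>0 in auto)
  have BI: "(\<Sum>k\<in>B. real k * (real n * (I k - I (Suc k)))) \<le> 15 / 2 * (real n * a) / \<kappa>"
    by (rule order.trans[OF tail divide_right_mono[OF S2]]) (use I_mono \<kappa>0 in auto)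
  have sumB: "(\<Sum>k\<in>B. real k * \<bar>h k - h (Suc k)\<bar>) \<le> (4 * U + 15) / \<kappa> * (real n * a)"
  proof -
    have "(\<Sum>k\<in>B. real k * \<bar>h k - h (Suc k)\<bar>) \<le> (\<Sum>k\<in>B. real k * ((w k - w (Suc k)) + real n * (I k - I (Suc k))))"
    proof (intro sum_mono mult_left_mono)
      fix k assume "k \<in> B"
      hence k: "k \<ge> 2" by (auto simp: B_def)
      have "0 \<le> real n * (I k - I (Suc k))" using I_mono[OF k] by simp
      moreover have "h k - h (Suc k) = (w k - w (Suc k)) - real n * (I k - I (Suc k))"
        by (simp add: hwI algebra_simps)
      ultimately show "\<bar>h k - h (Suc k)\<bar> \<le> (w k - w (Suc k)) + real n * (I k - I (Suc k))"
        using w_mono[OF k] by linarith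
    qed auto
    also have "\<dots> = (\<Sum>k\<in>B. real k * (w k - w (Suc k))) + (\<Sum>k\<in>B. real k * (real n * (I k - I (Suc k))))"
      by (simp only: distrib_left sum.distrib)
    also have "\<dots> \<le> (4 * U + 15) / \<kappa> * (real n * a)" using Bw BI \<kappa>0 by (simp add: field_simps)
    finally show ?thesis .
  qed

  have P0: "0 \<le> P k" "P k \<le> real k" for k
  proof -
    show "0 \<le> P k" unfolding P_def by (intro sum_nonneg) auto
    have "P k \<le> (\<Sum>l=1..k div 2. 1)" unfolding P_def
      by (intro sum_mono) (use a powr_mono2'[of "-a" 1] in auto)
    also have "\<dots> \<le> real k" by simp
    finally show "P k \<le> real k" .
  qed
  have P_ge: "real k \<le> 3 * exp 1 * P k" if k: "2 \<le> k" "k \<le> n" for k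
  proof -
    have "(\<Sum>l=1..k div 2. exp (-1)) \<le> P k" unfolding P_def a_def
      by (intro sum_mono powr_neg_ge n) (use k in auto)
    hence "real (k div 2) * exp (-1) \<le> P k" by simp
    hence "3 * exp 1 * (real (k div 2) * exp (-1)) \<le> 3 * exp 1 * P k" by (intro mult_left_mono) auto
    moreover have "3 * exp 1 * (real (k div 2) * exp (-1)) = 3 * real (k div 2)" by (simp add: exp_minus)
    moreover have "k \<le> 3 * (k div 2)" using k by presburger
    hence "real k \<le> real (3 * (k div 2))" by (simp only: of_nat_le_iff)
    ultimately show ?thesis by simp
  qed
  \<comment> \<open>Beyond \<open>n\<close> only the negative smooth part of \<open>h\<close>
    survives, so cutting the series \<open>V 1\<close> off at 2l <= n, and likewise the boundary
    term at \<open>n + 1\<close>, can only increase it. This yields the needed lower bound.\<close>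
  have PS: "- (U * (real n * a)) \<le> (\<Sum>k=2..n. P k * (h k - h (Suc k)))"
  proof -
    have V1: "((\<lambda>l. - (real l powr (-(1 * a)) * h (2 * l))) has_sum (- V 1)) {1..}"
      using Vs[of 1] by (simp add: has_sum_uminus)
    have "(\<Sum>l=1..n div 2. - (real l powr (-(1 * a)) * h (2 * l))) \<le> - V 1"
    proof (rule finite_sum_le_has_sum[OF V1])
      fix l assume "l \<in> {1..} - {1..n div 2}"
      hence "h (2 * l) \<le> 0" by (intro h_neg) auto
      thus "0 \<le> - (real l powr (-(1 * a)) * h (2 * l))" by (simp add: mult_nonneg_nonpos)
    qed auto
    hence "V 1 \<le> (\<Sum>l=1..n div 2. real l powr (-a) * h (2 * l))" by (simp add: sum_negf)
    also have "\<dots> \<le> (\<Sum>l=1..n div 2. real l powr (-a) * h (2 * l)) - P n * h (Suc n)"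
      using P0(1)[of n] h_neg[of "Suc n"] by (simp add: mult_nonneg_nonpos)
    also have "\<dots> = (\<Sum>k=1..n. P k * (h k - h (Suc k)))"
      unfolding P_def sum_half_partial_sums ..
    also have "\<dots> = (\<Sum>k=2..n. P k * (h k - h (Suc k)))"
      unfolding split1 using Qn by simp
    finally show ?thesis using Vb[of 1] by simp
  qed
  have sumA: "(\<Sum>k\<in>A. real k * \<bar>h k - h (Suc k)\<bar>) \<le> 3 * exp 1 * (6 * E + U + (4 * U + 15) / \<kappa>) * (real n * a)"
  proof -
    define err where "err = (\<lambda>k. E * real n * a\<^sup>2 / (real k)\<^sup>2)"
    have err: "h k - h (Suc k) \<le> err k" "err k \<ge> 0" if "k \<in> A" for k
    proof -
      show "h k - h (Suc k) \<le> err k"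
        using upper[of k] that by (simp add: A_def h_def err_def a_def power_mult_distrib power_one_over field_simps)
      show "err k \<ge> 0" using E by (simp add: err_def)
    qed
    \<comment> \<open>If x <= err and err >= 0, then |x| <= 2 err - x. The one-sided bound thus
      removes the absolute value at the price of a lower bound for a signed sum.\<close>
    have "(\<Sum>k\<in>A. real k * \<bar>h k - h (Suc k)\<bar>) \<le> (\<Sum>k\<in>A. (3 * exp 1 * P k) * (2 * err k - (h k - h (Suc k))))"
    proof (intro sum_mono mult_mono P_ge)
      fix k assume k: "k \<in> A"
      show "\<bar>h k - h (Suc k)\<bar> \<le> 2 * err k - (h k - h (Suc k))" using err[OF k] by linarith
    qed (use P0 in \<open>auto simp: A_def\<close>)
    also have "\<dots> = 3 * exp 1 * (2 * (\<Sum>k\<in>A. P k * err k) - (\<Sum>k\<in>A. P k * (h k - h (Suc k))))"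
      by (simp add: sum_distrib_left sum_subtractf sum.distrib algebra_simps)
    also have "\<dots> \<le> 3 * exp 1 * (2 * (3 * E * (real n * a)) + (U + (4 * U + 15) / \<kappa>) * (real n * a))"
    proof (intro mult_left_mono)
      have "(\<Sum>k\<in>A. P k * err k) \<le> (\<Sum>k\<in>A. E * real n * a\<^sup>2 * (1 / real k))"
      proof (rule sum_mono)
        fix k assume k: "k \<in> A"
        have "P k * err k \<le> real k * err k" using P0 err[OF k] by (intro mult_right_mono) auto
        also have "\<dots> = E * real n * a\<^sup>2 * (1 / real k)" using k by (simp add: err_def A_def power2_eq_square)
        finally show "P k * err k \<le> E * real n * a\<^sup>2 * (1 / real k)" .
      qed
      also have "\<dots> \<le> (\<Sum>k=1..n. E * real n * a\<^sup>2 * (1 / real k))"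
        using E by (intro sum_mono2) (auto simp: A_def)
      also have "\<dots> = E * real n * a\<^sup>2 * (\<Sum>k=1..n. 1 / real k)" by (simp only: sum_distrib_left)
      also have "\<dots> \<le> E * real n * a\<^sup>2 * (1 + ln (real n))"
        using E n by (intro mult_left_mono sum_inverse_le) auto
      also have "\<dots> = E * real n * a * (a + 1)" using n by (simp add: a_def power2_eq_square field_simps)
      also have "\<dots> \<le> E * real n * a * 3" using E a by (intro mult_left_mono) auto
      finally have 1: "(\<Sum>k\<in>A. P k * err k) \<le> 3 * E * (real n * a)" by simp
      \<comment> \<open>The signed sum over \<open>A\<close> is the full one minus that over
        \<open>B\<close>. On \<open>B\<close> increments of \<open>h\<close> are at most those of
        \<open>w\<close>, whose weighted sum is already bounded.\<close>
      have "(\<Sum>k=2..n. P k * (h k - h (Suc k))) = (\<Sum>k\<in>A. P k * (h k - h (Suc k))) + (\<Sum>k\<in>B. P k * (h k - h (Suc k)))"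
        unfolding AB(1) using AB by (intro sum.union_disjoint) auto
      moreover have "(\<Sum>k\<in>B. P k * (h k - h (Suc k))) \<le> (\<Sum>k\<in>B. real k * (w k - w (Suc k)))"
      proof (rule sum_mono)
        fix k assume "k \<in> B"
        hence k: "k \<ge> 2" by (auto simp: B_def)
        have "h k - h (Suc k) = (w k - w (Suc k)) - real n * (I k - I (Suc k))" by (simp add: hwI algebra_simps)
        moreover have "0 \<le> real n * (I k - I (Suc k))" using I_mono[OF k] by simp
        ultimately have "P k * (h k - h (Suc k)) \<le> P k * (w k - w (Suc k))" using P0 by (intro mult_left_mono) auto
        also have "\<dots> \<le> real k * (w k - w (Suc k))" using P0 w_mono[OF k] by (intro mult_right_mono) auto
        finally show "P k * (h k - h (Suc k)) \<le> real k * (w k - w (Suc k))" .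
      qed
      moreover have "(4 * U + 15 / 2) * (real n * a) / \<kappa> \<le> (4 * U + 15) / \<kappa> * (real n * a)"
        using a \<kappa>0 by (simp add: field_simps)
      ultimately show "2 * (\<Sum>k\<in>A. P k * err k) - (\<Sum>k\<in>A. P k * (h k - h (Suc k)))
         \<le> 2 * (3 * E * (real n * a)) + (U + (4 * U + 15) / \<kappa>) * (real n * a)"
        using 1 PS Bw unfolding distrib_right by linarith
    qed auto
    also have "\<dots> = 3 * exp 1 * (6 * E + U + (4 * U + 15) / \<kappa>) * (real n * a)" by (simp add: algebra_simps)
    finally show ?thesis .
  qed
  have "(\<Sum>k=2..n. real k * \<bar>h k - h (Suc k)\<bar>) = (\<Sum>k\<in>A. real k * \<bar>h k - h (Suc k)\<bar>) + (\<Sum>k\<in>B. real k * \<bar>h k - h (Suc k)\<bar>)"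
    unfolding AB(1) using AB by (intro sum.union_disjoint) auto
  also have "\<dots> \<le> ((4 * U + 15) / \<kappa> + 3 * exp 1 * (6 * E + U + (4 * U + 15) / \<kappa>)) * (real n * a)"
    using sumA sumB unfolding distrib_right[of _ _ "real n * a"] by linarith
  finally show ?thesis by (simp add: h_def a_def)
qed

text \<open>The sieve level N is about n^(1/24), so that N^6 <= n^(1/4) = n n^(-1/2) n^(-1/4), which
  is at most n / (k ln n)^2 because k <= n^(1/4) and (ln n)^2 <= n^(1/4). Rounding N down is covered
  by n^(1/48) <= N, hence the value 1/48 for the sieve parameter \<open>c\<close>.\<close>

lemma weight_diff_upper_large:
  fixes n :: nat
  assumes n: "n \<ge> 2" and k: "k \<ge> 2" "real k \<le> real n powr (1/4)"
    and n1: "2 \<le> real n powr (1/24)" "real n powr (1/48) \<le> real n powr (1/24) - 1"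
    and n2: "(ln (real n))\<^sup>2 \<le> real n powr (1/4)"
  defines "C \<equiv> 1 / (1 - exp (- (1 / 48))) + exp 2 / (1 / 48)"
  shows "weight_diff n k - weight_diff n (Suc k) \<le> (449328 * C + 6) * real n / (real k * ln (real n))\<^sup>2"
proof -
  define a where "a = 1 / ln (real n)"
  define N where "N = nat \<lfloor>real n powr (1/24)\<rfloor>"
  define r where "r = ln (real N)"
  have a: "a > 0" "a \<le> 2" using n inverse_ln_le_2[OF n] by (auto simp: a_def)
  have L: "ln (real n) > 0" using n by simp
  have N: "N \<ge> 2" unfolding N_def using n1 by (simp add: le_nat_floor)
  have N_le: "real N \<le> real n powr (1/24)" unfolding N_def by simp
  have N_ge: "real n powr (1/48) \<le> real N" unfolding N_def using n1 by linarith
  have r_ge: "ln (real n) / 48 \<le> r"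
  proof -
    have "ln (real n powr (1/48)) \<le> r" unfolding r_def using N_ge n by (intro ln_mono) auto
    thus ?thesis using n by (simp add: ln_powr)
  qed
  have r_le: "r \<le> ln (real n)"
  proof -
    have "r \<le> ln (real n powr (1/24))" unfolding r_def using N_le N by (intro ln_mono) auto
    also have "\<dots> = ln (real n) / 24" using n by (simp add: ln_powr)
    finally show ?thesis using L by simp
  qed
  have r0: "r > 0" using r_ge L by linarith
  have C: "C \<ge> 0" by (simp add: C_def)
  have "(floor_weight n k - floor_weight n (Suc k)) - real n * (smooth_weight a k - smooth_weight a (Suc k))
    \<le> real n * real k powr (-2) * C * (a / ln (real N) + (1 + a) / ln (real N) ^ 2 + 2 / ln (real N) ^ 3)
      + 6 * real N ^ 6"
    unfolding C_def
  proof (rule floor_smooth_one_sided)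
    show "1 / 48 \<le> a * ln (real N)" "a * ln (real N) \<le> 1"
      using r_ge r_le L unfolding r_def[symmetric] a_def by (simp_all add: field_simps)
  qed (use N a k in auto)
  also have "\<dots> \<le> real n * real k powr (-2) * C * (449328 * a\<^sup>2) + 6 * (real n * real k powr (-2) * a\<^sup>2)"
  proof (intro add_mono mult_left_mono)
    define x where "x = 1 / r"
    have x: "0 \<le> x" "x \<le> 48 * a" using r_ge r0 L by (auto simp: x_def a_def field_simps)
    have x2: "x\<^sup>2 \<le> (48 * a)\<^sup>2" using x by (intro power_mono) auto
    have "a / ln (real N) + (1 + a) / ln (real N) ^ 2 + 2 / ln (real N) ^ 3 = a * x + (1 + a) * x\<^sup>2 + 2 * (x * x\<^sup>2)"
      by (simp add: x_def r_def[symmetric] power2_eq_square power3_eq_cube)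
    \<comment> \<open>Uses 1 + a <= 3 and x <= 48a <= 96; the coefficient is 48 + 3 * 48^2 + 192 *
      48^2 = 449328.\<close>
    also have "\<dots> \<le> a * (48 * a) + 3 * (48 * a)\<^sup>2 + 2 * (96 * (48 * a)\<^sup>2)"
      using x x2 a by (intro add_mono mult_mono mult_left_mono) auto
    also have "\<dots> = 449328 * a\<^sup>2" by (simp add: power2_eq_square algebra_simps)
    finally show "a / ln (real N) + (1 + a) / ln (real N) ^ 2 + 2 / ln (real N) ^ 3 \<le> 449328 * a\<^sup>2" .
    have "real N ^ 6 \<le> (real n powr (1/24)) ^ 6" using N_le by (intro power_mono) auto
    also have "\<dots> = real n powr (1/4)" using n by (simp add: powr_realpow[symmetric] powr_powr)
    also have "\<dots> = real n * real n powr (-(1/2)) * real n powr (-(1/4))"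
      using n by (simp add: powr_add[symmetric] powr_mult_base)
    also have "\<dots> \<le> real n * real k powr (-2) * a\<^sup>2"
    proof (intro mult_mono mult_left_mono)
      have "(real k)\<^sup>2 \<le> (real n powr (1/4))\<^sup>2" using k by (intro power_mono) auto
      also have "\<dots> = real n powr (1/2)" using n by (simp add: powr_realpow[symmetric] powr_powr)
      finally have "(real k)\<^sup>2 \<le> real n powr (1/2)" .
      hence "inverse (real n powr (1/2)) \<le> inverse ((real k)\<^sup>2)" using k by (intro le_imp_inverse_le) auto
      thus "real n powr (-(1/2)) \<le> real k powr (-2)" using k by (simp add: powr_minus powr_numeral)
      have "inverse (real n powr (1/4)) \<le> inverse ((ln (real n))\<^sup>2)" using n2 L by (intro le_imp_inverse_le) auto
      thus "real n powr (-(1/4)) \<le> a\<^sup>2" by (simp add: powr_minus a_def power_one_over inverse_eq_divide)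
    qed auto
    finally show "real N ^ 6 \<le> real n * real k powr (-2) * a\<^sup>2" .
  qed (use C in auto)
  also have "\<dots> = (449328 * C + 6) * real n / (real k * ln (real n))\<^sup>2"
  proof -
    define y where "y = real n * real k powr (-2) * a\<^sup>2"
    have "real k powr (-2) = 1 / (real k)\<^sup>2" using k by (simp add: powr_minus_divide powr_numeral)
    hence y: "y = real n / (real k * ln (real n))\<^sup>2" by (simp add: y_def a_def power_mult_distrib power_one_over)
    have "real n * real k powr (-2) * C * (449328 * a\<^sup>2) + 6 * (real n * real k powr (-2) * a\<^sup>2) = (449328 * C + 6) * y"
      by (simp add: y_def algebra_simps)
    thus ?thesis by (simp add: y)
  qed
  finally show ?thesis by (simp add: weight_diff_def a_def algebra_simps)
qed

lemma eventually_bound_imp_bound: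
  fixes X Y :: "nat \<Rightarrow> real"
  assumes "eventually (\<lambda>n. X n \<le> C * Y n) sequentially" and Y: "\<And>n. n \<ge> m \<Longrightarrow> Y n > 0"
  shows "\<exists>C'>0. \<forall>n\<ge>m. X n \<le> C' * Y n"
proof -
  obtain n0 where n0: "\<And>n. n \<ge> n0 \<Longrightarrow> X n \<le> C * Y n" using assms(1) by (auto simp: eventually_sequentially)
  define D where "D = (\<Sum>n\<in>{m..<n0}. \<bar>X n\<bar> / Y n)"
  have D0: "D \<ge> 0" unfolding D_def by (intro sum_nonneg divide_nonneg_nonneg) (auto intro: less_imp_le[OF Y])
  have "X n \<le> (\<bar>C\<bar> + 1 + D) * Y n" if n: "n \<ge> m" for n
  proof (cases "n \<ge> n0")
    case True
    have "C * Y n \<le> (\<bar>C\<bar> + 1 + D) * Y n" using D0 Y[OF n] by (intro mult_right_mono) auto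
    thus ?thesis using n0[OF True] by linarith
  next
    case False
    have "\<bar>X n\<bar> / Y n \<le> D" unfolding D_def
      by (rule member_le_sum) (use False n in \<open>auto intro!: divide_nonneg_nonneg less_imp_le[OF Y]\<close>)
    hence "\<bar>X n\<bar> \<le> D * Y n" using Y[OF n] by (simp add: field_simps)
    also have "\<dots> \<le> (\<bar>C\<bar> + 1 + D) * Y n" using D0 Y[OF n] by (intro mult_right_mono) auto
    finally show ?thesis by linarith
  qed
  thus ?thesis using D0 by (intro exI[of _ "\<bar>C\<bar> + 1 + D"]) auto
qed

theorem weight_diff_total_variation:
  "\<exists>C>0. \<forall>n\<ge>2. (\<Sum>k=2..n. real k * \<bar>weight_diff n k - weight_diff n (Suc k)\<bar>) \<le> C * (real n / ln (real n))"
proof -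
  define E where "E = 449328 * (1 / (1 - exp (- (1 / 48 :: real))) + exp 2 / (1 / 48)) + 6"
  \<comment> \<open>For large n, 4l >= n^(1/4) forces l >= n^(1/8), and then l^(-1/ln n) is at most
    exp(-1/8).\<close>
  define \<rho> where "\<rho> = exp (- (1 / 8 :: real))"
  define \<kappa> where "\<kappa> = exp (-1) * (1 - \<rho>)\<^sup>2 / 8"
  define U where "U = 12 * exp (1 :: real) + 6"
  define C where "C = (4 * U + 15) / \<kappa> + 3 * exp 1 * (6 * E + U + (4 * U + 15) / \<kappa>)"
  have E: "E \<ge> 0" unfolding E_def by simp
  have ev: "eventually (\<lambda>n::nat. 2 \<le> real n powr (1/24)) sequentially"
    "eventually (\<lambda>n::nat. real n powr (1/48) \<le> real n powr (1/24) - 1) sequentially"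
    "eventually (\<lambda>n::nat. (ln (real n))\<^sup>2 \<le> real n powr (1/4)) sequentially"
    "eventually (\<lambda>n::nat. 4 \<le> real n powr (1/4)) sequentially"
    "eventually (\<lambda>n::nat. 4 * real n powr (1/8) \<le> real n powr (1/4)) sequentially"
    by real_asymp+
  show ?thesis
  proof (rule eventually_bound_imp_bound)
    show "\<forall>\<^sub>F n in sequentially. (\<Sum>k=2..n. real k * \<bar>weight_diff n k - weight_diff n (Suc k)\<bar>) \<le> C * (real n / ln (real n))"
      using ev eventually_ge_at_top[of 2]
    proof eventually_elim
      case (elim n)
      show ?case unfolding C_def U_def \<kappa>_def
      proof (rule sum_abs_weight_diff_le[where K = "real n powr (1/4)"])
        fix k :: nat assume k: "2 \<le> k" "real k \<le> real n powr (1/4)"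
        show "weight_diff n k - weight_diff n (Suc k) \<le> E * real n / (real k * ln (real n))\<^sup>2"
          unfolding E_def by (rule weight_diff_upper_large) (use elim k in auto)
      next
        fix l assume l: "l \<le> n" "real n powr (1/4) \<le> 4 * real l"
        have nl: "real n powr (1/8) \<le> real l" using l elim by linarith
        have "real l powr (-(1 / ln (real n))) \<le> (real n powr (1/8)) powr (-(1 / ln (real n)))"
          using nl elim by (intro powr_mono2') auto
        also have "\<dots> = \<rho>" using elim by (simp add: \<rho>_def powr_def)
        finally show "real l powr (-(1 / ln (real n))) \<le> \<rho>" .
      qed (use elim E in \<open>auto simp: \<rho>_def\<close>)
    qed
  qed auto
qed

subsection \<open>Partial summation with Moebius inversion\<close>

lemma Sfun_0 [simp]: "Sfun a 0 = 0"
  by (simp add: Sfun_def)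

lemma Sfun_1 [simp]: "Sfun a (Suc 0) = 0"
  by (simp add: Sfun_def)

lemma Sfun_eq:
  assumes "x \<le> N"
  shows "Sfun a x = (\<Sum>k=1..N. of_nat (x div k) * (a k * of_real (ln (real k))))"
proof -
  have "Sfun a x = (\<Sum>k=1..x. of_nat (x div k) * (a k * of_real (ln (real k))))"
    unfolding Sfun_def by (simp add: mult_ac)
  also have "\<dots> = (\<Sum>k=1..N. of_nat (x div k) * (a k * of_real (ln (real k))))"
    using assms by (intro sum.mono_neutral_left) auto
  finally show ?thesis .
qed

lemma sum_moebius_floor:
  "(\<Sum>e=1..X. real (X div e) * moebius_mu e) = (if X = 0 then 0 else 1)"
proof -
  have "(\<Sum>e=1..X. real (X div e) * moebius_mu e) = (\<Sum>m=1..X. \<Sum>e | e dvd m. moebius_mu e)"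
    by (rule sum_divisor_sums[symmetric])
  also have "\<dots> = (\<Sum>m=1..X. moebius_twist 0 m)"
    unfolding moebius_twist_def
  proof (intro sum.cong refl)
    fix m e assume "m \<in> {1..X}" "e \<in> {e. e dvd m}"
    hence "e > 0" by (auto intro: Nat.gr0I)
    thus "moebius_mu e = moebius_mu e * real e powr - 0" by simp
  qed
  also have "\<dots> = (\<Sum>m=1..X. if m = 1 then 1 else 0)"
    by (intro sum.cong refl moebius_twist_0) auto
  also have "\<dots> = (if X = 0 then 0 else 1)" by auto
  finally show ?thesis .
qed

text \<open>\<open>Sfun\<close> is the summatory function of the convolution of 1 with a(m) ln m;
  Moebius inversion removes the 1, using that \<open>div\<close> by \<open>e\<close> and
  \<open>div\<close> by \<open>k\<close> commute.\<close>

lemma partial_sum_eq_moebius_Sfun: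
  "(\<Sum>m=1..N. a m * of_real (ln (real m))) = (\<Sum>e=1..N. of_real (moebius_mu e) * Sfun a (N div e))"
proof -
  define b where "b = (\<lambda>m. a m * complex_of_real (ln (real m)))"
  have "(\<Sum>e=1..N. of_real (moebius_mu e) * Sfun a (N div e))
      = (\<Sum>e=1..N. \<Sum>k=1..N. of_real (real (N div k div e) * moebius_mu e) * b k)"
  proof (rule sum.cong[OF refl])
    fix e
    have "N div e div k = N div k div e" for k by (simp add: div_mult2_eq[symmetric] mult.commute)
    thus "of_real (moebius_mu e) * Sfun a (N div e) = (\<Sum>k=1..N. of_real (real (N div k div e) * moebius_mu e) * b k)"
      unfolding Sfun_eq[OF div_le_dividend[of N e]] by (simp add: b_def sum_distrib_left mult_ac)
  qed
  also have "\<dots> = (\<Sum>k=1..N. \<Sum>e=1..N. of_real (real (N div k div e) * moebius_mu e) * b k)" by (rule sum.swap)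
  also have "\<dots> = (\<Sum>k=1..N. b k)"
  proof (rule sum.cong[OF refl])
    fix k assume k: "k \<in> {1..N}"
    have "(\<Sum>e=1..N. real (N div k div e) * moebius_mu e) = (\<Sum>e=1..N div k. real (N div k div e) * moebius_mu e)"
      by (intro sum.mono_neutral_right) (auto intro: order.trans[OF _ div_le_dividend])
    also have "\<dots> = 1" unfolding sum_moebius_floor using k by (auto simp: div_eq_0_iff)
    finally show "(\<Sum>e=1..N. of_real (real (N div k div e) * moebius_mu e) * b k) = b k"
      by (simp add: sum_distrib_right[symmetric] of_real_sum[symmetric] del: of_real_sum of_real_mult)
  qed
  finally show ?thesis by (simp add: b_def)
qed

text \<open>Summation by parts brings in the partial sums of a(m) ln m, Moebius inversion replaces
  them by \<open>Sfun a (N div e)\<close>, and collecting the N with the same quotient k = N div e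
  produces the increments of \<open>W\<close>. The growth exponent \<open>v\<close> is placed
  between 1 and \<open>q\<close>: \<open>v > 1\<close> makes the sum over e converge,
  \<open>v < q\<close> the sum over N.\<close>

lemma abel_summation_moebius:
  fixes a :: "nat \<Rightarrow> complex" and \<phi> :: "nat \<Rightarrow> real"
  assumes S: "\<And>k. k \<ge> 1 \<Longrightarrow> norm (Sfun a k) \<le> M * real k powr v" and M: "M \<ge> 0" and v: "1 < v" "v < q"
    and \<phi>: "\<And>m. m \<ge> 1 \<Longrightarrow> \<bar>\<phi> m\<bar> \<le> D * real m powr (-q)"
    and \<delta>: "\<And>m. m \<ge> 1 \<Longrightarrow> \<bar>\<phi> m - \<phi> (Suc m)\<bar> \<le> D * real m powr (-1 - q)"
    and W: "\<And>k. k \<ge> 1 \<Longrightarrow> ((\<lambda>e. moebius_mu e * \<phi> (k * e)) has_sum W k) {1..}"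
  shows "\<exists>T. (\<lambda>m. a (Suc m) * of_real (ln (real (Suc m)) * \<phi> (Suc m))) sums T
     \<and> ((\<lambda>k. Sfun a k * of_real (W k - W (Suc k))) has_sum T) {1..}"
proof -
  have D: "D \<ge> 0" using \<phi>[of 1] by simp
  define B where "B = (\<lambda>N. \<Sum>m=1..N. a m * complex_of_real (ln (real m)))"
  define d where "d = (\<lambda>m. \<phi> m - \<phi> (Suc m))"
  define F where "F = (\<lambda>N e. of_real (moebius_mu e) * Sfun a (N div e) * of_real (d N))"
  have F0: "F N e = 0" if "e > N" for N e using that by (simp add: F_def)
  have SN: "norm (Sfun a (N div e)) \<le> M * (real N powr v * real e powr (-v))" if "N \<ge> 1" "e \<ge> 1" for N e
  proof (cases "N div e = 0")
    case False
    hence "norm (Sfun a (N div e)) \<le> M * real (N div e) powr v" by (intro S) auto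
    also have "\<dots> \<le> M * (real N / real e) powr v"
      using v M by (intro mult_left_mono powr_mono2 of_nat_div_le_of_nat) auto
    also have "(real N / real e) powr v = real N powr v * real e powr (-v)"
      by (simp add: powr_divide powr_minus_divide)
    finally show ?thesis .
  qed (use M in simp)
  have Fs: "(\<lambda>(N, e). F N e) summable_on {1..} \<times> {1..}"
  proof (rule summable_on_Times_product_bound)
    show "(\<lambda>N. M * D * real N powr (-1 - (q - v))) summable_on {1::nat..}"
      by (intro summable_on_cmult_right summable_on_powr) (use v in auto)
    show "(\<lambda>e. real e powr (-1 - (v - 1))) summable_on {1::nat..}"
      by (intro summable_on_powr) (use v in auto)
    fix N e :: nat assume Ne: "N \<in> {1..}" "e \<in> {1..}"
    have "norm (F N e) \<le> 1 * (M * (real N powr v * real e powr (-v))) * (D * real N powr (-1 - q))"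
      unfolding F_def norm_mult norm_of_real d_def
      using abs_moebius_mu_le[of e] SN[of N e] \<delta>[of N] Ne M D by (intro mult_mono) auto
    also have "\<dots> = M * D * (real N powr v * real N powr (-1 - q)) * real e powr (-v)" by (simp add: mult_ac)
    also have "real N powr v * real N powr (-1 - q) = real N powr (-1 - (q - v))"
      by (simp add: powr_add[symmetric] algebra_simps)
    finally show "norm (F N e) \<le> M * D * real N powr (-1 - (q - v)) * real e powr (-1 - (v - 1))" by simp
  qed (use M D in auto)
  have FB: "(\<Sum>\<^sub>\<infinity>e\<in>{1..}. F N e) = B N * of_real (d N)" for N
  proof -
    have "((\<lambda>e. F N e) has_sum (\<Sum>e=1..N. F N e)) {1..}"
      by (rule has_sum_finite_neutralI) (auto simp: F0)
    moreover have "(\<Sum>e=1..N. F N e) = B N * of_real (d N)"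
      unfolding B_def partial_sum_eq_moebius_Sfun F_def by (simp add: sum_distrib_right)
    ultimately show ?thesis by (metis infsumI)
  qed
  define T where "T = (\<Sum>\<^sub>\<infinity>N\<in>{1..}. \<Sum>\<^sub>\<infinity>e\<in>{1..}. F N e)"
  have "(\<lambda>N. \<Sum>\<^sub>\<infinity>e\<in>{1..}. F N e) summable_on {1..}"
    using summable_on_Sigma_banach[of F "{1..}" "\<lambda>_. {1..}"] Fs by simp
  from infsum_atLeast1_sums[OF this] have Bs: "(\<lambda>N. B (Suc N) * of_real (d (Suc N))) sums T"
    unfolding T_def FB .

  define z where "z = (\<Sum>\<^sub>\<infinity>e\<in>{1::nat..}. real e powr (-v))"
  have zs: "(\<lambda>e. real e powr (-v)) summable_on {1::nat..}"
    using summable_on_powr[of "v - 1" "{1..}"] v by simp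
  have z0: "z \<ge> 0" unfolding z_def by (rule infsum_nonneg) simp
  have B_le: "norm (B N) \<le> M * z * real N powr v" if N: "N \<ge> 1" for N
  proof -
    have "norm (B N) \<le> (\<Sum>e=1..N. M * (real N powr v * real e powr (-v)))"
      unfolding B_def partial_sum_eq_moebius_Sfun
    proof (rule sum_norm_le)
      fix e assume e: "e \<in> {1..N}"
      have "norm (of_real (moebius_mu e) * Sfun a (N div e)) \<le> 1 * (M * (real N powr v * real e powr (-v)))"
        unfolding norm_mult norm_of_real
        using abs_moebius_mu_le[of e] SN[of N e] N e by (intro mult_mono) auto
      thus "norm (of_real (moebius_mu e) * Sfun a (N div e)) \<le> M * (real N powr v * real e powr (-v))" by simp
    qed
    also have "\<dots> = M * real N powr v * (\<Sum>e=1..N. real e powr (-v))" by (simp add: sum_distrib_left mult_ac)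
    also have "\<dots> \<le> M * real N powr v * z"
      unfolding z_def using M by (intro mult_left_mono finite_sum_le_infsum zs) auto
    finally show ?thesis by (simp add: mult_ac)
  qed
  have abel: "(\<Sum>m=1..N. a m * of_real (ln (real m) * \<phi> m)) = (\<Sum>m=1..N. B m * of_real (d m)) + B N * of_real (\<phi> (Suc N))" for N
  proof (induction N)
    case (Suc N)
    have "B (Suc N) = B N + a (Suc N) * of_real (ln (real (Suc N)))" by (simp add: B_def)
    thus ?case using Suc by (simp add: d_def algebra_simps)
  qed (simp add: B_def)
  have rem: "(\<lambda>N. B N * of_real (\<phi> (Suc N))) \<longlonglongrightarrow> 0"
  proof (rule Lim_null_comparison)
    show "\<forall>\<^sub>F N in sequentially. norm (B N * of_real (\<phi> (Suc N))) \<le> M * z * D * real N powr (-(q - v))"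
      using eventually_ge_at_top[of 1]
    proof eventually_elim
      case (elim N)
      have "\<bar>\<phi> (Suc N)\<bar> \<le> D * real (Suc N) powr (-q)" by (rule \<phi>) simp
      also have "\<dots> \<le> D * real N powr (-q)" using elim v D by (intro mult_left_mono powr_mono2') auto
      finally have "norm (B N * of_real (\<phi> (Suc N))) \<le> (M * z * real N powr v) * (D * real N powr (-q))"
        unfolding norm_mult norm_of_real using B_le[of N] elim D M z0 by (intro mult_mono) auto
      also have "\<dots> = M * z * D * (real N powr v * real N powr (-q))" by (simp add: mult_ac)
      also have "real N powr v * real N powr (-q) = real N powr (-(q - v))" by (simp add: powr_add[symmetric])
      finally show ?case .
    qed
    have "((\<lambda>N. real N powr (-(q - v))) \<longlongrightarrow> 0) sequentially"
      by (rule tendsto_neg_powr) (use v filterlim_real_sequentially in auto)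
    from tendsto_mult_right_zero[OF this] show "((\<lambda>N. M * z * D * real N powr (-(q - v))) \<longlongrightarrow> 0) sequentially" .
  qed
  have sums: "(\<lambda>m. a (Suc m) * of_real (ln (real (Suc m)) * \<phi> (Suc m))) sums T"
  proof -
    have "(\<lambda>N. (\<Sum>m<N. B (Suc m) * of_real (d (Suc m))) + B N * of_real (\<phi> (Suc N))) \<longlonglongrightarrow> T + 0"
      using Bs rem unfolding sums_def by (intro tendsto_add)
    moreover have "(\<Sum>m<N. a (Suc m) * of_real (ln (real (Suc m)) * \<phi> (Suc m)))
        = (\<Sum>m<N. B (Suc m) * of_real (d (Suc m))) + B N * of_real (\<phi> (Suc N))" for N
      using abel[of N] by (simp only: sum.atLeast1_atMost_eq One_nat_def)
    ultimately show ?thesis unfolding sums_def by (simp only: add_0_right)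
  qed

  define G where "G = (\<lambda>k e. of_real (moebius_mu e) * (Sfun a k * of_real (\<phi> (k * e) - \<phi> (Suc k * e))))"
  have tele: "(\<Sum>N\<in>{k*e..<k*e+e}. d N) = \<phi> (k * e) - \<phi> (Suc k * e)" for k e
    unfolding d_def using sum_Suc_diff'[of "k*e" "k*e+e" "\<lambda>m. - \<phi> m"] by (simp add: add.commute)
  have Gd: "\<bar>\<phi> (k * e) - \<phi> (Suc k * e)\<bar> \<le> D * (real k powr (-1 - q) * real e powr (-q))" if "k \<ge> 1" "e \<ge> 1" for k e
  proof -
    have ke: "k * e \<ge> 1" using that by simp
    have "\<bar>\<phi> (k * e) - \<phi> (Suc k * e)\<bar> \<le> (\<Sum>N\<in>{k*e..<k*e+e}. \<bar>d N\<bar>)"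
      unfolding tele[symmetric] by (rule sum_abs)
    also have "\<dots> \<le> (\<Sum>N\<in>{k*e..<k*e+e}. D * real (k * e) powr (-1 - q))"
    proof (rule sum_mono)
      fix N assume N: "N \<in> {k*e..<k*e+e}"
      have N1: "1 \<le> N" using order.trans[OF ke, of N] N by simp
      have "\<bar>d N\<bar> \<le> D * real N powr (-1 - q)" unfolding d_def by (rule \<delta>[OF N1])
      also have "\<dots> \<le> D * real (k * e) powr (-1 - q)"
        using N ke v D by (intro mult_left_mono powr_mono2') (simp_all only: of_nat_0_less_iff of_nat_le_iff, auto)
      finally show "\<bar>d N\<bar> \<le> D * real (k * e) powr (-1 - q)" .
    qed
    also have "\<dots> = D * (real e * real (k * e) powr (-1 - q))" by (simp add: mult_ac)
    also have "real e * real (k * e) powr (-1 - q) = real k powr (-1 - q) * (real e * real e powr (-1 - q))"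
      by (simp add: powr_mult mult_ac)
    also have "real e * real e powr (-1 - q) = real e powr (-q)"
      using that powr_mult_base[of "real e" "-1 - q"] by simp
    finally show ?thesis .
  qed
  \<comment> \<open>A second majorant is needed for exchanging k and e after the blocks have been
    summed; a block of e increments costs e (ke)^(-1-q), which still leaves e^-q.\<close>
  have Gb: "norm (G k e) \<le> M * D * real k powr (-1 - (q - v)) * real e powr (-1 - (q - 1))" if ke: "k \<in> {1..}" "e \<in> {1..}" for k e
  proof -
    have "norm (G k e) \<le> 1 * ((M * real k powr v) * (D * (real k powr (-1 - q) * real e powr (-q))))"
      unfolding G_def norm_mult norm_of_real
      using abs_moebius_mu_le[of e] S[of k] Gd[of k e] ke M D by (intro mult_mono mult_nonneg_nonneg) auto
    also have "\<dots> = M * D * (real k powr v * real k powr (-1 - q)) * real e powr (-q)" by (simp add: mult_ac)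
    also have "real k powr v * real k powr (-1 - q) = real k powr (-1 - (q - v))"
      by (simp add: powr_add[symmetric] algebra_simps)
    finally show ?thesis by simp
  qed
  have Gs: "(\<lambda>(k, e). G k e) summable_on {1..} \<times> {1..}"
    by (rule summable_on_Times_product_bound[OF _ _ _ _ Gb])
       (use v M D summable_on_powr[of "q - 1" "{1..}"] in \<open>auto intro!: summable_on_cmult_right summable_on_powr\<close>)
  have Gs': "(\<lambda>(e, k). G k e) summable_on {1..} \<times> {1..}"
    using summable_on_swap[of "\<lambda>(k, e). G k e" "{1..}" "{1..}"] Gs by (simp add: case_prod_unfold)
  have Fs': "(\<lambda>(e, N). F N e) summable_on {1..} \<times> {1..}"
    using summable_on_swap[of "\<lambda>(N, e). F N e" "{1..}" "{1..}"] Fs by (simp add: case_prod_unfold)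
  have FG: "(\<Sum>\<^sub>\<infinity>N\<in>{1..}. F N e) = (\<Sum>\<^sub>\<infinity>k\<in>{1..}. G k e)" if e: "e \<in> {1..}" for e
  proof -
    have "(\<lambda>N. F (Suc N) e) sums (\<Sum>\<^sub>\<infinity>N\<in>{1..}. F N e)"
      by (rule infsum_atLeast1_sums) (use summable_on_SigmaD1[of "\<lambda>e N. F N e"] Fs' e in blast)
    hence "(\<lambda>N. F N e) sums (\<Sum>\<^sub>\<infinity>N\<in>{1..}. F N e)" using sums_Suc_iff[of "\<lambda>N. F N e"] F0[of 0 e] e by simp
    \<comment> \<open>The k-th block consists of the N with \<open>N div e = k\<close>, on which
      \<open>d\<close> telescopes. The block k = 0 vanishes since \<open>Sfun a 0 = 0\<close>, so
      starting at 0 or at 1 makes no difference.\<close>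
    hence "(\<lambda>k. \<Sum>N\<in>{k*e..<k*e+e}. F N e) sums (\<Sum>\<^sub>\<infinity>N\<in>{1..}. F N e)"
      by (rule sums_group) (use e in auto)
    also have "(\<lambda>k. \<Sum>N\<in>{k*e..<k*e+e}. F N e) = (\<lambda>k. G k e)"
    proof
      fix k
      have "(\<Sum>N\<in>{k*e..<k*e+e}. F N e) = (\<Sum>N\<in>{k*e..<k*e+e}. of_real (moebius_mu e) * Sfun a k * of_real (d N))"
      proof (rule sum.cong[OF refl])
        fix N assume N: "N \<in> {k*e..<k*e+e}"
        have "N div e = k" using N e by (intro div_nat_eqI) (auto simp: mult.commute)
        thus "F N e = of_real (moebius_mu e) * Sfun a k * of_real (d N)" by (simp add: F_def)
      qed
      also have "\<dots> = of_real (moebius_mu e) * Sfun a k * of_real (\<Sum>N\<in>{k*e..<k*e+e}. d N)"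
        by (simp only: sum_distrib_left of_real_sum)
      finally show "(\<Sum>N\<in>{k*e..<k*e+e}. F N e) = G k e" unfolding tele G_def by (simp only: mult.assoc)
    qed
    finally have 1: "(\<lambda>k. G k e) sums (\<Sum>\<^sub>\<infinity>N\<in>{1..}. F N e)" .
    have "(\<lambda>k. G (Suc k) e) sums (\<Sum>\<^sub>\<infinity>k\<in>{1..}. G k e)"
      by (rule infsum_atLeast1_sums) (use summable_on_SigmaD1[of "\<lambda>e k. G k e"] Gs' e in blast)
    hence "(\<lambda>k. G k e) sums (\<Sum>\<^sub>\<infinity>k\<in>{1..}. G k e)" using sums_Suc_iff[of "\<lambda>k. G k e"] by (simp add: G_def)
    with 1 show ?thesis by (rule sums_unique2)
  qed
  have GW: "(\<Sum>\<^sub>\<infinity>e\<in>{1..}. G k e) = Sfun a k * of_real (W k - W (Suc k))" if k: "k \<in> {1..}" for k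
  proof -
    have "((\<lambda>e. - (moebius_mu e * \<phi> (Suc k * e))) has_sum (- W (Suc k))) {1..}"
      unfolding has_sum_uminus minus_minus by (rule W) simp
    hence "((\<lambda>e. moebius_mu e * \<phi> (k * e) + - (moebius_mu e * \<phi> (Suc k * e))) has_sum (W k + - W (Suc k))) {1..}"
      using k by (intro has_sum_add W) simp_all
    hence "((\<lambda>e. moebius_mu e * (\<phi> (k * e) - \<phi> (Suc k * e))) has_sum (W k - W (Suc k))) {1..}"
      by (simp add: right_diff_distrib)
    from has_sum_cmult_right[OF has_sum_of_real[OF this, where 'a = complex], of "Sfun a k"] show ?thesis
      by (intro infsumI) (simp add: G_def mult_ac)
  qed
  have "T = (\<Sum>\<^sub>\<infinity>e\<in>{1..}. \<Sum>\<^sub>\<infinity>N\<in>{1..}. F N e)" unfolding T_def by (rule infsum_swap_banach[OF Fs])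
  also have "\<dots> = (\<Sum>\<^sub>\<infinity>e\<in>{1..}. \<Sum>\<^sub>\<infinity>k\<in>{1..}. G k e)" by (rule infsum_cong) (rule FG)
  also have "\<dots> = (\<Sum>\<^sub>\<infinity>k\<in>{1..}. \<Sum>\<^sub>\<infinity>e\<in>{1..}. G k e)" by (rule infsum_swap_banach[OF Gs'])
  also have "\<dots> = (\<Sum>\<^sub>\<infinity>k\<in>{1..}. Sfun a k * of_real (W k - W (Suc k)))" by (rule infsum_cong) (rule GW)
  finally have "T = (\<Sum>\<^sub>\<infinity>k\<in>{1..}. Sfun a k * of_real (W k - W (Suc k)))" .
  moreover have "(\<lambda>k. Sfun a k * of_real (W k - W (Suc k))) summable_on {1..}"
  proof -
    have "(\<lambda>k. \<Sum>\<^sub>\<infinity>e\<in>{1..}. G k e) summable_on {1..}"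
      using summable_on_Sigma_banach[of G "{1..}" "\<lambda>_. {1..}"] Gs by simp
    thus ?thesis using GW by (subst (asm) summable_on_cong) auto
  qed
  ultimately have "((\<lambda>k. Sfun a k * of_real (W k - W (Suc k))) has_sum T) {1..}" by (simp add: has_sum_infsum)
  with sums show ?thesis by blast
qed

section \<open>The two kernels to which partial summation is applied\<close>

lemma Sfun_growth:
  assumes "((\<lambda>k. norm (Sfun a k) / real k powr v) \<longlongrightarrow> 0) at_top"
  shows "\<exists>M\<ge>0. \<forall>k\<ge>1. norm (Sfun a k) \<le> M * real k powr v"
proof -
  have "Bseq (\<lambda>k. norm (Sfun a k) / real k powr v)"
    by (rule convergent_imp_Bseq) (use assms in \<open>auto simp: convergent_def\<close>)
  then obtain M where M: "M > 0" "\<And>k. norm (norm (Sfun a k) / real k powr v) \<le> M" by (auto elim: BseqE)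
  have "norm (Sfun a k) \<le> M * real k powr v" if "k \<ge> 1" for k
    using M(2)[of k] that by (simp add: field_simps)
  thus ?thesis using M(1) by (intro exI[of _ M]) auto
qed

lemma powr_over_ln_bounds:
  assumes v: "v > 1" and m: "m \<ge> 1"
  shows "\<bar>real m powr (-v) / ln (real m)\<bar> \<le> (4 + 4 * v) * real m powr (-v)"
    and "\<bar>real m powr (-v) / ln (real m) - real (Suc m) powr (-v) / ln (real (Suc m))\<bar> \<le> (4 + 4 * v) * real m powr (-1 - v)"
proof -
  have base: "\<bar>real j powr (-v) / ln (real j)\<bar> \<le> 2 * real j powr (-v)" if "j \<ge> 1" for j
  proof (cases "j = 1")
    case False
    hence j: "j \<ge> 2" using that by simp
    have "real j powr (-v) * (1 / ln (real j)) \<le> real j powr (-v) * 2"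
      by (intro mult_left_mono inverse_ln_le_2 j) auto
    thus ?thesis using j by (simp add: abs_mult)
  qed simp
  have "2 * real m powr (-v) \<le> (4 + 4 * v) * real m powr (-v)" using v by (intro mult_right_mono) auto
  thus "\<bar>real m powr (-v) / ln (real m)\<bar> \<le> (4 + 4 * v) * real m powr (-v)" using base[OF m] by linarith
  show "\<bar>real m powr (-v) / ln (real m) - real (Suc m) powr (-v) / ln (real (Suc m))\<bar> \<le> (4 + 4 * v) * real m powr (-1 - v)"
  \<comment> \<open>At \<open>m = 1\<close> the first quotient is 0 by division by
    \<open>ln 1\<close>, so the increment is just the value at 2.\<close>
  proof (cases "m = 1")
    case True
    have "\<bar>real 2 powr (-v) / ln (real 2)\<bar> \<le> 2 * real 2 powr (-v)" by (rule base) simp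
    also have "\<dots> \<le> 2 * 1" using v powr_mono2'[of "-v" 1 2] by (intro mult_left_mono) auto
    also have "\<dots> \<le> 4 + 4 * v" using v by simp
    finally show ?thesis using True by (simp add: numeral_2_eq_2)
  next
    case False
    hence m2: "m \<ge> 2" using m by simp
    define x y lx ly where "x = real m powr (-v)" and "y = real (Suc m) powr (-v)"
      and "lx = ln (real m)" and "ly = ln (real (Suc m))"
    have lx: "lx \<ge> 1 / 2" unfolding lx_def by (rule ln_ge_half[OF m2])
    have lxy: "lx \<le> ly" unfolding lx_def ly_def using m2 by (intro ln_mono) auto
    have dl: "ly - lx \<le> 1 / real m"
    proof -
      have "ln (real (Suc m) / real m) \<le> real (Suc m) / real m - 1" by (rule ln_le_minus_one) (use m2 in auto)
      thus ?thesis using m2 unfolding lx_def ly_def by (simp add: ln_div field_simps)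
    qed
    have xy: "0 \<le> x - y" "x - y \<le> v * real m powr (-1 - v)"
      using powr_minus_diff_bounds(1)[of "real m" v] v m2 unfolding x_def y_def
      by (auto simp: add.commute intro!: powr_mono2')
    have xm: "x / real m = real m powr (-1 - v)" unfolding x_def by (rule powr_minus_one_minus[symmetric]) (use m2 in auto)
    have eq: "x / lx - y / ly = x * ((ly - lx) / (lx * ly)) + (x - y) / ly"
      using lx lxy by (simp add: field_simps)
    have "(ly - lx) / (lx * ly) \<le> (1 / real m) / (1 / 2 * (1 / 2))"
      using dl lx lxy by (intro frac_le mult_mono) auto
    hence "x * ((ly - lx) / (lx * ly)) \<le> x * ((1 / real m) / (1 / 2 * (1 / 2)))"
      by (intro mult_left_mono) (auto simp: x_def)
    also have "\<dots> = 4 * real m powr (-1 - v)" by (simp add: xm[symmetric])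
    finally have 1: "x * ((ly - lx) / (lx * ly)) \<le> 4 * real m powr (-1 - v)" .
    have "(x - y) / ly \<le> (v * real m powr (-1 - v)) / (1 / 2)" using xy lx lxy v by (intro frac_le) auto
    also have "\<dots> \<le> 4 * v * real m powr (-1 - v)" using v by simp
    finally have 2: "(x - y) / ly \<le> 4 * v * real m powr (-1 - v)" .
    have "0 \<le> x * ((ly - lx) / (lx * ly))" "0 \<le> (x - y) / ly"
      using lx lxy xy by (auto simp: x_def)
    hence "\<bar>x / lx - y / ly\<bar> \<le> (4 + 4 * v) * real m powr (-1 - v)"
      unfolding eq distrib_right using 1 2 by linarith
    thus ?thesis by (simp add: x_def y_def lx_def ly_def)
  qed
qed

text \<open>Partial summation with kernel m^-v / ln m and growth exponent (1 + v)/2, midway between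
  1 and v. Multiplying by ln m returns m^-v except at m = 1, where both the logarithm and the kernel
  are 0; one term does not affect convergence.\<close>

lemma summable_dirichlet_series:
  assumes S: "\<forall>v>1. ((\<lambda>k. norm (Sfun a k) / real k powr v) \<longlongrightarrow> 0) at_top" and v: "v > 1"
  shows "summable (\<lambda>m. a (Suc m) / of_real (real (Suc m) powr v))"
proof -
  define \<phi> where "\<phi> = (\<lambda>m. real m powr (-v) / ln (real m))"
  have "(1 + v) / 2 > 1" using v by simp
  then obtain M where M: "M \<ge> 0" "\<And>k. k \<ge> 1 \<Longrightarrow> norm (Sfun a k) \<le> M * real k powr ((1 + v) / 2)"
    using Sfun_growth S by blast
  have "\<exists>T. (\<lambda>m. a (Suc m) * of_real (ln (real (Suc m)) * \<phi> (Suc m))) sums T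
     \<and> ((\<lambda>k. Sfun a k * of_real (smooth_weight (v - 1) k - smooth_weight (v - 1) (Suc k))) has_sum T) {1..}"
  proof (rule abel_summation_moebius[where q = v and D = "4 + 4 * v" and v = "(1 + v) / 2" and M = M])
    fix k :: nat assume k: "k \<ge> 1"
    show "\<bar>\<phi> k\<bar> \<le> (4 + 4 * v) * real k powr (-v)" "\<bar>\<phi> k - \<phi> (Suc k)\<bar> \<le> (4 + 4 * v) * real k powr (-1 - v)"
      unfolding \<phi>_def by (rule powr_over_ln_bounds[OF v k])+
    show "((\<lambda>e. moebius_mu e * \<phi> (k * e)) has_sum smooth_weight (v - 1) k) {1..}"
      using has_sum_infsum[OF summable_on_smooth_weight[of "v - 1" k "{1..}"]] v
      by (simp add: \<phi>_def smooth_weight_def)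
  qed (use M v in auto)
  then obtain T where "(\<lambda>m. a (Suc m) * of_real (ln (real (Suc m)) * \<phi> (Suc m))) sums T" by blast
  hence "summable (\<lambda>m. a (Suc m) * of_real (ln (real (Suc m)) * \<phi> (Suc m)))" by (rule sums_summable)
  moreover have "\<forall>\<^sub>F m in sequentially. a (Suc m) * of_real (ln (real (Suc m)) * \<phi> (Suc m)) = a (Suc m) / of_real (real (Suc m) powr v)"
    using eventually_ge_at_top[of 1]
  proof eventually_elim
    case (elim m)
    hence "ln (real (Suc m)) > 0" by simp
    hence "ln (real (Suc m)) * \<phi> (Suc m) = 1 / real (Suc m) powr v" by (simp add: \<phi>_def powr_minus_divide)
    thus ?case by simp
  qed
  ultimately show ?thesis by (subst (asm) summable_cong) auto
qed

text \<open>\<open>D\<close> may depend on \<open>n\<close>, since it only secures convergence in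
  the partial summation. The floor part vanishes beyond \<open>n\<close> and thus satisfies any
  power bound with such a constant; the smooth part is \<open>powr_over_ln_bounds\<close>.\<close>

lemma floor_kernel_bounds:
  assumes n: "n \<ge> 2"
  shows "\<exists>D. \<forall>m\<ge>1. \<bar>floor_kernel n m\<bar> \<le> D * real m powr (-1 - 1 / ln (real n))
    \<and> \<bar>floor_kernel n m - floor_kernel n (Suc m)\<bar> \<le> D * real m powr (-2 - 1 / ln (real n))"
proof -
  define v where "v = 1 + 1 / ln (real n)"
  have v: "v > 1" using n by (simp add: v_def)
  define f where "f = (\<lambda>m. real (n div m) / ln (real m))"
  define g where "g = (\<lambda>m. real m powr (-v) / ln (real m))"
  have k: "floor_kernel n m = f m - real n * g m" for m
    by (simp add: floor_kernel_def f_def g_def v_def diff_divide_distrib)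
  define c where "c = 2 * real n * real n powr (1 + v)"
  have f_le: "\<bar>f m\<bar> \<le> c * real m powr (-1 - v)" if m: "m \<ge> 1" for m
  proof (cases "m \<le> n \<and> m \<noteq> 1")
    case True
    have "real (n div m) * (1 / ln (real m)) \<le> real n * 2"
      using True m by (intro mult_mono inverse_ln_le_2) auto
    also have "\<dots> = 2 * real n * (real n powr (1 + v) * real n powr (-1 - v))"
      using n by (simp add: powr_add[symmetric])
    also have "\<dots> \<le> 2 * real n * (real n powr (1 + v) * real m powr (-1 - v))"
      using True m v by (intro mult_left_mono powr_mono2') auto
    finally show ?thesis using m by (simp add: f_def c_def abs_mult)
  next
    case False
    hence "f m = 0" using m by (auto simp: f_def)
    thus ?thesis by (simp add: c_def)
  qed
  have c0: "c \<ge> 0" by (simp add: c_def)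
  have f_le': "\<bar>f m\<bar> \<le> c * real m powr (-v)" if m: "m \<ge> 1" for m
  proof -
    have "c * real m powr (-1 - v) \<le> c * real m powr (-v)" using m c0 by (intro mult_left_mono powr_mono) auto
    thus ?thesis using f_le[OF m] by linarith
  qed
  have f_le'': "\<bar>f (Suc m)\<bar> \<le> c * real m powr (-1 - v)" if m: "m \<ge> 1" for m
  proof -
    have "c * real (Suc m) powr (-1 - v) \<le> c * real m powr (-1 - v)" using m c0 v by (intro mult_left_mono powr_mono2') auto
    thus ?thesis using f_le[of "Suc m"] by linarith
  qed
  define D where "D = 2 * c + real n * (4 + 4 * v)"
  have "\<bar>floor_kernel n m\<bar> \<le> D * real m powr (-v) \<and> \<bar>floor_kernel n m - floor_kernel n (Suc m)\<bar> \<le> D * real m powr (-1 - v)" if m: "m \<ge> 1" for m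
  proof
    have g1: "real n * \<bar>g m\<bar> \<le> real n * ((4 + 4 * v) * real m powr (-v))"
      unfolding g_def by (intro mult_left_mono powr_over_ln_bounds v m) auto
    have "\<bar>floor_kernel n m\<bar> \<le> \<bar>f m\<bar> + real n * \<bar>g m\<bar>" unfolding k using abs_triangle_ineq4[of "f m" "real n * g m"] by (simp add: abs_mult)
    also have "\<dots> \<le> c * real m powr (-v) + real n * ((4 + 4 * v) * real m powr (-v))" using f_le'[OF m] g1 by linarith
    also have "\<dots> \<le> D * real m powr (-v)" using c0 by (simp add: D_def algebra_simps)
    finally show "\<bar>floor_kernel n m\<bar> \<le> D * real m powr (-v)" .
    have g2: "real n * \<bar>g m - g (Suc m)\<bar> \<le> real n * ((4 + 4 * v) * real m powr (-1 - v))"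
      unfolding g_def by (intro mult_left_mono powr_over_ln_bounds v m) auto
    have "floor_kernel n m - floor_kernel n (Suc m) = f m - f (Suc m) - real n * (g m - g (Suc m))" by (simp add: k algebra_simps)
    hence "\<bar>floor_kernel n m - floor_kernel n (Suc m)\<bar> \<le> \<bar>f m\<bar> + \<bar>f (Suc m)\<bar> + \<bar>real n * (g m - g (Suc m))\<bar>" by linarith
    also have "\<dots> = \<bar>f m\<bar> + \<bar>f (Suc m)\<bar> + real n * \<bar>g m - g (Suc m)\<bar>" by (simp add: abs_mult)
    also have "\<dots> \<le> c * real m powr (-1 - v) + c * real m powr (-1 - v) + real n * ((4 + 4 * v) * real m powr (-1 - v))"
      using f_le[OF m] f_le''[OF m] g2 by linarith
    also have "\<dots> = D * real m powr (-1 - v)" by (simp add: D_def algebra_simps)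
    finally show "\<bar>floor_kernel n m - floor_kernel n (Suc m)\<bar> \<le> D * real m powr (-1 - v)" .
  qed
  moreover have "-1 - 1 / ln (real n) = -v" "-2 - 1 / ln (real n) = -1 - v" by (simp_all add: v_def)
  ultimately show ?thesis by (simp only:) blast
qed

lemma infsum_atLeast_eq_suminf:
  fixes g :: "nat \<Rightarrow> real"
  assumes "g summable_on {n..}"
  shows "infsum g {n..} = (\<Sum>j. g (j + n))"
proof -
  have "(g has_sum infsum g {n..}) {n..}" using assms by (rule has_sum_infsum)
  moreover have "{n..} = range (\<lambda>j. j + n)" by (auto simp: image_iff intro: le_add_diff_inverse2[symmetric])
  ultimately have "(g has_sum infsum g {n..}) (range (\<lambda>j. j + n))" by metis
  hence "((g \<circ> (\<lambda>j. j + n)) has_sum infsum g {n..}) UNIV" by (subst (asm) has_sum_reindex) auto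
  from has_sum_imp_sums[OF this] show ?thesis by (simp add: sums_iff o_def)
qed

text \<open>Partial summation with \<open>floor_kernel n\<close>, which decays with exponent 1 + b,
  so 1 + b/2 is an admissible growth exponent. Coefficients with k <= n are kept as they are; those
  with k > n are compared with the tail series.\<close>

lemma floor_sum_deviation_bound:
  assumes S: "\<forall>v>1. ((\<lambda>k. norm (Sfun a k) / real k powr v) \<longlongrightarrow> 0) at_top" and n: "n \<ge> 2"
  shows "norm ((\<Sum>m=1..n. a m * of_nat (n div m)) - of_real (real n) * gser a (1 + 1 / ln (real n)))
    \<le> 12 * ((\<Sum>k=2..n. \<bar>weight_diff n k - weight_diff n (Suc k)\<bar> * norm (Sfun a k))
       + real n / ln (real n) * (\<Sum>j. norm (Sfun a (j + n)) /
           (real (j + n) powr (2 + 1 / ln (real n)) * ln (real (j + n)))))"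
proof -
  define b where "b = 1 / ln (real n)"
  define v where "v = 1 + b / 2"
  have b: "b > 0" "b \<le> 2" using n inverse_ln_le_2[OF n] by (auto simp: b_def)
  hence "v > 1" by (simp add: v_def)
  then obtain M where M: "M \<ge> 0" "\<And>k. k \<ge> 1 \<Longrightarrow> norm (Sfun a k) \<le> M * real k powr v"
    using Sfun_growth S by blast
  obtain D where D: "\<And>m. m \<ge> 1 \<Longrightarrow> \<bar>floor_kernel n m\<bar> \<le> D * real m powr (-1 - b)"
    "\<And>m. m \<ge> 1 \<Longrightarrow> \<bar>floor_kernel n m - floor_kernel n (Suc m)\<bar> \<le> D * real m powr (-2 - b)"
    using floor_kernel_bounds[OF n] unfolding b_def[symmetric] by blast
  have q: "-(1 + b) = -1 - b" "-1 - (1 + b) = -2 - b" by simp_all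
  have "\<exists>T. (\<lambda>m. a (Suc m) * of_real (ln (real (Suc m)) * floor_kernel n (Suc m))) sums T
     \<and> ((\<lambda>k. Sfun a k * of_real (weight_diff n k - weight_diff n (Suc k))) has_sum T) {1..}"
  proof (rule abel_summation_moebius[where q = "1 + b" and D = D and v = v and M = M])
    show "\<bar>floor_kernel n m\<bar> \<le> D * real m powr (-(1 + b))" if "m \<ge> 1" for m unfolding q by (rule D[OF that])
    show "\<bar>floor_kernel n m - floor_kernel n (Suc m)\<bar> \<le> D * real m powr (-1 - (1 + b))" if "m \<ge> 1" for m
      unfolding q by (rule D[OF that])
    show "1 < v" "v < 1 + b" using b by (simp_all add: v_def)
  qed (rule M weight_diff_has_sum[OF n] | assumption)+
  then obtain T where T: "(\<lambda>m. a (Suc m) * of_real (ln (real (Suc m)) * floor_kernel n (Suc m))) sums T"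
     "((\<lambda>k. Sfun a k * of_real (weight_diff n k - weight_diff n (Suc k))) has_sum T) {1..}" by blast

  have T_eq: "(\<Sum>m=1..n. a m * of_nat (n div m)) - of_real (real n) * gser a (1 + b) = T"
  proof (rule sums_unique2[OF _ T(1)])
    have "(\<lambda>m. a (Suc m) / of_real (real (Suc m) powr (1 + b))) sums gser a (1 + b)"
      unfolding gser_def by (rule summable_sums, rule summable_dirichlet_series[OF S]) (use b in simp)
    moreover have "(\<lambda>m. a (Suc m) * of_nat (n div Suc m)) sums (\<Sum>m<n. a (Suc m) * of_nat (n div Suc m))"
      by (rule sums_finite) auto
    ultimately have "(\<lambda>m. a (Suc m) * of_nat (n div Suc m) - of_real (real n) * (a (Suc m) / of_real (real (Suc m) powr (1 + b))))
      sums ((\<Sum>m<n. a (Suc m) * of_nat (n div Suc m)) - of_real (real n) * gser a (1 + b))"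
      by (intro sums_diff sums_mult)
    moreover have "a (Suc m) * of_nat (n div Suc m) - of_real (real n) * (a (Suc m) / of_real (real (Suc m) powr (1 + b)))
       = a (Suc m) * of_real (ln (real (Suc m)) * floor_kernel n (Suc m))" for m
    proof -
      define y where "y = real (Suc m) powr (1 + b)"
      have E: "real (n div Suc m) - real n * real (Suc m) powr (-(1 + b)) = ln (real (Suc m)) * floor_kernel n (Suc m)"
      \<comment> \<open>For the first term \<open>ln 1 = 0\<close> on the right matches
        \<open>n div 1 - n = 0\<close> on the left, so the default value of
        \<open>floor_kernel n 1\<close> does no harm.\<close>
      proof (cases "m = 0")
        case False
        hence "ln (real (Suc m)) > 0" by simp
        thus ?thesis unfolding q by (simp add: floor_kernel_def b_def)
      qed simp
      show ?thesis unfolding E[symmetric] powr_minus_divide y_def[symmetric] by (simp add: right_diff_distrib)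
    qed
    moreover have "(\<Sum>m<n. a (Suc m) * of_nat (n div Suc m)) = (\<Sum>m=1..n. a m * of_nat (n div m))"
      by (simp add: sum.atLeast1_atMost_eq)
    ultimately show "(\<lambda>m. a (Suc m) * of_real (ln (real (Suc m)) * floor_kernel n (Suc m)))
       sums ((\<Sum>m=1..n. a m * of_nat (n div m)) - of_real (real n) * gser a (1 + b))" by simp
  qed

  define c where "c = (\<lambda>k. \<bar>weight_diff n k - weight_diff n (Suc k)\<bar>)"
  define t where "t = (\<lambda>k. norm (Sfun a k) / (real k powr (2 + b) * ln (real k)))"
  have ts: "t summable_on {n..}"
  proof (rule summable_on_comparison_test)
    show "(\<lambda>k. 2 * M * real k powr (-1 - b / 2)) summable_on {n..}"
      using b by (intro summable_on_cmult_right summable_on_powr) auto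
    fix k assume "k \<in> {n..}"
    hence k: "k \<ge> 2" using n by simp
    have lk: "ln (real k) > 0" using k by simp
    have "t k = norm (Sfun a k) * (1 / ln (real k)) * real k powr (-(2 + b))"
      unfolding t_def powr_minus_divide by simp
    also have "\<dots> \<le> (M * real k powr v) * 2 * real k powr (-(2 + b))"
      using M k lk by (intro mult_right_mono mult_mono inverse_ln_le_2) auto
    also have "\<dots> = 2 * M * (real k powr v * real k powr (-(2 + b)))" by (simp add: mult_ac)
    also have "real k powr v * real k powr (-(2 + b)) = real k powr (-1 - b / 2)"
      by (simp add: powr_add[symmetric] v_def)
    finally show "t k \<le> 2 * M * real k powr (-1 - b / 2)" .
    show "0 \<le> t k" using lk by (simp add: t_def)
  qed
  define F1 where "F1 = (\<lambda>k. if k \<in> {2..n} then c k * norm (Sfun a k) else 0)"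
  define F2 where "F2 = (\<lambda>k. if k \<in> {n..} then 12 * (real n * b) * t k else 0)"
  have F1s: "(F1 has_sum (\<Sum>k=2..n. c k * norm (Sfun a k))) {1..}"
    by (rule has_sum_finite_neutralI[of "{2..n}"]) (auto simp: F1_def)
  have "((\<lambda>k. 12 * (real n * b) * t k) has_sum (12 * (real n * b) * infsum t {n..})) {n..}"
    by (rule has_sum_cmult_right[OF has_sum_infsum[OF ts]])
  hence F2s: "(F2 has_sum (12 * (real n * b) * infsum t {n..})) {1..}"
    by (subst has_sum_cong_neutral[where T = "{n..}" and g = "\<lambda>k. 12 * (real n * b) * t k"])
       (use n in \<open>auto simp: F2_def\<close>)
  have "norm T \<le> (\<Sum>k=2..n. c k * norm (Sfun a k)) + 12 * (real n * b) * infsum t {n..}"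
  proof (rule norm_infsum_le[OF T(2) has_sum_add[OF F1s F2s]])
    fix k :: nat assume k: "k \<in> {1..}"
    have t0: "t k \<ge> 0" using k by (simp add: t_def)
    have c0: "c k \<ge> 0" by (simp add: c_def)
    have N: "norm (Sfun a k * of_real (weight_diff n k - weight_diff n (Suc k))) = c k * norm (Sfun a k)"
      by (simp only: norm_mult norm_of_real c_def mult.commute)
    consider "k = 1" | "k \<in> {2..n}" | "k > n" using k by (cases "k = 1"; cases "k \<le> n") auto
    thus "norm (Sfun a k * of_real (weight_diff n k - weight_diff n (Suc k))) \<le> F1 k + F2 k"
    proof cases
      case 1
      thus ?thesis using t0 b c0 by (simp add: F1_def F2_def)
    next
      case 2
      thus ?thesis unfolding N using t0 b by (simp add: F1_def F2_def)
    next
      case 3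
      have k2: "k \<ge> 2" using 3 n by simp
      have bk: "1 / ln (real k) \<le> b" unfolding b_def using 3 n by (intro divide_left_mono ln_mono mult_pos_pos) auto
      \<comment> \<open>Only the smooth part is left, and \<open>bk\<close> is the hypothesis of
        \<open>smooth_weight_diff_le\<close>, the source of the constant 12.\<close>
      have "weight_diff n k - weight_diff n (Suc k) = - (real n * (smooth_weight b k - smooth_weight b (Suc k)))"
        using 3 by (simp add: weight_diff_def floor_weight_eq_0 b_def algebra_simps)
      hence "c k = real n * (smooth_weight b k - smooth_weight b (Suc k))"
        unfolding c_def using smooth_weight_antimono[OF b(1) k2] by (simp add: abs_mult)
      also have "\<dots> \<le> real n * (12 * b / ln (real k) * real k powr (-2 - b))"
        by (intro mult_left_mono smooth_weight_diff_le b k2 bk) auto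
      finally have "c k * norm (Sfun a k) \<le> real n * (12 * b / ln (real k) * real k powr (-2 - b)) * norm (Sfun a k)"
        by (intro mult_right_mono) auto
      also have "real k powr (-2 - b) = 1 / real k powr (2 + b)"
        using powr_minus_divide[of "real k" "2 + b"] by simp
      also have "real n * (12 * b / ln (real k) * (1 / real k powr (2 + b))) * norm (Sfun a k) = F2 k"
        using 3 by (simp add: F2_def t_def mult_ac)
      finally show ?thesis unfolding N using 3 by (simp add: F1_def)
    qed
  qed
  also have "\<dots> \<le> 12 * ((\<Sum>k=2..n. c k * norm (Sfun a k)) + real n * b * infsum t {n..})"
  proof -
    have "0 \<le> (\<Sum>k=2..n. c k * norm (Sfun a k))" by (intro sum_nonneg) (simp add: c_def)
    thus ?thesis by simp
  qed
  finally show ?thesis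
    unfolding T_eq[symmetric] infsum_atLeast_eq_suminf[OF ts] by (simp add: c_def t_def b_def)
qed

theorem theorem5:
  shows "\<exists>c :: nat \<Rightarrow> nat \<Rightarrow> real.
    (\<forall>n\<ge>2. \<forall>k\<in>{2..n}. c n k \<ge> 0)
    \<and> (\<forall>\<epsilon>::real. 0 < \<epsilon> \<and> \<epsilon> \<le> 1 \<longrightarrow>
         (\<exists>C>0. \<forall>n::nat\<ge>2.
            (\<Sum>k=2..n-1. c n k * real k * ln (real k) powr \<epsilon>)
              \<le> C * real n * ln (real n) powr (\<epsilon> - 1)))
    \<and> (\<forall>k\<ge>2. ((\<lambda>n. c n k / real n) \<longlongrightarrow> 0) at_top)
    \<and> (\<exists>A>0. \<forall>a :: nat \<Rightarrow> complex.
         (\<forall>v>1. ((\<lambda>k. norm (Sfun a k) / real k powr v) \<longlongrightarrow> 0) at_top) \<longrightarrow>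
         (\<forall>v>1. summable (\<lambda>m. a (Suc m) / of_real (real (Suc m) powr v)))
         \<and> (\<forall>n::nat\<ge>2.
              norm ((\<Sum>m=1..n. a m * of_nat (n div m))
                    - of_real (real n) * gser a (1 + 1 / ln (real n)))
              \<le> A * ((\<Sum>k=2..n. c n k * norm (Sfun a k))
                     + real n / ln (real n) *
                       (\<Sum>j. norm (Sfun a (j + n)) /
                          (real (j + n) powr (2 + 1 / ln (real n)) * ln (real (j + n)))))))"
proof -
  define c where "c = (\<lambda>n k. \<bar>weight_diff n k - weight_diff n (Suc k)\<bar>)"
  obtain C where C: "C > 0" "\<And>n. n \<ge> 2 \<Longrightarrow> (\<Sum>k=2..n. real k * c n k) \<le> C * (real n / ln (real n))"
    unfolding c_def using weight_diff_total_variation by blast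
  have c0: "c n k \<ge> 0" for n k by (simp add: c_def)
  \<comment> \<open>Replacing (ln k)^eps by (ln n)^eps loses nothing essential against the total
    variation bound, and the resulting constant does not even depend on eps.\<close>
  have i: "(\<Sum>k=2..n-1. c n k * real k * ln (real k) powr \<epsilon>) \<le> C * real n * ln (real n) powr (\<epsilon> - 1)"
    if \<epsilon>: "0 < \<epsilon>" and n: "n \<ge> 2" for \<epsilon> :: real and n :: nat
  proof -
    have "(\<Sum>k=2..n-1. c n k * real k * ln (real k) powr \<epsilon>) \<le> (\<Sum>k=2..n-1. c n k * real k * ln (real n) powr \<epsilon>)"
      using \<epsilon> c0 by (intro sum_mono mult_left_mono powr_mono2 ln_mono) auto
    also have "\<dots> \<le> (\<Sum>k=2..n. c n k * real k * ln (real n) powr \<epsilon>)"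
      using c0 by (intro sum_mono2) auto
    also have "\<dots> = (\<Sum>k=2..n. real k * c n k) * ln (real n) powr \<epsilon>"
      by (simp add: sum_distrib_left mult_ac)
    also have "\<dots> \<le> C * (real n / ln (real n)) * ln (real n) powr \<epsilon>"
      by (intro mult_right_mono C n) auto
    also have "\<dots> = C * real n * ln (real n) powr (\<epsilon> - 1)" using n by (simp add: powr_diff)
    finally show ?thesis .
  qed
  \<comment> \<open>A single term of the total variation gives c(n,k) <= C n / ln n.\<close>
  have ii: "((\<lambda>n. c n k / real n) \<longlongrightarrow> 0) at_top" if k: "k \<ge> 2" for k
  proof (rule Lim_null_comparison)
    show "\<forall>\<^sub>F n in at_top. norm (c n k / real n) \<le> C * (1 / ln (real n))"
      using eventually_ge_at_top[of k]
    proof eventually_elim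
      case (elim n)
      have "1 * c n k \<le> real k * c n k" using k c0 by (intro mult_right_mono) auto
      also have "\<dots> \<le> (\<Sum>k=2..n. real k * c n k)" by (rule member_le_sum) (use elim k c0 in auto)
      also have "\<dots> \<le> C * (real n / ln (real n))" by (rule C) (use elim k in simp)
      finally have "c n k / real n \<le> C * (real n / ln (real n)) / real n" by (intro divide_right_mono) auto
      thus ?case using elim k c0 by simp
    qed
    show "((\<lambda>n. C * (1 / ln (real n))) \<longlongrightarrow> 0) at_top" by real_asymp
  qed
  show ?thesis
  proof (intro exI[of _ c] conjI)
    show "\<exists>A>0. \<forall>a :: nat \<Rightarrow> complex.
         (\<forall>v>1. ((\<lambda>k. norm (Sfun a k) / real k powr v) \<longlongrightarrow> 0) at_top) \<longrightarrow>
         (\<forall>v>1. summable (\<lambda>m. a (Suc m) / of_real (real (Suc m) powr v)))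
         \<and> (\<forall>n::nat\<ge>2.
              norm ((\<Sum>m=1..n. a m * of_nat (n div m))
                    - of_real (real n) * gser a (1 + 1 / ln (real n)))
              \<le> A * ((\<Sum>k=2..n. c n k * norm (Sfun a k))
                     + real n / ln (real n) *
                       (\<Sum>j. norm (Sfun a (j + n)) /
                          (real (j + n) powr (2 + 1 / ln (real n)) * ln (real (j + n))))))"
      unfolding c_def
      by (intro exI[of _ "12::real"] conjI allI impI summable_dirichlet_series floor_sum_deviation_bound) auto
  qed (use c0 i ii C(1) in blast)+
qed

end
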